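(* Let $0\le m,\lambda,a^-,b^+\in C_b(\mathbb{R}_+\times\mathbb{R}^d)$, and let $a^+:\mathbb{R}_+\times\mathbb{R}^d\to\mathbb{R}_+$ be such that $a^+(t,\cdot)$ is a probability density on $\mathbb{R}^d$ for all $t\ge0$. Suppose that for any compact $\Lambda\subset\mathbb{R}^d$ and $T>0$ there exists $a^*\in L^1(\mathbb{R}^d)$ which satisfies $$a^+(t,x-y)\le a^*(y),\qquad x\in\Lambda,\ t\in[0,T],\ y\in\mathbb{R}^d.$$ Moreover, assume that $b^+(t,x)\le a^-(t,x)$ holds for all $x\in\mathbb{R}^d$ and $t\ge0$. Consider on $\Gamma_0$ the transition function $$Q(t,\eta,A)=\sum_{x\in\eta}\Big(m(t,x)+\sum_{y\in\eta\backslash x}a^-(t,x-y)\Big)\mathbf{1}_A(\eta\backslash x)+\frac1e\sum_{x\in\eta}\Big(\lambda(t,x)+\sum_{y\in\eta\backslash x}b^+(t,x-y)\Big)\int_{\Gamma_0\backslash\{\emptyset\}}\mathbf{1}_A(\eta\cup\zeta)\prod_{w\in\zeta}a^+(t,x-w)\,d\lambda_{LP}(\zeta),$$ and let $q(t,\eta)=Q(t,\eta,\Gamma_0)$. Then the following conditions are satisfied for $V(\eta)=|\eta|+|\eta|^2$: (A) For any $\varepsilon>0$, $T>0$ and any compact $B\subset\Gamma_0$ there exists a compact $A\subset\Gamma_0$ such that $\int_0^TQ(r,\eta,A^c)\,dr<\varepsilon$ for all $\eta\in B$. (B) There exists a continuous function $c:\mathbb{R}_+\to\mathbb{R}_+$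 such that $\int_{\Gamma_0}V(\omega)\,Q(t,\eta,d\omega)\le c(t)V(\eta)+q(t,\eta)V(\eta)$ for all $t\ge0$, $\eta\in\Gamma_0$. (C) For any continuous $F:\Gamma_0\to\mathbb{R}$ with $\sup_{\eta\in\Gamma_0}\frac{|F(\eta)|}{1+V(\eta)}<\infty$ the map $(t,\eta)\mapsto\int_{\Gamma_0}F(\omega)\,Q(t,\eta,d\omega)$ is continuous. (D) For any $T>0$ there exists $a(T)>0$ such that $q(t,\eta)\le a(T)V(\eta)$ for all $\eta\in\Gamma_0$ and $t\in[0,T]$.
   Context: $\Gamma_0=\{\eta\subset\mathbb{R}^d : |\eta|<\infty\}=\bigsqcup_{n\ge0}\Gamma_0^{(n)}$ is the space of finite subsets of $\mathbb{R}^d$, where $|\eta|$ is the cardinality and $\Gamma_0^{(n)}=\{\eta\subset\mathbb{R}^d : |\eta|=n\}$. $\Gamma_0^{(n)}$ carries the quotient topology under $(x_1,\dots,x_n)\mapsto\{x_1,\dots,x_n\}$ from the set of $n$-tuples of pairwise distinct points of $\mathbb{R}^d$, and $\Gamma_0$ the disjoint union topology; it is a locally compact Polish space, equipped with its Borel $\sigma$-algebra. We write $\eta\backslash x$ for $\eta\backslash\{x\}$. $C_b(\mathbb{R}_+\times\mathbb{R}^d)$ is the space of bounded continuous functions on $\mathbb{R}_+\times\mathbb{R}^d$. $\lambda_{LP}=\delta_\emptyset+\sum_{n\ge1}\frac1{n!}d^{(n)}x$ is the Lebesgue-Poisson measure on $\Gamma_0$ (not to be confused with the intensity function $\lambda$),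 where $d^{(n)}x$ is the image on $\Gamma_0^{(n)}$ of Lebesgue measure on $(\mathbb{R}^d)^n$ under $(x_1,\dots,x_n)\mapsto\{x_1,\dots,x_n\}$. The (pre-)generator of this (generalized Dieckmann-Law) model is $L(t)F(\eta)=\int_{\Gamma_0}(F(\omega)-F(\eta))\,Q(t,\eta,d\omega)$.
   Formalization: It is additionally assumed that t ↦ a⁺(t,y)dy is weakly continuous on R₊; without this (C) fails, e.g. d=1, λ=1, m=a⁻=b⁺=0, a⁺(t,·)=1_[0,1] for t≤1 and 1_[1,2] for t>1. *)

theory Defs
  imports "HOL-Analysis.Analysis" "HOL-Library.FSet"
begin

text \<open>
  The space of finite configurations is the type \<open>'a fset\<close>, where \<open>'a\<close> is a Euclidean space.
  An \<open>n\<close>-tuple of points is a function on \<open>{..<n}\<close>, extended by \<open>undefined\<close>, as in the library's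
  product topology and product measure.
\<close>

definition distinct_tuples :: "nat \<Rightarrow> (nat \<Rightarrow> 'a) set" where
  "distinct_tuples n = {x \<in> {..<n} \<rightarrow>\<^sub>E UNIV. inj_on x {..<n}}"

definition tuple_topology :: "nat \<Rightarrow> (nat \<Rightarrow> 'a::topological_space) topology" where
  "tuple_topology n =
     subtopology (product_topology (\<lambda>_. euclidean) {..<n}) (distinct_tuples n)"

definition conf_of :: "nat \<Rightarrow> (nat \<Rightarrow> 'a) \<Rightarrow> 'a fset" where
  "conf_of n x = fset_of_list (map x [0..<n])"

lemma fset_conf_of [simp]: "fset (conf_of n x) = x ` {..<n}"
  by (auto simp: conf_of_def fset_of_list.rep_eq)

lemma topspace_tuple_topology [simp]: "topspace (tuple_topology n) = distinct_tuples n"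
  by (auto simp: tuple_topology_def distinct_tuples_def)

text \<open>
  Disjoint union topology of the quotient topologies on the \<open>n\<close>-point configurations; the lemmas
  \<open>open_fcard_eq\<close> and \<open>quotient_map_conf_of\<close> below confirm this reading of the definition.
\<close>

instantiation fset :: (topological_space) topological_space
begin

definition open_fset :: "'a fset set \<Rightarrow> bool" where
  "open_fset U \<longleftrightarrow> (\<forall>n. openin (tuple_topology n) {x \<in> distinct_tuples n. conf_of n x \<in> U})"

instance
proof
  show "open (UNIV :: 'a fset set)"
    unfolding open_fset_def
  proof
    fix n
    have "{x \<in> distinct_tuples n. conf_of n x \<in> (UNIV :: 'a fset set)} = topspace (tuple_topology n)"
      by simp
    then show "openin (tuple_topology n) {x \<in> distinct_tuples n. conf_of n x \<in> (UNIV :: 'a fset set)}"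
      by (simp only: openin_topspace)
  qed
next
  fix S T :: "'a fset set"
  assume ST: "open S" "open T"
  show "open (S \<inter> T)"
    unfolding open_fset_def
  proof
    fix n
    have "{x \<in> distinct_tuples n. conf_of n x \<in> S \<inter> T} =
        {x \<in> distinct_tuples n. conf_of n x \<in> S} \<inter> {x \<in> distinct_tuples n. conf_of n x \<in> T}"
      by auto
    then show "openin (tuple_topology n) {x \<in> distinct_tuples n. conf_of n x \<in> S \<inter> T}"
      using ST by (simp add: open_fset_def openin_Int)
  qed
next
  fix K :: "'a fset set set"
  assume K: "\<forall>S\<in>K. open S"
  show "open (\<Union>K)"
    unfolding open_fset_def
  proof
    fix n
    have "{x \<in> distinct_tuples n. conf_of n x \<in> \<Union>K} =
        \<Union>((\<lambda>S. {x \<in> distinct_tuples n. conf_of n x \<in> S}) ` K)"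
      by auto
    then show "openin (tuple_topology n) {x \<in> distinct_tuples n. conf_of n x \<in> \<Union>K}"
      using K by (auto simp: open_fset_def intro!: openin_Union)
  qed
qed

end

lemma fcard_conf_of: "x \<in> distinct_tuples n \<Longrightarrow> fcard (conf_of n x) = n"
  by (simp add: fcard.rep_eq distinct_tuples_def card_image)

lemma open_fcard_eq: "open {\<eta> :: 'a::topological_space fset. fcard \<eta> = n}"
  unfolding open_fset_def
proof
  fix k
  have "{x \<in> distinct_tuples k. conf_of k x \<in> {\<eta> :: 'a fset. fcard \<eta> = n}} =
      (if k = n then topspace (tuple_topology k) else {})"
    by (auto simp: fcard_conf_of)
  then show "openin (tuple_topology k)
      {x \<in> distinct_tuples k. conf_of k x \<in> {\<eta> :: 'a fset. fcard \<eta> = n}}"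
    by (cases "k = n") (simp_all only: openin_empty openin_topspace if_True if_False refl)
qed

lemma quotient_map_conf_of:
  "quotient_map (tuple_topology n) (top_of_set {\<eta> :: 'a::topological_space fset. fcard \<eta> = n})
     (conf_of n)"
proof -
  have surj: "conf_of n ` distinct_tuples n = {\<eta> :: 'a fset. fcard \<eta> = n}"
  proof (intro equalityI subsetI)
    fix \<eta> :: "'a fset" assume "\<eta> \<in> {\<eta>. fcard \<eta> = n}"
    then have "card (fset \<eta>) = n" by (simp add: fcard.rep_eq)
    then obtain h where h: "bij_betw h {..<n} (fset \<eta>)"
      by (metis bij_betw_iff_card card_lessThan finite_fset finite_lessThan)
    define x where "x = restrict h {..<n}"
    have "x \<in> distinct_tuples n"
      using h by (auto simp: x_def distinct_tuples_def bij_betw_def inj_on_def)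
    moreover have "fset (conf_of n x) = fset \<eta>"
      using h by (auto simp: x_def bij_betw_def)
    ultimately show "\<eta> \<in> conf_of n ` distinct_tuples n"
      by (metis fset_inject image_eqI)
  qed (auto simp: fcard_conf_of)
  have "openin (tuple_topology n) {x \<in> distinct_tuples n. conf_of n x \<in> U} \<longleftrightarrow> open U"
    if U: "U \<subseteq> {\<eta> :: 'a fset. fcard \<eta> = n}" for U
  proof
    assume n: "openin (tuple_topology n) {x \<in> distinct_tuples n. conf_of n x \<in> U}"
    show "open U"
      unfolding open_fset_def
    proof
      fix k
      show "openin (tuple_topology k) {x \<in> distinct_tuples k. conf_of k x \<in> U}"
      proof (cases "k = n")
        case False
        then have "{x \<in> distinct_tuples k. conf_of k x \<in> U} = {}"
          using U by (auto dest!: fcard_conf_of)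
        then show ?thesis by (simp only: openin_empty)
      qed (use n in simp)
    qed
  qed (simp add: open_fset_def)
  then show ?thesis
    by (simp add: quotient_map_def surj openin_open_eq[OF open_fcard_eq])
qed

definition lebesgue_conf :: "nat \<Rightarrow> 'a::euclidean_space fset measure" where
  "lebesgue_conf n =
     distr (restrict_space (PiM {..<n} (\<lambda>_. lborel)) (distinct_tuples n)) borel (conf_of n)"

definition lebesgue_poisson :: "'a::euclidean_space fset measure" where
  "lebesgue_poisson = measure_of UNIV (sets borel)
     (\<lambda>A. indicator A {||} + (\<Sum>n. ennreal (1 / fact (Suc n)) * emeasure (lebesgue_conf (Suc n)) A))"

text \<open>
  Functions on \<open>\<real>\<^sub>+ \<times> \<real>\<^sup>d\<close> are functions on \<open>real \<times> 'a\<close>, all of whose properties are only required on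
  \<open>{0..} \<times> UNIV\<close>.
\<close>

definition nonneg_Cb :: "(real \<times> 'a::euclidean_space \<Rightarrow> real) \<Rightarrow> bool" where
  "nonneg_Cb f \<longleftrightarrow> continuous_on ({0..} \<times> UNIV) f \<and> bounded (f ` ({0..} \<times> UNIV)) \<and>
     (\<forall>t\<ge>0. \<forall>x. 0 \<le> f (t, x))"

definition prob_density :: "('a::euclidean_space \<Rightarrow> real) \<Rightarrow> bool" where
  "prob_density f \<longleftrightarrow> f \<in> borel_measurable borel \<and> (\<forall>x. 0 \<le> f x) \<and>
     (\<integral>\<^sup>+x. ennreal (f x) \<partial>lborel) = 1"

text \<open>
  Continuity of \<open>t \<mapsto> f(t, y) dy\<close> for the weak convergence of measures. It follows from continuity of
  \<open>f\<close>, or of \<open>t \<mapsto> f(t, \<cdot>)\<close> in \<open>L\<^sup>1\<close>, when the \<open>f(t, \<cdot>)\<close> are probability densities.  Without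
  it condition (C) below can fail: with \<open>l = 1\<close>, \<open>m = am = bp = 0\<close> and
  \<open>F(\<eta>) = (\<Sum>w\<in>\<eta>. g w)\<close> for a bounded continuous \<open>g\<close>, the integral of \<open>F\<close> against \<open>transition\<close> at
  \<open>\<eta> = {x}\<close> is \<open>(1 - 1/e) g(x) + \<integral> g(x - y) ap(t, y) dy\<close>.
\<close>

definition narrowly_continuous :: "(real \<times> 'a::euclidean_space \<Rightarrow> real) \<Rightarrow> bool" where
  "narrowly_continuous f \<longleftrightarrow> (\<forall>g :: 'a \<Rightarrow> real. continuous_on UNIV g \<and> bounded (range g) \<longrightarrow>
     continuous_on {0..} (\<lambda>t. \<integral>y. g y * f (t, y) \<partial>lborel))"

definition transition ::
  "(real \<times> 'a \<Rightarrow> real) \<Rightarrow> (real \<times> 'a \<Rightarrow> real) \<Rightarrow> (real \<times> 'a \<Rightarrow> real) \<Rightarrow> (real \<times> 'a \<Rightarrow> real) \<Rightarrow>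
   (real \<times> 'a \<Rightarrow> real) \<Rightarrow> real \<Rightarrow> 'a::euclidean_space fset \<Rightarrow> 'a fset measure" where
  "transition m am l bp ap t \<eta> = measure_of UNIV (sets borel) (\<lambda>A.
     (\<Sum>x\<in>fset \<eta>. ennreal (m (t, x) + (\<Sum>y\<in>fset (\<eta> |-| {|x|}). am (t, x - y)))
        * indicator A (\<eta> |-| {|x|}))
     + ennreal (1 / exp 1)
        * (\<Sum>x\<in>fset \<eta>. ennreal (l (t, x) + (\<Sum>y\<in>fset (\<eta> |-| {|x|}). bp (t, x - y)))
            * (\<integral>\<^sup>+\<zeta>\<in>UNIV - {{||}}. indicator A (\<eta> |\<union>| \<zeta>) * (\<Prod>w\<in>fset \<zeta>. ennreal (ap (t, x - w)))
                \<partial>lebesgue_poisson)))"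

definition total_rate :: "(real \<Rightarrow> 'a::topological_space fset \<Rightarrow> 'a fset measure) \<Rightarrow> real \<Rightarrow> 'a fset \<Rightarrow> ennreal"
  where "total_rate Q t \<eta> = emeasure (Q t \<eta>) UNIV"

definition lyapunov :: "'a fset \<Rightarrow> real" where
  "lyapunov \<eta> = real (fcard \<eta>) + (real (fcard \<eta>))\<^sup>2"

definition condition_A :: "(real \<Rightarrow> 'a::topological_space fset \<Rightarrow> 'a fset measure) \<Rightarrow> bool" where
  "condition_A Q \<longleftrightarrow> (\<forall>\<epsilon>>0. \<forall>T>0. \<forall>B. compact B \<longrightarrow>
     (\<exists>A. compact A \<and>
        (\<forall>\<eta>\<in>B. (\<integral>\<^sup>+r\<in>{0..T}. emeasure (Q r \<eta>) (- A) \<partial>lborel) < ennreal \<epsilon>)))"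

definition condition_B ::
  "('a fset \<Rightarrow> real) \<Rightarrow> (real \<Rightarrow> 'a::topological_space fset \<Rightarrow> 'a fset measure) \<Rightarrow> bool" where
  "condition_B V Q \<longleftrightarrow> (\<exists>c :: real \<Rightarrow> real. continuous_on {0..} c \<and> (\<forall>t\<ge>0. 0 \<le> c t) \<and>
     (\<forall>t\<ge>0. \<forall>\<eta>. (\<integral>\<^sup>+\<omega>. ennreal (V \<omega>) \<partial>Q t \<eta>)
        \<le> ennreal (c t * V \<eta>) + total_rate Q t \<eta> * ennreal (V \<eta>)))"

text \<open>
  Integrability is stated explicitly since the Bochner integral of a non-integrable function is 0.
\<close>

definition condition_C ::
  "('a fset \<Rightarrow> real) \<Rightarrow> (real \<Rightarrow> 'a::topological_space fset \<Rightarrow> 'a fset measure) \<Rightarrow> bool" where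
  "condition_C V Q \<longleftrightarrow> (\<forall>F :: 'a fset \<Rightarrow> real.
     continuous_on UNIV F \<and> bdd_above (range (\<lambda>\<eta>. \<bar>F \<eta>\<bar> / (1 + V \<eta>))) \<longrightarrow>
     (\<forall>t\<ge>0. \<forall>\<eta>. integrable (Q t \<eta>) F) \<and>
     continuous_on ({0..} \<times> UNIV) (\<lambda>(t, \<eta>). \<integral>\<omega>. F \<omega> \<partial>Q t \<eta>))"

definition condition_D ::
  "('a fset \<Rightarrow> real) \<Rightarrow> (real \<Rightarrow> 'a::topological_space fset \<Rightarrow> 'a fset measure) \<Rightarrow> bool" where
  "condition_D V Q \<longleftrightarrow> (\<forall>T>0. \<exists>a>0. \<forall>\<eta>. \<forall>t\<in>{0..T}. total_rate Q t \<eta> \<le> ennreal (a * V \<eta>))"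

end

theory Submission
  imports Defs "HOL-Probability.Giry_Monad"
begin

text \<open>
  Every integral against the transition function is a sum over the parents \<open>x \<in> \<eta>\<close> and over the number
  \<open>k \<ge> 1\<close> of children, whose positions have density \<open>\<Prod>i<k. a\<^sup>+(t, x - w\<^sub>i)\<close> with weight \<open>1 / k!\<close>; the
  total mass of these weights is \<open>e - 1\<close> (\<open>transition_mixture\<close>, \<open>nn_integral_offspring\<close>).

  Condition (D) holds since the coefficients are bounded and \<open>|\<eta>| + |\<eta>|\<^sup>2\<close> bounds the number of terms in the
  rates. In (B), \<open>k\<close> births raise \<open>V\<close> by at most \<open>(1 + 2|\<eta>|) k + k\<^sup>2\<close>, which sums to \<open>3 + 2|\<eta>|\<close> under the
  weights \<open>1 / (e k!)\<close>, while a death lowers \<open>V\<close> by \<open>2|\<eta>|\<close>. Summed over the pairs of interacting points the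
  births thus contribute a term that is cubic in \<open>|\<eta>|\<close>; since \<open>b\<^sup>+ \<le> a\<^sup>-\<close>, the deaths cancel it.

  For (C), take \<open>(t\<^sub>j, \<eta>\<^sub>j) \<rightarrow> (t, \<eta>)\<close> and label the points so that they converge one by one. The function
  \<open>w \<mapsto> F(\<eta>\<^sub>j \<union> {w\<^sub>1, \<dots>, w\<^sub>k})\<close> may be discontinuous where points collide, so convergence of the dispersal laws
  against continuous test functions is not enough. But the densities \<open>a\<^sup>+(t\<^sub>j, x\<^sub>j - w)\<close> have a common
  integrable majorant, and continuous functions are dense in the \<open>L\<^sup>1\<close> space of the majorant; hence they
  converge against all bounded measurable functions (\<open>tendsto_integral_bounded_measurable\<close>). This
  passes to product densities by Fubini (\<open>tendsto_integral_product_density\<close>), and the integrands may vary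
  with \<open>j\<close> as long as they converge almost everywhere (\<open>tendsto_integral_perturb\<close>), which they do because
  the children almost surely avoid the parents and each other. Tannery's theorem sums over \<open>k\<close>.

  Condition (A) is a consequence of (C). Let \<open>W\<close> be a continuous function with compact sublevel
  sets (\<open>spread\<close>) and let \<open>\<phi>\<^sub>n\<close> be \<open>W - n\<close> truncated to \<open>[0, 1]\<close>. The integrals of \<open>\<phi>\<^sub>n\<close> are continuous in
  \<open>(t, \<eta>)\<close> and decrease to \<open>0\<close> pointwise, hence uniformly on the compact set \<open>[0, T] \<times> B\<close> by Dini's argument;
  and \<open>\<phi>\<^sub>n\<close> is \<open>1\<close> off a compact set.
\<close>

section \<open>Configurations as images of injective sequences\<close>

text \<open>
  The first \<open>n\<close> entries of a sequence serve as the tuple and the others are arbitrary. In contrast to the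
  extensional tuples these sequences form an open subset of the type \<open>nat \<Rightarrow> 'a\<close>, whose product topology is
  metrizable, so that continuity can be tested on sequences there.
\<close>

definition distinct_seqs :: "nat \<Rightarrow> (nat \<Rightarrow> 'a) set" where
  "distinct_seqs n = {x. inj_on x {..<n}}"

lemma conf_of_cong: "(\<And>i. i < n \<Longrightarrow> x i = y i) \<Longrightarrow> conf_of n x = conf_of n y"
  unfolding conf_of_def by (intro arg_cong[where f=fset_of_list] map_cong) auto

lemma conf_of_eqI: "x ` {..<n} = y ` {..<k} \<Longrightarrow> conf_of n x = conf_of k y"
  by (simp add: fset_inject[symmetric])

lemma fcard_conf_of_distinct: "x \<in> distinct_seqs n \<Longrightarrow> fcard (conf_of n x) = n"
  by (simp add: fcard.rep_eq distinct_seqs_def card_image)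

lemma conf_of_surj:
  obtains n x where "x \<in> distinct_seqs n" "\<eta> = conf_of n x"
proof -
  obtain h where h: "bij_betw h {..<card (fset \<eta>)} (fset \<eta>)"
    by (metis bij_betw_iff_card card_lessThan finite_fset finite_lessThan)
  then have "h \<in> distinct_seqs (card (fset \<eta>))" "fset (conf_of (card (fset \<eta>)) h) = fset \<eta>"
    by (auto simp: distinct_seqs_def bij_betw_def)
  then show thesis
    using that by (metis fset_inject)
qed

lemma open_distinct_seqs: "open (distinct_seqs n :: (nat \<Rightarrow> 'a::t2_space) set)"
proof -
  have "distinct_seqs n = (\<Inter>i\<in>{..<n}. \<Inter>j\<in>{..<n} - {i}. {x :: nat \<Rightarrow> 'a. x i \<noteq> x j})"
    by (auto simp: distinct_seqs_def inj_on_def)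
  also have "open \<dots>"
    by (intro open_INT ballI open_Collect_neq continuous_on_product_coordinates) auto
  finally show ?thesis .
qed

text \<open>
  Restricting sequences to \<open>{..<n}\<close> is continuous, and so is the inclusion of the extensional tuples into the
  sequences. Both maps preserve the configuration, so the quotient topology can equally be taken from the
  product topology of \<open>nat \<Rightarrow> 'a\<close>.
\<close>

lemma open_fset_iff:
  "open (U :: 'a::t2_space fset set) \<longleftrightarrow> (\<forall>n. open {x \<in> distinct_seqs n. conf_of n x \<in> U})"
proof
  assume U: "open U"
  show "\<forall>n. open {x \<in> distinct_seqs n. conf_of n x \<in> U}"
  proof
    fix n
    have "openin (tuple_topology n) {x \<in> distinct_tuples n. conf_of n x \<in> U}"
      using U by (simp add: open_fset_def)
    then obtain W where W: "openin (product_topology (\<lambda>_. euclidean) {..<n}) W"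
      and eq: "{x \<in> distinct_tuples n. conf_of n x \<in> U} = W \<inter> distinct_tuples n"
      by (auto simp: tuple_topology_def openin_subtopology)
    have cont: "continuous_map euclidean (product_topology (\<lambda>_. euclidean) {..<n})
        (\<lambda>x :: nat \<Rightarrow> 'a. restrict x {..<n})"
      by (auto simp: continuous_map_componentwise)
    have "open {x. restrict x {..<n} \<in> W}"
      using openin_continuous_map_preimage[OF cont W] by simp
    moreover have "{x \<in> distinct_seqs n. conf_of n x \<in> U} =
        {x. restrict x {..<n} \<in> W} \<inter> distinct_seqs n"
    proof -
      have "restrict x {..<n} \<in> distinct_tuples n \<and> conf_of n (restrict x {..<n}) = conf_of n x"
        if "x \<in> distinct_seqs n" for x :: "nat \<Rightarrow> 'a"
        using that by (intro conjI conf_of_cong) (simp_all add: distinct_tuples_def distinct_seqs_def)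
      then have "x \<in> distinct_seqs n \<and> conf_of n x \<in> U \<longleftrightarrow>
          restrict x {..<n} \<in> W \<and> x \<in> distinct_seqs n" for x
        using eq[unfolded set_eq_iff, rule_format, of "restrict x {..<n}"] by auto
      then show ?thesis by blast
    qed
    ultimately show "open {x \<in> distinct_seqs n. conf_of n x \<in> U}"
      by (simp add: open_Int open_distinct_seqs)
  qed
next
  assume U: "\<forall>n. open {x \<in> distinct_seqs n. conf_of n x \<in> U}"
  show "open U"
    unfolding open_fset_def
  proof
    fix n
    have cont: "continuous_map (product_topology (\<lambda>_. euclidean) {..<n}) euclidean
        (\<lambda>x :: nat \<Rightarrow> 'a. x)"
    proof -
      have "continuous_map (product_topology (\<lambda>_. euclidean) {..<n}) euclidean
          (\<lambda>x :: nat \<Rightarrow> 'a. x i)" for i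
      proof (cases "i < n")
        case False
        then have "continuous_map (product_topology (\<lambda>_. euclidean) {..<n}) euclidean
            (\<lambda>x :: nat \<Rightarrow> 'a. undefined)" by simp
        then show ?thesis
          by (rule continuous_map_eq) (use False in \<open>auto simp: PiE_def extensional_def\<close>)
      qed (auto intro: continuous_map_product_projection)
      then show ?thesis
        by (simp add: euclidean_product_topology[symmetric] continuous_map_componentwise_UNIV)
    qed
    have "openin (product_topology (\<lambda>_. euclidean) {..<n})
        {x \<in> topspace (product_topology (\<lambda>_. euclidean) {..<n}). x \<in> {x \<in> distinct_seqs n. conf_of n x \<in> U}}"
      by (rule openin_continuous_map_preimage[OF cont]) (use U in simp)
    moreover have "{x \<in> distinct_tuples n. conf_of n x \<in> U} =
        {x \<in> topspace (product_topology (\<lambda>_. euclidean) {..<n}). x \<in> {x \<in> distinct_seqs n. conf_of n x \<in> U}}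
          \<inter> distinct_tuples n"
      by (auto simp: distinct_tuples_def distinct_seqs_def)
    ultimately show "openin (tuple_topology n) {x \<in> distinct_tuples n. conf_of n x \<in> U}"
      unfolding tuple_topology_def openin_subtopology by blast
  qed
qed

lemma continuous_on_conf_of:
  "continuous_on (distinct_seqs n :: (nat \<Rightarrow> 'a::t2_space) set) (conf_of n)"
  unfolding continuous_on_open_vimage[OF open_distinct_seqs]
  by (auto simp: open_fset_iff vimage_def Int_def conj_commute)

text \<open>
  The map to configurations is open: the set of all sequences with a configuration in the image
  of \<open>W\<close> is the union, over the permutations of the first \<open>n\<close> indices and over all changes of the tail, of
  preimages of \<open>W\<close> under continuous maps.
\<close>

lemma open_conf_of_image:
  fixes W :: "(nat \<Rightarrow> 'a::t2_space) set"
  assumes W: "open W" "W \<subseteq> distinct_seqs n"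
  shows "open (conf_of n ` W)"
  unfolding open_fset_iff
proof
  fix k
  show "open {y \<in> distinct_seqs k. conf_of k y \<in> conf_of n ` W}"
  proof (cases "k = n")
    case False
    then have "{y \<in> distinct_seqs k. conf_of k y \<in> conf_of n ` W} = {}"
      using W(2) by (auto dest!: fcard_conf_of_distinct)
    then show ?thesis by (simp only: open_empty)
  next
    case [simp]: True
    let ?r = "\<lambda>\<sigma> z y. (\<lambda>i. if i < n then y (\<sigma> i) else z i) :: nat \<Rightarrow> 'a"
    have "{y \<in> distinct_seqs n. conf_of n y \<in> conf_of n ` W} =
        (\<Union>\<sigma>\<in>{\<sigma>. bij_betw \<sigma> {..<n} {..<n}}. \<Union>z. {y. ?r \<sigma> z y \<in> W})" (is "?L = ?R")
    proof (intro equalityI subsetI)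
      fix y assume "y \<in> ?L"
      then obtain x where y: "inj_on y {..<n}" and x: "x \<in> W" "conf_of n y = conf_of n x"
        by (auto simp: distinct_seqs_def)
      have im: "y ` {..<n} = x ` {..<n}"
        using x(2) by (metis fset_conf_of)
      have "bij_betw x {..<n} (y ` {..<n})"
        using x W(2) im by (auto simp: distinct_seqs_def bij_betw_def)
      moreover have "bij_betw (inv_into {..<n} y) (y ` {..<n}) {..<n}"
        using y by (simp add: bij_betw_inv_into inj_on_imp_bij_betw)
      ultimately have "bij_betw (inv_into {..<n} y \<circ> x) {..<n} {..<n}"
        by (rule bij_betw_trans)
      moreover have "?r (inv_into {..<n} y \<circ> x) x y = x"
        using im by (auto simp: fun_eq_iff f_inv_into_f)
      ultimately show "y \<in> ?R"
        using x(1) by (intro UN_I[of "inv_into {..<n} y \<circ> x"] UN_I[of x]) auto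
    next
      fix y assume "y \<in> ?R"
      then obtain \<sigma> z where s: "bij_betw \<sigma> {..<n} {..<n}" and x: "?r \<sigma> z y \<in> W"
        by auto
      have "inj_on (?r \<sigma> z y) {..<n}"
        using x W(2) by (auto simp: distinct_seqs_def)
      then have "inj_on (y \<circ> \<sigma>) {..<n}"
        by (rule inj_on_cong[THEN iffD1, rotated]) auto
      then have "y \<in> distinct_seqs n"
        using s by (metis bij_betw_def distinct_seqs_def inj_on_imageI mem_Collect_eq)
      moreover have "conf_of n y = conf_of n (?r \<sigma> z y)"
      proof (rule conf_of_eqI)
        have "(?r \<sigma> z y) ` {..<n} = y ` \<sigma> ` {..<n}" by (auto simp: image_iff)
        then show "y ` {..<n} = (?r \<sigma> z y) ` {..<n}" using s by (simp add: bij_betw_def)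
      qed
      ultimately show "y \<in> ?L"
        using x by auto
    qed
    moreover have "open {y. ?r \<sigma> z y \<in> W}" for \<sigma> z
    proof -
      have "continuous_on UNIV (?r \<sigma> z)"
      proof (rule continuous_on_coordinatewise_then_product)
        fix i show "continuous_on UNIV (\<lambda>y. if i < n then y (\<sigma> i) else z i)"
          by (cases "i < n") auto
      qed
      then show ?thesis
        using open_vimage[OF W(1)] by (auto simp: vimage_def)
    qed
    ultimately show ?thesis by (auto intro!: open_UN)
  qed
qed

text \<open>
  A product of a quotient map with an identity need not be a quotient map, but a product of open maps is
  open. This is what allows joint continuity in a parameter and a configuration to be checked on tuples.
\<close>

lemma continuous_on_fset_prodI:
  fixes \<Phi> :: "'c::topological_space \<times> 'a::t2_space fset \<Rightarrow> 'b::topological_space"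
  assumes "\<And>n. continuous_on (S \<times> distinct_seqs n) (\<lambda>(t, x). \<Phi> (t, conf_of n x))"
  shows "continuous_on (S \<times> UNIV) \<Phi>"
  unfolding continuous_on_open_invariant
proof (intro allI impI)
  fix B :: "'b set" assume B: "open B"
  have "\<exists>A. open A \<and> A \<inter> (S \<times> distinct_seqs n) =
      (\<lambda>(t, x). \<Phi> (t, conf_of n x)) -` B \<inter> (S \<times> distinct_seqs n)" for n
    using assms[of n] B unfolding continuous_on_open_invariant by blast
  then obtain A where A: "\<And>n. open (A n)" "\<And>n. A n \<inter> (S \<times> distinct_seqs n) =
      (\<lambda>(t, x). \<Phi> (t, conf_of n x)) -` B \<inter> (S \<times> distinct_seqs n)"
    by metis
  define D where "D n = (\<lambda>(t, x). (t, conf_of n x)) ` (A n \<inter> UNIV \<times> distinct_seqs n)" for n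
  have "open (D n)" for n
  proof (rule open_prod_intro)
    fix p assume "p \<in> D n"
    then obtain t x where p: "p = (t, conf_of n x)" "(t, x) \<in> A n" "x \<in> distinct_seqs n"
      by (auto simp: D_def)
    then obtain P X where PX: "open P" "open X" "(t, x) \<in> P \<times> X" "P \<times> X \<subseteq> A n"
      using A(1) open_prod_elim by metis
    have "open (conf_of n ` (X \<inter> distinct_seqs n))"
      by (intro open_conf_of_image open_Int PX open_distinct_seqs) auto
    moreover have "p \<in> P \<times> conf_of n ` (X \<inter> distinct_seqs n)"
      using p PX by auto
    moreover have "P \<times> conf_of n ` (X \<inter> distinct_seqs n) \<subseteq> D n"
      using PX(4) by (force simp: D_def)
    ultimately show "\<exists>A B. open A \<and> open B \<and> p \<in> A \<times> B \<and> A \<times> B \<subseteq> D n"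
      using PX(1) by blast
  qed
  then have "open (\<Union>n. D n)" by (intro open_UN) auto
  moreover have "(\<Union>n. D n) \<inter> S \<times> UNIV = \<Phi> -` B \<inter> S \<times> UNIV"
  proof (intro equalityI subsetI)
    fix p assume "p \<in> (\<Union>n. D n) \<inter> S \<times> UNIV"
    then obtain n t x where p: "p = (t, conf_of n x)" "(t, x) \<in> A n" "x \<in> distinct_seqs n" "t \<in> S"
      by (auto simp: D_def)
    then have "(t, x) \<in> (\<lambda>(t, x). \<Phi> (t, conf_of n x)) -` B \<inter> (S \<times> distinct_seqs n)"
      unfolding A(2)[symmetric] by auto
    then show "p \<in> \<Phi> -` B \<inter> S \<times> UNIV" using p by auto
  next
    fix p assume p: "p \<in> \<Phi> -` B \<inter> S \<times> UNIV"
    obtain n x where x: "x \<in> distinct_seqs n" "snd p = conf_of n x"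
      using conf_of_surj by blast
    have "(fst p, x) \<in> (\<lambda>(t, x). \<Phi> (t, conf_of n x)) -` B \<inter> (S \<times> distinct_seqs n)"
      using p x by (auto simp: x(2)[symmetric])
    then have "(fst p, x) \<in> A n \<inter> (S \<times> distinct_seqs n)"
      unfolding A(2) .
    then have "(fst p, conf_of n x) \<in> D n"
      unfolding D_def using x(1) by (intro image_eqI[of _ _ "(fst p, x)"]) auto
    then have "p \<in> D n" by (simp add: x(2)[symmetric])
    then show "p \<in> (\<Union>n. D n) \<inter> S \<times> UNIV" using p by auto
  qed
  ultimately show "\<exists>A. open A \<and> A \<inter> S \<times> UNIV = \<Phi> -` B \<inter> S \<times> UNIV" by blast
qed

lemma continuous_on_fsetI:
  fixes F :: "'a::t2_space fset \<Rightarrow> 'b::topological_space"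
  assumes "\<And>n. continuous_on (distinct_seqs n) (\<lambda>x. F (conf_of n x))"
  shows "continuous_on UNIV F"
  unfolding continuous_on_open_vimage[OF open_UNIV]
proof (intro allI impI)
  fix B :: "'b set" assume B: "open B"
  have "open ((\<lambda>x. F (conf_of n x)) -` B \<inter> distinct_seqs n)" for n
    using assms[of n] B unfolding continuous_on_open_vimage[OF open_distinct_seqs] by blast
  then show "open (F -` B \<inter> UNIV)"
    by (simp add: open_fset_iff vimage_def Int_def conj_commute)
qed

lemma tendsto_coordinatewise:
  fixes X :: "'b \<Rightarrow> 'i \<Rightarrow> 'a::topological_space"
  assumes "\<And>i. ((\<lambda>j. X j i) \<longlongrightarrow> x i) F"
  shows "(X \<longlongrightarrow> x) F"
proof -
  have "limitin (product_topology (\<lambda>_. euclidean) UNIV) X x F"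
    using assms by (auto simp: limitin_componentwise)
  then show ?thesis by (simp add: euclidean_product_topology)
qed

lemma tendsto_conf_of:
  fixes X :: "'b \<Rightarrow> nat \<Rightarrow> 'a::t2_space"
  assumes "x \<in> distinct_seqs n" "\<And>i. i < n \<Longrightarrow> ((\<lambda>j. X j i) \<longlongrightarrow> x i) F"
  shows "((\<lambda>j. conf_of n (X j)) \<longlongrightarrow> conf_of n x) F"
proof -
  have lim: "((\<lambda>j i. if i < n then X j i else x i) \<longlongrightarrow> x) F"
  proof (rule tendsto_coordinatewise)
    fix i show "((\<lambda>j. if i < n then X j i else x i) \<longlongrightarrow> x i) F"
      using assms(2)[of i] by (cases "i < n") auto
  qed
  have "((\<lambda>j. conf_of n (\<lambda>i. if i < n then X j i else x i)) \<longlongrightarrow> conf_of n x) F"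
  proof (rule topological_tendstoI)
    fix S assume S: "open S" "conf_of n x \<in> S"
    then have "open {y \<in> distinct_seqs n. conf_of n y \<in> S}"
      by (simp add: open_fset_iff)
    from topological_tendstoD[OF lim this]
    have "\<forall>\<^sub>F j in F. (\<lambda>i. if i < n then X j i else x i) \<in> {y \<in> distinct_seqs n. conf_of n y \<in> S}"
      using S assms(1) by blast
    then show "\<forall>\<^sub>F j in F. conf_of n (\<lambda>i. if i < n then X j i else x i) \<in> S"
      by eventually_elim simp
  qed
  moreover have "conf_of n (\<lambda>i. if i < n then X j i else x i) = conf_of n (X j)" for j
    by (rule conf_of_cong) simp
  ultimately show ?thesis by simp
qed

lemma conf_of_funion:
  "conf_of n x |\<union>| conf_of k w = conf_of (n + k) (\<lambda>i. if i < n then x i else w (i - n))"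
proof -
  have "x ` {..<n} \<union> w ` {..<k} = (\<lambda>i. if i < n then x i else w (i - n)) ` {..<n + k}" (is "_ = ?h ` _")
  proof (intro equalityI subsetI)
    fix z assume "z \<in> x ` {..<n} \<union> w ` {..<k}"
    then consider i where "i < n" "z = x i" | i where "i < k" "z = w i" by auto
    then show "z \<in> ?h ` {..<n + k}"
    proof cases
      case 1 then show ?thesis by (intro image_eqI[of _ _ i]) auto
    next
      case 2 then show ?thesis by (intro image_eqI[of _ _ "i + n"]) auto
    qed
  next
    fix z assume "z \<in> ?h ` {..<n + k}"
    then show "z \<in> x ` {..<n} \<union> w ` {..<k}" by (auto split: if_splits)
  qed
  then show ?thesis by (simp add: fset_inject[symmetric])
qed

lemma distinct_seqs_append:
  assumes "x \<in> distinct_seqs n" "w \<in> distinct_seqs k" "x ` {..<n} \<inter> w ` {..<k} = {}"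
  shows "(\<lambda>i. if i < n then x i else w (i - n)) \<in> distinct_seqs (n + k)"
  unfolding distinct_seqs_def mem_Collect_eq
proof (rule inj_onI)
  fix i j assume ij: "i \<in> {..<n + k}" "j \<in> {..<n + k}"
    and eq: "(if i < n then x i else w (i - n)) = (if j < n then x j else w (j - n))"
  have *: "x a \<noteq> w b" if "a < n" "b < k" for a b using assms(3) that by blast
  have inj: "inj_on x {..<n}" "inj_on w {..<k}"
    using assms by (auto simp: distinct_seqs_def)
  consider "i < n" "j < n" | "i < n" "j - n < k" "\<not> j < n" | "j < n" "i - n < k" "\<not> i < n"
    | "\<not> i < n" "\<not> j < n" "i - n < k" "j - n < k"
    using ij by fastforce
  then show "i = j"
  proof cases
    case 1 then show ?thesis using eq inj(1) by (auto simp: inj_on_def)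
  next
    case 2 then show ?thesis using eq *[of i "j - n"] by simp
  next
    case 3 then show ?thesis using eq *[of j "i - n"] by simp
  next
    case 4
    then have "i - n = j - n" using eq inj(2) by (auto simp: inj_on_def)
    then show ?thesis using 4 by simp
  qed
qed

lemma tendsto_funion:
  fixes X :: "'b \<Rightarrow> nat \<Rightarrow> 'a::t2_space"
  assumes "x \<in> distinct_seqs n" "w \<in> distinct_seqs k" "x ` {..<n} \<inter> w ` {..<k} = {}"
    and "\<And>i. i < n \<Longrightarrow> ((\<lambda>j. X j i) \<longlongrightarrow> x i) F"
  shows "((\<lambda>j. conf_of n (X j) |\<union>| conf_of k w) \<longlongrightarrow> conf_of n x |\<union>| conf_of k w) F"
  unfolding conf_of_funion
proof (rule tendsto_conf_of[OF distinct_seqs_append[OF assms(1-3)]])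
  fix i assume "i < n + k"
  then show "((\<lambda>j. if i < n then X j i else w (i - n)) \<longlongrightarrow> (if i < n then x i else w (i - n))) F"
    using assms(4) by auto
qed

lemma conf_of_fminus:
  assumes "x \<in> distinct_seqs n" "i < n"
  shows "conf_of n x |-| {|x i|} = conf_of (n - 1) (\<lambda>j. if j < i then x j else x (Suc j))"
    and "(\<lambda>j. if j < i then x j else x (Suc j)) \<in> distinct_seqs (n - 1)"
proof -
  have inj: "inj_on x {..<n}" using assms by (simp add: distinct_seqs_def)
  have "x ` {..<n} - {x i} = (\<lambda>j. if j < i then x j else x (Suc j)) ` {..<n - 1}" (is "_ = ?h ` _")
  proof (intro equalityI subsetI)
    fix z assume "z \<in> x ` {..<n} - {x i}"
    then obtain j where j: "j < n" "z = x j" "j \<noteq> i" by auto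
    show "z \<in> ?h ` {..<n - 1}"
    proof (cases "j < i")
      case True then show ?thesis using j assms(2) by (intro image_eqI[of _ _ j]) auto
    next
      case False then show ?thesis using j by (intro image_eqI[of _ _ "j - 1"]) auto
    qed
  next
    fix z assume "z \<in> ?h ` {..<n - 1}"
    then show "z \<in> x ` {..<n} - {x i}"
      using inj assms(2) by (auto simp: inj_on_def split: if_splits)
  qed
  then show "conf_of n x |-| {|x i|} = conf_of (n - 1) ?h"
    by (simp add: fset_inject[symmetric])
  show "?h \<in> distinct_seqs (n - 1)"
    unfolding distinct_seqs_def mem_Collect_eq
  proof (rule inj_onI)
    fix a b assume ab: "a \<in> {..<n - 1}" "b \<in> {..<n - 1}" and eq: "?h a = ?h b"
    have "(if a < i then a else Suc a) = (if b < i then b else Suc b)"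
      by (rule inj_onD[OF inj]) (use ab eq in \<open>auto split: if_splits\<close>)
    then show "a = b" by (auto split: if_splits)
  qed
qed

lemma sum_conf_of:
  assumes "x \<in> distinct_seqs n"
  shows "(\<Sum>y\<in>fset (conf_of n x). g y) = (\<Sum>i<n. g (x i))"
    and "i < n \<Longrightarrow> (\<Sum>y\<in>fset (conf_of n x |-| {|x i|}). g y) = (\<Sum>j\<in>{..<n} - {i}. g (x j))"
proof -
  have inj: "inj_on x {..<n}" using assms by (simp add: distinct_seqs_def)
  then show "(\<Sum>y\<in>fset (conf_of n x). g y) = (\<Sum>i<n. g (x i))"
    by (simp add: sum.reindex)
  assume i: "i < n"
  have "fset (conf_of n x |-| {|x i|}) = x ` ({..<n} - {i})"
    using inj i by (auto simp: inj_on_def)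
  then show "(\<Sum>y\<in>fset (conf_of n x |-| {|x i|}). g y) = (\<Sum>j\<in>{..<n} - {i}. g (x j))"
    using inj by (simp add: sum.reindex inj_on_subset)
qed

section \<open>A proper function on the configuration space\<close>

text \<open>
  Escape to infinity and collision are the two ways in which a sequence of configurations of bounded
  cardinality can fail to accumulate; a bound on this quantity excludes both.
\<close>

definition spread :: "'a::real_normed_vector fset \<Rightarrow> real" where
  "spread \<eta> = real (fcard \<eta>) + (\<Sum>x\<in>fset \<eta>. norm x + (\<Sum>y\<in>fset (\<eta> |-| {|x|}). 1 / dist x y))"

lemma spread_conf_of:
  assumes "x \<in> distinct_seqs n"
  shows "spread (conf_of n x) = real n + (\<Sum>i<n. norm (x i) + (\<Sum>j\<in>{..<n} - {i}. 1 / dist (x i) (x j)))"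
  unfolding spread_def sum_conf_of(1)[OF assms] fcard_conf_of_distinct[OF assms]
  by (intro arg_cong2[where f="(+)"] sum.cong refl sum_conf_of(2)[OF assms]) simp

lemma continuous_on_spread: "continuous_on UNIV (spread :: 'a::real_normed_vector fset \<Rightarrow> real)"
proof (rule continuous_on_fsetI)
  fix n
  have "continuous_on (distinct_seqs n) (\<lambda>x :: nat \<Rightarrow> 'a. real n +
      (\<Sum>i<n. norm (x i) + (\<Sum>j\<in>{..<n} - {i}. 1 / dist (x i) (x j))))"
    by (intro continuous_intros continuous_on_subset[OF continuous_on_product_coordinates])
       (auto simp: distinct_seqs_def inj_on_def)
  then show "continuous_on (distinct_seqs n) (\<lambda>x :: nat \<Rightarrow> 'a. spread (conf_of n x))"
    by (rule continuous_on_eq) (simp add: spread_conf_of)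
qed

text \<open>
  A bound \<open>c\<close> on the spread bounds the number of points, their norms, and their inverse distances.
  For each cardinality, the tuples with entries in a ball and mutual distances at least \<open>1 / c\<close>
  form a compact set once the tail of the sequence is pinned to \<open>0\<close>.
\<close>

lemma spread_sublevel_in_compact:
  fixes c :: real
  obtains K :: "'a::euclidean_space fset set" where "compact K" "\<And>\<eta>. spread \<eta> \<le> c \<Longrightarrow> \<eta> \<in> K"
proof -
  define C where "C n = PiE UNIV (\<lambda>i. if i < n then cball 0 c else {0})
    \<inter> {x :: nat \<Rightarrow> 'a. \<forall>i\<in>{..<n}. \<forall>j\<in>{..<n} - {i}. 1 \<le> c * dist (x i) (x j)}" for n
  have compC: "compact (C n)" for n
  proof -
    have "compactin (product_topology (\<lambda>_. euclidean) UNIV)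
        (PiE UNIV (\<lambda>i. if i < n then cball 0 c else {0 :: 'a}))"
      by (auto simp: compactin_PiE)
    then have "compact (PiE UNIV (\<lambda>i. if i < n then cball 0 c else {0 :: 'a}))"
      by (simp add: euclidean_product_topology)
    moreover have "closed {x :: nat \<Rightarrow> 'a. \<forall>i\<in>{..<n}. \<forall>j\<in>{..<n} - {i}. 1 \<le> c * dist (x i) (x j)}"
      unfolding Collect_ball_eq
      by (intro closed_INT ballI closed_Collect_le continuous_intros continuous_on_product_coordinates)
    ultimately show ?thesis
      unfolding C_def by (rule compact_Int_closed)
  qed
  have sub: "C n \<subseteq> distinct_seqs n" for n
  proof
    fix x assume x: "x \<in> C n"
    have "x i \<noteq> x j" if "i < n" "j < n" "i \<noteq> j" for i j
    proof
      assume "x i = x j"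
      moreover have "1 \<le> c * dist (x i) (x j)" using x that by (auto simp: C_def)
      ultimately show False by simp
    qed
    then show "x \<in> distinct_seqs n" by (auto simp: distinct_seqs_def inj_on_def)
  qed
  define K where "K = (\<Union>n\<in>{n. real n \<le> c}. conf_of n ` C n)"
  have "finite {n. real n \<le> c}"
    by (rule finite_subset[of _ "{..nat \<lfloor>c\<rfloor>}"]) (auto simp: le_nat_floor)
  then have "compact K"
    unfolding K_def
    by (intro compact_UN compact_continuous_image compC continuous_on_subset[OF continuous_on_conf_of sub])
       auto
  moreover have "\<eta> \<in> K" if le: "spread \<eta> \<le> c" for \<eta>
  proof -
    obtain n x where x: "x \<in> distinct_seqs n" and \<eta>: "\<eta> = conf_of n x"
      using conf_of_surj by blast
    define y where "y i = (if i < n then x i else 0)" for i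
    have y: "y \<in> distinct_seqs n" and \<eta>y: "\<eta> = conf_of n y"
      using x \<eta> by (auto simp: y_def distinct_seqs_def inj_on_def intro!: conf_of_cong)
    have sp: "real n + (\<Sum>i<n. norm (y i) + (\<Sum>j\<in>{..<n} - {i}. 1 / dist (y i) (y j))) \<le> c"
      using le spread_conf_of[OF y] \<eta>y by simp
    have nn: "0 \<le> norm (y i) + (\<Sum>j\<in>{..<n} - {i}. 1 / dist (y i) (y j))" for i
      by (auto intro!: add_nonneg_nonneg sum_nonneg)
    have n: "real n \<le> c"
    proof -
      have "0 \<le> (\<Sum>i<n. norm (y i) + (\<Sum>j\<in>{..<n} - {i}. 1 / dist (y i) (y j)))"
        by (rule sum_nonneg) (rule nn)
      then show ?thesis using sp by linarith
    qed
    have row: "norm (y i) + (\<Sum>j\<in>{..<n} - {i}. 1 / dist (y i) (y j)) \<le> c" if "i < n" for i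
    proof -
      have "norm (y i) + (\<Sum>j\<in>{..<n} - {i}. 1 / dist (y i) (y j))
          \<le> (\<Sum>i<n. norm (y i) + (\<Sum>j\<in>{..<n} - {i}. 1 / dist (y i) (y j)))"
        using that by (intro member_le_sum nn) auto
      then show ?thesis using sp by simp
    qed
    have "norm (y i) \<le> c" if "i < n" for i
    proof -
      have "0 \<le> (\<Sum>j\<in>{..<n} - {i}. 1 / dist (y i) (y j))" by (intro sum_nonneg) auto
      then show ?thesis using row[OF that] by linarith
    qed
    moreover have "1 \<le> c * dist (y i) (y j)" if "i < n" "j < n" "j \<noteq> i" for i j
    proof -
      have "1 / dist (y i) (y j) \<le> (\<Sum>j\<in>{..<n} - {i}. 1 / dist (y i) (y j))"
        using that by (intro member_le_sum) auto
      then have "1 / dist (y i) (y j) \<le> c"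
        using row[OF that(1)] norm_ge_zero[of "y i"] by linarith
      moreover have "dist (y i) (y j) > 0"
        using y that by (auto simp: distinct_seqs_def inj_on_def)
      ultimately show ?thesis by (simp add: field_simps)
    qed
    ultimately have "y \<in> C n"
      by (auto simp: C_def y_def)
    then show ?thesis using n \<eta>y by (auto simp: K_def)
  qed
  ultimately show thesis using that by blast
qed

section \<open>The Borel sets of the configuration space\<close>

lemma measurable_tuple_as_sequence:
  "(\<lambda>x. x) \<in> PiM {..<n} (\<lambda>_. lborel) \<rightarrow>\<^sub>M (borel :: (nat \<Rightarrow> 'a::euclidean_space) measure)"
proof (rule measurable_coordinatewise_then_product)
  fix i
  show "(\<lambda>x. x i) \<in> borel_measurable (PiM {..<n} (\<lambda>_. lborel :: 'a measure))"
  proof (cases "i < n")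
    case True then show ?thesis by simp
  next
    case False
    then have "x i = undefined" if "x \<in> space (PiM {..<n} (\<lambda>_. lborel :: 'a measure))" for x
      using that by (auto simp: space_PiM PiE_def extensional_def)
    then show ?thesis by (subst measurable_cong[where g="\<lambda>_. undefined"]) auto
  qed
qed

lemma sets_tuples_of_sequences:
  assumes "S \<in> sets (borel :: (nat \<Rightarrow> 'a::euclidean_space) measure)" "S \<subseteq> distinct_seqs n"
  shows "S \<inter> distinct_tuples n \<in> sets (PiM {..<n} (\<lambda>_. lborel))"
proof -
  have "S \<inter> distinct_tuples n = (\<lambda>x. x) -` S \<inter> space (PiM {..<n} (\<lambda>_. lborel))"
    using assms(2) by (auto simp: distinct_tuples_def distinct_seqs_def space_PiM)
  then show ?thesis
    using measurable_sets[OF measurable_tuple_as_sequence assms(1)] by metis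
qed

lemma distinct_tuples_eq: "distinct_tuples n = distinct_seqs n \<inter> distinct_tuples n"
  by (auto simp: distinct_tuples_def distinct_seqs_def)

lemma sets_distinct_tuples [measurable]:
  "(distinct_tuples n :: (nat \<Rightarrow> 'a::euclidean_space) set) \<in> sets (PiM {..<n} (\<lambda>_. lborel))"
  using sets_tuples_of_sequences[OF borel_open[OF open_distinct_seqs], of n n]
  unfolding distinct_tuples_eq[symmetric] by simp

lemma space_restrict_distinct_tuples [simp]:
  "space (restrict_space (PiM {..<n} (\<lambda>_. lborel)) (distinct_tuples n)) =
     (distinct_tuples n :: (nat \<Rightarrow> 'a::euclidean_space) set)"
  using sets.sets_into_space[OF sets_distinct_tuples] by (auto simp: space_restrict_space)

lemma measurable_conf_of [measurable]:
  "conf_of n \<in> restrict_space (PiM {..<n} (\<lambda>_. lborel)) (distinct_tuples n)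
     \<rightarrow>\<^sub>M (borel :: 'a::euclidean_space fset measure)"
proof (rule borel_measurableI)
  fix S :: "'a fset set" assume "open S"
  then have "open {x \<in> distinct_seqs n. conf_of n x \<in> S}" by (simp add: open_fset_iff)
  then have "{x \<in> distinct_seqs n. conf_of n x \<in> S} \<inter> distinct_tuples n
      \<in> sets (PiM {..<n} (\<lambda>_. lborel))"
    by (intro sets_tuples_of_sequences borel_open) auto
  moreover have "conf_of n -` S \<inter> distinct_tuples n =
      {x \<in> distinct_seqs n. conf_of n x \<in> S} \<inter> distinct_tuples n"
    by (auto simp: distinct_tuples_def distinct_seqs_def)
  ultimately show "conf_of n -` S \<inter> space (restrict_space (PiM {..<n} (\<lambda>_. lborel)) (distinct_tuples n))
      \<in> sets (restrict_space (PiM {..<n} (\<lambda>_. lborel)) (distinct_tuples n))"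
    by (simp add: sets_restrict_space_iff sets.Int_space_eq2)
qed

lemma disjoint_cell:
  fixes b :: "nat \<Rightarrow> 'a::euclidean_space set"
  assumes b: "\<And>i. i < n \<Longrightarrow> open (b i)" "disjoint_family_on b {..<n}"
  shows "open {x. \<forall>i<n. x i \<in> b i}" and "{x. \<forall>i<n. x i \<in> b i} \<subseteq> distinct_seqs n"
proof -
  have "{x. \<forall>i<n. x i \<in> b i} = (\<Inter>i\<in>{..<n}. (\<lambda>x. x i) -` b i)" by auto
  also have "open \<dots>"
    using b(1) by (intro open_INT ballI open_vimage continuous_on_product_coordinates) auto
  finally show "open {x. \<forall>i<n. x i \<in> b i}" .
  show "{x. \<forall>i<n. x i \<in> b i} \<subseteq> distinct_seqs n"
    unfolding distinct_seqs_def
  proof (intro subsetI CollectI inj_onI)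
    fix x i j assume x: "x \<in> {x. \<forall>i<n. x i \<in> b i}" and ij: "i \<in> {..<n}" "j \<in> {..<n}" "x i = x j"
    then have "x i \<in> b i \<inter> b j" by auto
    then show "i = j"
      using b(2) ij(1,2) unfolding disjoint_family_on_def by (metis empty_iff)
  qed
qed

text \<open>
  Among \<open>n\<close>-point configurations with exactly one point in each of \<open>n\<close> disjoint open cells, the cells label the
  points. The label is continuous because the map to configurations is open.
\<close>

lemma measurable_point_in_cell:
  fixes b :: "nat \<Rightarrow> 'a::euclidean_space set"
  assumes b: "\<And>i. i < n \<Longrightarrow> open (b i)" "disjoint_family_on b {..<n}" and i: "i < n"
  defines "U \<equiv> {x. \<forall>i<n. x i \<in> b i}"
  shows "x \<in> U \<Longrightarrow> (THE y. y \<in> fset (conf_of n x) \<inter> b i) = x i"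
    and "(\<lambda>\<eta>. THE y. y \<in> fset \<eta> \<inter> b i) \<in> restrict_space borel (conf_of n ` U) \<rightarrow>\<^sub>M borel"
proof -
  show the: "(THE y. y \<in> fset (conf_of n x) \<inter> b i) = x i" if "x \<in> U" for x
  proof (rule the_equality)
    show "x i \<in> fset (conf_of n x) \<inter> b i" using that i by (auto simp: U_def)
    fix y assume "y \<in> fset (conf_of n x) \<inter> b i"
    then obtain j where "j < n" "y = x j" "x j \<in> b i" by auto
    then show "y = x i"
      using that b(2) i by (cases "j = i") (auto simp: U_def disjoint_family_on_def)
  qed
  have openU: "open U" and sub: "U \<subseteq> distinct_seqs n"
    unfolding U_def by (rule disjoint_cell[OF b]; assumption)+
  show "(\<lambda>\<eta>. THE y. y \<in> fset \<eta> \<inter> b i) \<in> restrict_space borel (conf_of n ` U) \<rightarrow>\<^sub>M borel"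
  proof (rule borel_measurableI)
    fix S :: "'a set" assume S: "open S"
    have "(\<lambda>\<eta>. THE y. y \<in> fset \<eta> \<inter> b i) -` S \<inter> conf_of n ` U = conf_of n ` (U \<inter> (\<lambda>x. x i) -` S)"
      using the by auto
    also have "open \<dots>"
      using sub S by (intro open_conf_of_image open_Int openU open_vimage
          continuous_on_product_coordinates) auto
    finally show "(\<lambda>\<eta>. THE y. y \<in> fset \<eta> \<inter> b i) -` S \<inter> space (restrict_space borel (conf_of n ` U))
        \<in> sets (restrict_space borel (conf_of n ` U))"
      using open_conf_of_image[OF openU sub]
      by (subst sets_restrict_space_iff) (auto simp: space_restrict_space)
  qed
qed

lemma distinct_seqs_separate:
  fixes x :: "nat \<Rightarrow> 'a::euclidean_space"
  assumes x: "x \<in> distinct_seqs n" and \<B>: "topological_basis \<B>"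
  obtains b where "b \<in> {..<n} \<rightarrow>\<^sub>E \<B>" "disjoint_family_on b {..<n}" "\<And>i. i < n \<Longrightarrow> x i \<in> b i"
proof -
  have "\<exists>d>0. \<forall>y\<in>x ` {..<n}. y \<noteq> x i \<longrightarrow> d \<le> dist (x i) y" for i
    by (rule finite_set_avoid) simp
  then obtain d where d: "\<And>i. d i > 0" "\<And>i y. y \<in> x ` {..<n} \<Longrightarrow> y \<noteq> x i \<Longrightarrow> d i \<le> dist (x i) y"
    by metis
  have "\<exists>B\<in>\<B>. x i \<in> B \<and> B \<subseteq> ball (x i) (d i / 2)" for i
  proof -
    have "x i \<in> ball (x i) (d i / 2)" using d(1)[of i] by simp
    from topological_basisE[OF \<B> open_ball this] show ?thesis by metis
  qed
  then obtain b where b: "\<And>i. b i \<in> \<B>" "\<And>i. x i \<in> b i" "\<And>i. b i \<subseteq> ball (x i) (d i / 2)"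
    by metis
  have "b i \<inter> b j = {}" if ij: "i < n" "j < n" "i \<noteq> j" for i j
  proof -
    have "x i \<noteq> x j" using x ij by (auto simp: distinct_seqs_def inj_on_def)
    then have "d i \<le> dist (x i) (x j)" "d j \<le> dist (x i) (x j)"
      using d(2)[of "x j" i] d(2)[of "x i" j] ij by (auto simp: dist_commute)
    then have "ball (x i) (d i / 2) \<inter> ball (x j) (d j / 2) = {}"
      by (intro disjoint_ballI) auto
    then show ?thesis using b(3)[of i] b(3)[of j] by blast
  qed
  then have "disjoint_family_on (restrict b {..<n}) {..<n}"
    by (auto simp: disjoint_family_on_def)
  then show thesis
    using b by (intro that[of "restrict b {..<n}"]) auto
qed

text \<open>
  The Borel sets are exactly those with Borel preimages among the tuples. The nontrivial half needs
  measurable local inverses of the map to configurations; the labelling by cells from a countable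
  basis provides them, and countably many families of cells cover all configurations.
\<close>

lemma sets_borel_fsetI:
  fixes A :: "'a::euclidean_space fset set"
  assumes A: "\<And>n. {x \<in> distinct_tuples n. conf_of n x \<in> A} \<in> sets (PiM {..<n} (\<lambda>_. lborel))"
  shows "A \<in> sets borel"
proof -
  obtain \<B> :: "'a set set" where \<B>: "countable \<B>" "topological_basis \<B>"
    using ex_countable_basis by blast
  define U where "U n b = {x :: nat \<Rightarrow> 'a. \<forall>i<n. x i \<in> b i}" for n :: nat and b
  define I where "I n = {b \<in> {..<n} \<rightarrow>\<^sub>E \<B>. disjoint_family_on b {..<n}}" for n :: nat
  have cell: "A \<inter> conf_of n ` U n b \<in> sets borel" if b: "b \<in> I n" for n b
  proof -
    have bo: "\<And>i. i < n \<Longrightarrow> open (b i)" and bd: "disjoint_family_on b {..<n}"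
      using b \<B>(2) topological_basis_open by (auto simp: I_def)
    define s where "s \<eta> = (\<lambda>i\<in>{..<n}. THE y. y \<in> fset \<eta> \<inter> b i)" for \<eta>
    have U: "open (U n b)" "U n b \<subseteq> distinct_seqs n"
      unfolding U_def by (rule disjoint_cell[OF bo bd]; assumption)+
    have V: "conf_of n ` U n b \<in> sets borel"
      by (intro borel_open open_conf_of_image U)
    have s: "s (conf_of n x) = restrict x {..<n}" if "x \<in> U n b" for x
      using measurable_point_in_cell(1)[OF bo bd] that by (auto simp: s_def U_def)
    have "s \<in> restrict_space borel (conf_of n ` U n b) \<rightarrow>\<^sub>M PiM {..<n} (\<lambda>_. lborel)"
      unfolding s_def U_def using measurable_point_in_cell(2)[OF bo bd]
      by (intro measurable_restrict) auto
    from measurable_sets[OF this A[of n]]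
    have "s -` {x \<in> distinct_tuples n. conf_of n x \<in> A} \<inter> conf_of n ` U n b \<in> sets borel"
      using V by (simp add: sets_restrict_space_iff space_restrict_space)
    also have "s -` {x \<in> distinct_tuples n. conf_of n x \<in> A} \<inter> conf_of n ` U n b = A \<inter> conf_of n ` U n b"
    proof -
      have "restrict x {..<n} \<in> distinct_tuples n" "conf_of n (restrict x {..<n}) = conf_of n x"
        if "x \<in> U n b" for x
        using that U(2) by (auto simp: distinct_tuples_def distinct_seqs_def intro: conf_of_cong)
      then show ?thesis using s by auto
    qed
    finally show ?thesis .
  qed
  have "countable (I n)" for n
    unfolding I_def by (rule countable_subset[OF _ countable_PiE[of "{..<n}" "\<lambda>_. \<B>"]]) (use \<B>(1) in auto)
  then have "(\<Union>b\<in>I n. A \<inter> conf_of n ` U n b) \<in> sets borel" for n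
    by (intro sets.countable_UN') (auto simp: cell)
  then have "(\<Union>n. \<Union>b\<in>I n. A \<inter> conf_of n ` U n b) \<in> sets borel"
    by (intro sets.countable_UN) auto
  also have "(\<Union>n. \<Union>b\<in>I n. A \<inter> conf_of n ` U n b) = A"
  proof (intro equalityI subsetI)
    fix \<eta> assume "\<eta> \<in> A"
    moreover obtain n x where x: "x \<in> distinct_seqs n" "\<eta> = conf_of n x"
      using conf_of_surj by blast
    moreover obtain b where "b \<in> {..<n} \<rightarrow>\<^sub>E \<B>" "disjoint_family_on b {..<n}" "\<And>i. i < n \<Longrightarrow> x i \<in> b i"
      using distinct_seqs_separate[OF x(1) \<B>(2)] by blast
    ultimately show "\<eta> \<in> (\<Union>n. \<Union>b\<in>I n. A \<inter> conf_of n ` U n b)"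
      by (auto simp: I_def U_def intro!: exI[of _ n] bexI[of _ b])
  qed auto
  finally show ?thesis .
qed

lemma measurable_fsetI:
  fixes f :: "'a::euclidean_space fset \<Rightarrow> 'b"
  assumes f: "\<And>n. (\<lambda>x. f (conf_of n x)) \<in> restrict_space (PiM {..<n} (\<lambda>_. lborel)) (distinct_tuples n) \<rightarrow>\<^sub>M N"
  shows "f \<in> borel \<rightarrow>\<^sub>M N"
proof (rule measurableI)
  fix \<eta> :: "'a fset"
  obtain n x where x: "x \<in> distinct_seqs n" "\<eta> = conf_of n x"
    using conf_of_surj by blast
  have "restrict x {..<n} \<in> distinct_tuples n" "conf_of n (restrict x {..<n}) = conf_of n x"
    using x by (auto simp: distinct_tuples_def distinct_seqs_def intro: conf_of_cong)
  then show "f \<eta> \<in> space N"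
    using measurable_space[OF f[of n]] x by (metis space_restrict_distinct_tuples)
next
  fix A assume A: "A \<in> sets N"
  show "f -` A \<inter> space borel \<in> sets borel"
  proof (rule sets_borel_fsetI)
    fix n
    have "{x \<in> distinct_tuples n. conf_of n x \<in> f -` A \<inter> space borel} =
        (\<lambda>x. f (conf_of n x)) -` A \<inter> distinct_tuples n" by auto
    then show "{x \<in> distinct_tuples n. conf_of n x \<in> f -` A \<inter> space borel} \<in> sets (PiM {..<n} (\<lambda>_. lborel))"
      using measurable_sets[OF f[of n] A] by (simp add: sets_restrict_space_iff sets.Int_space_eq2)
  qed
qed

text \<open>
  Adding a point is not continuous, since the cardinality jumps when another point approaches it. It is
  continuous on the open set of configurations that miss the point and the identity on the complement.
\<close>

lemma measurable_finsert [measurable]: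
  "finsert y \<in> borel \<rightarrow>\<^sub>M (borel :: 'a::euclidean_space fset measure)"
proof (rule borel_measurableI)
  fix S :: "'a fset set" assume S: "open S"
  have "open {\<zeta>. y |\<notin>| \<zeta> \<and> finsert y \<zeta> \<in> T}" if T: "open T" for T
    unfolding open_fset_iff
  proof
    fix n
    have "x(n := y) \<in> distinct_seqs (Suc n) \<longleftrightarrow> x \<in> distinct_seqs n \<and> y \<notin> x ` {..<n}" for x
    proof -
      have "inj_on (x(n := y)) {..<n} = inj_on x {..<n}" by (rule inj_on_cong) auto
      moreover have "(x(n := y)) ` {..<n} = x ` {..<n}" by auto
      ultimately show ?thesis by (auto simp: distinct_seqs_def lessThan_Suc)
    qed
    moreover have "conf_of (Suc n) (x(n := y)) = finsert y (conf_of n x)" for x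
      by (auto simp: fset_inject[symmetric] lessThan_Suc)
    ultimately have "{x \<in> distinct_seqs n. conf_of n x \<in> {\<zeta>. y |\<notin>| \<zeta> \<and> finsert y \<zeta> \<in> T}} =
        (\<lambda>x. x(n := y)) -` {x \<in> distinct_seqs (Suc n). conf_of (Suc n) x \<in> T}"
      by auto
    also have "open \<dots>"
    proof (rule open_vimage)
      show "open {x \<in> distinct_seqs (Suc n). conf_of (Suc n) x \<in> T}"
        using T by (simp add: open_fset_iff)
      show "continuous_on UNIV (\<lambda>x. x(n := y))"
      proof (rule continuous_on_coordinatewise_then_product)
        fix i show "continuous_on UNIV (\<lambda>x. (x(n := y)) i)"
          by (cases "i = n") auto
      qed
    qed
    finally show "open {x \<in> distinct_seqs n. conf_of n x \<in> {\<zeta>. y |\<notin>| \<zeta> \<and> finsert y \<zeta> \<in> T}}" .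
  qed
  note * = this[OF S] this[OF open_UNIV]
  have "finsert y -` S \<inter> space borel =
      ({\<zeta>. y |\<notin>| \<zeta> \<and> finsert y \<zeta> \<in> S} \<union> (S - {\<zeta>. y |\<notin>| \<zeta> \<and> finsert y \<zeta> \<in> UNIV}))"
    by (auto simp: finsert_absorb)
  also have "\<dots> \<in> sets borel"
    using * S by (intro sets.Un sets.Diff borel_open)
  finally show "finsert y -` S \<inter> space borel \<in> sets borel" .
qed

lemma measurable_funion [measurable]:
  "(|\<union>|) \<eta> \<in> borel \<rightarrow>\<^sub>M (borel :: 'a::euclidean_space fset measure)"
proof (induction \<eta>)
  case empty
  then show ?case by simp
next
  case (insert y \<eta>)
  from measurable_compose[OF insert(2) measurable_finsert[of y]]
  show ?case by simp
qed

lemma measurable_prod_over_fset: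
  fixes f :: "'a::euclidean_space \<Rightarrow> ennreal"
  assumes [measurable]: "f \<in> borel_measurable borel"
  shows "(\<lambda>\<zeta>. \<Prod>w\<in>fset \<zeta>. f w) \<in> borel_measurable borel"
proof (rule measurable_fsetI)
  fix n
  have "(\<lambda>x. \<Prod>i<n. f (x i)) \<in> borel_measurable (restrict_space (PiM {..<n} (\<lambda>_. lborel)) (distinct_tuples n))"
    by (intro measurable_restrict_space1) measurable
  then show "(\<lambda>x. \<Prod>w\<in>fset (conf_of n x). f w) \<in>
      borel_measurable (restrict_space (PiM {..<n} (\<lambda>_. lborel)) (distinct_tuples n))"
  proof (rule measurable_cong[THEN iffD1, rotated])
    fix x assume "x \<in> space (restrict_space (PiM {..<n} (\<lambda>_. lborel)) (distinct_tuples n :: (nat \<Rightarrow> 'a) set))"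
    then have "inj_on x {..<n}"
      unfolding space_restrict_distinct_tuples by (simp add: distinct_tuples_def)
    then show "(\<Prod>i<n. f (x i)) = (\<Prod>w\<in>fset (conf_of n x). f w)"
      by (simp add: prod.reindex)
  qed
qed

lemma nn_integral_lebesgue_conf:
  fixes g :: "'a::euclidean_space fset \<Rightarrow> ennreal"
  assumes [measurable]: "g \<in> borel_measurable borel"
  shows "(\<integral>\<^sup>+\<zeta>. g \<zeta> \<partial>lebesgue_conf n) =
    (\<integral>\<^sup>+x. g (conf_of n x) * indicator (distinct_tuples n) x \<partial>PiM {..<n} (\<lambda>_. lborel))"
  unfolding lebesgue_conf_def
  by (simp add: nn_integral_distr nn_integral_restrict_space)

section \<open>The transition function as a measure\<close>

text \<open>
  The set functions that define \<open>lebesgue_poisson\<close> and \<open>transition\<close> are weighted sums of measures. Writing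
  such a sum as an integral over a counting measure reduces countable additivity, and the formula
  for integrals, to monotone convergence.
\<close>

lemma measure_of_mixture:
  fixes M :: "'i \<Rightarrow> 'b::topological_space measure" and c :: "'i \<Rightarrow> ennreal"
  assumes sets [measurable_cong]: "\<And>i. i \<in> I \<Longrightarrow> sets (M i) = sets borel"
    and \<mu>: "\<And>A. A \<in> sets borel \<Longrightarrow> \<mu> A = (\<integral>\<^sup>+i. c i * emeasure (M i) A \<partial>count_space I)"
  defines "N \<equiv> measure_of UNIV (sets borel) \<mu>"
  shows "sets N = sets borel"
    and "A \<in> sets borel \<Longrightarrow> emeasure N A = \<mu> A"
    and "g \<in> borel_measurable borel \<Longrightarrow>
      (\<integral>\<^sup>+\<omega>. g \<omega> \<partial>N) = (\<integral>\<^sup>+i. c i * (\<integral>\<^sup>+\<omega>. g \<omega> \<partial>M i) \<partial>count_space I)"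
proof -
  show sets_N [measurable_cong]: "sets N = sets borel"
    unfolding N_def using sets.sigma_sets_eq[of "borel :: 'b measure"] by (simp add: sets_measure_of_conv)
  have N: "emeasure N A = \<mu> A" if "A \<in> sets borel" for A
  proof (rule emeasure_measure_of[OF N_def[THEN meta_eq_to_obj_eq]])
    show "sets borel \<subseteq> Pow UNIV" by simp
    show "A \<in> sets N" using that sets_N by simp
    show "positive (sets N) \<mu>" using \<mu>[of "{}"] by (simp add: positive_def sets_N)
    show "countably_additive (sets N) \<mu>"
    proof (rule countably_additiveI)
      fix B :: "nat \<Rightarrow> 'b set"
      assume B: "range B \<subseteq> sets N" "disjoint_family B" "\<Union> (range B) \<in> sets N"
      have "(\<Sum>j. \<mu> (B j)) = (\<Sum>j. \<integral>\<^sup>+i. c i * emeasure (M i) (B j) \<partial>count_space I)"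
        using B sets_N by (intro suminf_cong \<mu>) auto
      also have "\<dots> = (\<integral>\<^sup>+i. (\<Sum>j. c i * emeasure (M i) (B j)) \<partial>count_space I)"
        by (rule nn_integral_suminf[symmetric]) simp
      also have "\<dots> = (\<integral>\<^sup>+i. c i * emeasure (M i) (\<Union> (range B)) \<partial>count_space I)"
        using B sets sets_N
        by (intro nn_integral_cong) (simp add: suminf_emeasure)
      also have "\<dots> = \<mu> (\<Union> (range B))"
        using B sets_N by (intro \<mu>[symmetric]) simp
      finally show "(\<Sum>j. \<mu> (B j)) = \<mu> (\<Union> (range B))" .
    qed
  qed
  then show "A \<in> sets borel \<Longrightarrow> emeasure N A = \<mu> A" .
  have M: "h \<in> borel_measurable (M i)" if "h \<in> borel_measurable borel" "i \<in> I"
    for h :: "'b \<Rightarrow> ennreal" and i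
    using that(1) measurable_cong_sets[OF sets[OF that(2)] refl] by blast
  assume "g \<in> borel_measurable borel"
  then show "(\<integral>\<^sup>+\<omega>. g \<omega> \<partial>N) = (\<integral>\<^sup>+i. c i * (\<integral>\<^sup>+\<omega>. g \<omega> \<partial>M i) \<partial>count_space I)"
  proof induction
    case (cong f g)
    then have "f = g" by auto
    then show ?case using cong by simp
  next
    case (set A)
    then show ?case
      using N sets sets_N by (auto simp: \<mu> intro!: nn_integral_cong)
  next
    case (mult u a)
    have "(\<integral>\<^sup>+\<omega>. a * u \<omega> \<partial>N) = a * (\<integral>\<^sup>+i. c i * (\<integral>\<^sup>+\<omega>. u \<omega> \<partial>M i) \<partial>count_space I)"
      using mult by (subst nn_integral_cmult) auto
    also have "\<dots> = (\<integral>\<^sup>+i. a * (c i * (\<integral>\<^sup>+\<omega>. u \<omega> \<partial>M i)) \<partial>count_space I)"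
      by (rule nn_integral_cmult[symmetric]) simp
    also have "\<dots> = (\<integral>\<^sup>+i. c i * (\<integral>\<^sup>+\<omega>. a * u \<omega> \<partial>M i) \<partial>count_space I)"
      using mult by (intro nn_integral_cong) (simp add: nn_integral_cmult M mult.left_commute)
    finally show ?case .
  next
    case (add u v)
    have "(\<integral>\<^sup>+\<omega>. v \<omega> + u \<omega> \<partial>N) = (\<integral>\<^sup>+i. c i * (\<integral>\<^sup>+\<omega>. v \<omega> \<partial>M i) \<partial>count_space I) +
        (\<integral>\<^sup>+i. c i * (\<integral>\<^sup>+\<omega>. u \<omega> \<partial>M i) \<partial>count_space I)"
      using add by (subst nn_integral_add) auto
    also have "\<dots> = (\<integral>\<^sup>+i. c i * (\<integral>\<^sup>+\<omega>. v \<omega> \<partial>M i) + c i * (\<integral>\<^sup>+\<omega>. u \<omega> \<partial>M i) \<partial>count_space I)"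
      by (rule nn_integral_add[symmetric]) simp_all
    also have "\<dots> = (\<integral>\<^sup>+i. c i * (\<integral>\<^sup>+\<omega>. v \<omega> + u \<omega> \<partial>M i) \<partial>count_space I)"
      using add by (intro nn_integral_cong) (simp add: nn_integral_add M distrib_left)
    finally show ?case .
  next
    case (seq U)
    have [measurable]: "U j \<in> borel_measurable borel" for j using seq by auto
    have sup: "Sup (range U) = (\<lambda>\<omega>. SUP j. U j \<omega>)" by (rule ext) (rule SUP_apply)
    have inc: "incseq (\<lambda>j. integral\<^sup>N (M i) (U j))" for i
      using seq by (intro incseq_SucI nn_integral_mono) (auto simp: incseq_Suc_iff le_fun_def)
    have "integral\<^sup>N N (SUP j. U j) = (SUP j. integral\<^sup>N N (U j))"
      using seq by (subst nn_integral_monotone_convergence_SUP[symmetric]) (simp_all add: sup)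
    also have "\<dots> = (SUP j. \<integral>\<^sup>+i. c i * (integral\<^sup>N (M i) (U j)) \<partial>count_space I)"
      using seq by simp
    also have "\<dots> = (\<integral>\<^sup>+i. (SUP j. c i * (integral\<^sup>N (M i) (U j))) \<partial>count_space I)"
      using inc by (intro nn_integral_monotone_convergence_SUP[symmetric])
        (auto simp: incseq_def le_fun_def intro!: mult_left_mono)
    also have "\<dots> = (\<integral>\<^sup>+i. c i * (integral\<^sup>N (M i) (SUP j. U j)) \<partial>count_space I)"
    proof (intro nn_integral_cong)
      fix i assume i: "i \<in> space (count_space I)"
      then have [measurable]: "U j \<in> borel_measurable (M i)" for j
        using M seq by simp
      have "integral\<^sup>N (M i) (SUP j. U j) = (SUP j. integral\<^sup>N (M i) (U j))"
        using seq by (subst nn_integral_monotone_convergence_SUP[symmetric]) (simp_all add: sup)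
      then show "(SUP j. c i * (integral\<^sup>N (M i) (U j))) = c i * (integral\<^sup>N (M i) (SUP j. U j))"
        by (simp add: SUP_mult_left_ennreal)
    qed
    finally show ?case .
  qed
qed

lemma suminf_ennreal_head: "(\<Sum>n. f n) = f 0 + (\<Sum>n. f (Suc n) :: ennreal)"
  using sums_unique[OF sums_Suc[OF summable_sums[OF summableI], of f]] by (simp add: add.commute)

lemma nn_integral_count_space_nat_head:
  "(\<integral>\<^sup>+n. f n \<partial>count_space UNIV) = f 0 + (\<Sum>n. f (Suc n) :: ennreal)"
  unfolding nn_integral_count_space_nat by (rule suminf_ennreal_head)

lemma lebesgue_poisson_mixture:
  shows sets_lebesgue_poisson [measurable_cong, simp]:
      "sets (lebesgue_poisson :: 'a::euclidean_space fset measure) = sets borel"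
    and nn_integral_lebesgue_poisson: "g \<in> borel_measurable borel \<Longrightarrow>
      (\<integral>\<^sup>+\<zeta>. g \<zeta> \<partial>(lebesgue_poisson :: 'a fset measure)) =
        g {||} + (\<Sum>n. ennreal (1 / fact (Suc n)) * (\<integral>\<^sup>+\<zeta>. g \<zeta> \<partial>lebesgue_conf (Suc n)))"
proof -
  define M :: "nat \<Rightarrow> 'a fset measure" where
    "M n = (case n of 0 \<Rightarrow> return borel {||} | Suc _ \<Rightarrow> lebesgue_conf n)" for n
  define c :: "nat \<Rightarrow> ennreal" where "c n = ennreal (1 / fact n)" for n
  have "sets (M n) = sets borel" for n
    by (simp add: M_def lebesgue_conf_def split: nat.split)
  note * = measure_of_mixture[where I="UNIV :: nat set" and M=M and c=c, OF this,
      of "\<lambda>A. indicator A {||} + (\<Sum>n. ennreal (1 / fact (Suc n)) * emeasure (lebesgue_conf (Suc n)) A)",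
      folded lebesgue_poisson_def]
  have \<mu>: "indicator A {||} + (\<Sum>n. ennreal (1 / fact (Suc n)) * emeasure (lebesgue_conf (Suc n)) A) =
      (\<integral>\<^sup>+n. c n * emeasure (M n) A \<partial>count_space UNIV)" if "A \<in> sets borel" for A
    using that by (simp add: nn_integral_count_space_nat_head c_def M_def del: fact_Suc)
  show "sets (lebesgue_poisson :: 'a fset measure) = sets borel"
    using *(1)[OF \<mu>] by simp
  assume g: "g \<in> borel_measurable borel"
  show "(\<integral>\<^sup>+\<zeta>. g \<zeta> \<partial>(lebesgue_poisson :: 'a fset measure)) =
        g {||} + (\<Sum>n. ennreal (1 / fact (Suc n)) * (\<integral>\<^sup>+\<zeta>. g \<zeta> \<partial>lebesgue_conf (Suc n)))"
    using *(3)[OF \<mu> g] g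
    by (simp add: nn_integral_count_space_nat_head c_def M_def nn_integral_return del: fact_Suc)
qed

text \<open>
  The unnormalised law of the set of children of one parent, where \<open>f\<close> is the density of the position
  of a child. Its total mass is \<open>e - 1\<close> when \<open>f\<close> is a probability density.
\<close>

definition offspring :: "('a::euclidean_space \<Rightarrow> real) \<Rightarrow> 'a fset measure" where
  "offspring f = density lebesgue_poisson
     (\<lambda>\<zeta>. indicator (UNIV - {{||}}) \<zeta> * (\<Prod>w\<in>fset \<zeta>. ennreal (f w)))"

lemma sets_offspring [measurable_cong, simp]: "sets (offspring f) = sets borel"
  by (simp add: offspring_def)

lemma open_nonempty_fset: "open (UNIV - {{||}} :: 'a::t2_space fset set)"
proof -
  have "UNIV - {{||}} = (\<Union>n\<in>{0<..}. {\<eta> :: 'a fset. fcard \<eta> = n})" by (auto simp: fcard.rep_eq card_gt_0_iff fset_inject[symmetric])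
  also have "open \<dots>" by (intro open_UN ballI open_fcard_eq)
  finally show ?thesis .
qed

lemma measurable_offspring_density [measurable]:
  assumes [measurable]: "f \<in> borel_measurable borel"
  shows "(\<lambda>\<zeta>. indicator (UNIV - {{||}}) \<zeta> * (\<Prod>w\<in>fset \<zeta>. ennreal (f w)))
    \<in> borel_measurable (borel :: 'a::euclidean_space fset measure)"
proof -
  have [measurable]: "UNIV - {{||}} \<in> sets (borel :: 'a fset measure)"
    by (rule borel_open[OF open_nonempty_fset])
  have [measurable]: "(\<lambda>\<zeta> :: 'a fset. \<Prod>w\<in>fset \<zeta>. ennreal (f w)) \<in> borel_measurable borel"
    by (rule measurable_prod_over_fset) measurable
  show ?thesis by measurable
qed

definition offspring_term :: "('a::euclidean_space \<Rightarrow> real) \<Rightarrow> ('a fset \<Rightarrow> ennreal) \<Rightarrow> nat \<Rightarrow> ennreal" where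
  "offspring_term f g n = (\<integral>\<^sup>+w. indicator (distinct_tuples n) w * g (conf_of n w) * (\<Prod>i<n. ennreal (f (w i)))
     \<partial>PiM {..<n} (\<lambda>_. lborel))"

lemma nn_integral_offspring:
  fixes f :: "'a::euclidean_space \<Rightarrow> real"
  assumes [measurable]: "f \<in> borel_measurable borel" "g \<in> borel_measurable borel"
  shows "(\<integral>\<^sup>+\<zeta>. g \<zeta> \<partial>offspring f) = (\<Sum>k. ennreal (1 / fact (Suc k)) * offspring_term f g (Suc k))"
proof -
  let ?h = "\<lambda>\<zeta>. indicator (UNIV - {{||}}) \<zeta> * (\<Prod>w\<in>fset \<zeta>. ennreal (f w)) * g \<zeta>"
  have h [measurable]: "?h \<in> borel_measurable borel"
    using measurable_offspring_density[OF assms(1)] assms(2) by measurable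
  have "(\<integral>\<^sup>+\<zeta>. g \<zeta> \<partial>offspring f) = (\<integral>\<^sup>+\<zeta>. ?h \<zeta> \<partial>lebesgue_poisson)"
    unfolding offspring_def by (rule nn_integral_density) (simp_all cong: measurable_cong_sets)
  also have "\<dots> = (\<Sum>k. ennreal (1 / fact (Suc k)) * (\<integral>\<^sup>+\<zeta>. ?h \<zeta> \<partial>lebesgue_conf (Suc k)))"
    by (subst nn_integral_lebesgue_poisson[OF h]) simp
  also have "\<dots> = (\<Sum>k. ennreal (1 / fact (Suc k)) * offspring_term f g (Suc k))"
  proof (intro suminf_cong arg_cong2[where f="(*)"] refl)
    fix k
    have "?h (conf_of (Suc k) w) * indicator (distinct_tuples (Suc k)) w =
        indicator (distinct_tuples (Suc k)) w * g (conf_of (Suc k) w) * (\<Prod>i<Suc k. ennreal (f (w i)))" for w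
    proof (cases "w \<in> distinct_tuples (Suc k)")
      case True
      then have "inj_on w {..<Suc k}" by (simp add: distinct_tuples_def)
      moreover have "conf_of (Suc k) w \<noteq> {||}" by (auto simp: fset_inject[symmetric])
      ultimately show ?thesis
        using True by (simp add: prod.reindex mult.commute del: prod.lessThan_Suc)
    qed simp
    then show "(\<integral>\<^sup>+\<zeta>. ?h \<zeta> \<partial>lebesgue_conf (Suc k)) = offspring_term f g (Suc k)"
      unfolding nn_integral_lebesgue_conf[OF h] offspring_term_def by simp
  qed
  finally show ?thesis .
qed

definition interaction_rate ::
  "(real \<times> 'a \<Rightarrow> real) \<Rightarrow> (real \<times> 'a \<Rightarrow> real) \<Rightarrow> real \<Rightarrow> 'a::euclidean_space fset \<Rightarrow> 'a \<Rightarrow> real" where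
  "interaction_rate r a t \<eta> x = r (t, x) + (\<Sum>y\<in>fset (\<eta> |-| {|x|}). a (t, x - y))"

text \<open>
  The transition function is the finite mixture of the point masses at \<open>\<eta> \<setminus> x\<close> and of the images of the
  offspring measures under \<open>\<zeta> \<mapsto> \<eta> \<union> \<zeta>\<close>.
\<close>

lemma transition_mixture:
  fixes m am l bp ap :: "real \<times> 'a::euclidean_space \<Rightarrow> real"
  assumes [measurable]: "(\<lambda>y. ap (t, y)) \<in> borel_measurable borel"
  shows "sets (transition m am l bp ap t \<eta>) = sets borel" (is "sets ?Q = _")
    and "g \<in> borel_measurable borel \<Longrightarrow> (\<integral>\<^sup>+\<omega>. g \<omega> \<partial>transition m am l bp ap t \<eta>) =
      (\<Sum>x\<in>fset \<eta>. ennreal (interaction_rate m am t \<eta> x) * g (\<eta> |-| {|x|})) +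
      ennreal (1 / exp 1) * (\<Sum>x\<in>fset \<eta>. ennreal (interaction_rate l bp t \<eta> x) *
        (\<integral>\<^sup>+\<zeta>. g (\<eta> |\<union>| \<zeta>) \<partial>offspring (\<lambda>w. ap (t, x - w))))"
proof -
  have f [measurable]: "(\<lambda>w. ap (t, x - w)) \<in> borel_measurable borel" for x
    by (rule measurable_compose[OF _ assms, of "\<lambda>w. x - w"]) measurable
  define M where "M = (\<lambda>(d, x). if d then return borel (\<eta> |-| {|x|})
    else distr (offspring (\<lambda>w. ap (t, x - w))) borel ((|\<union>|) \<eta>))"
  define c where "c = (\<lambda>(d, x). if d then ennreal (interaction_rate m am t \<eta> x)
    else ennreal (1 / exp 1) * ennreal (interaction_rate l bp t \<eta> x))"
  let ?I = "(UNIV :: bool set) \<times> fset \<eta>"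
  have split: "(\<integral>\<^sup>+i. h i \<partial>count_space ?I) = (\<Sum>x\<in>fset \<eta>. h (True, x)) + (\<Sum>x\<in>fset \<eta>. h (False, x))"
    for h :: "_ \<Rightarrow> ennreal"
    by (subst nn_integral_count_space_finite)
       (simp_all add: sum.cartesian_product' UNIV_bool add.commute)
  have sets_M: "sets (M i) = sets borel" for i
    by (simp add: M_def split: prod.split)
  note * = measure_of_mixture[where I="?I" and M=M and c=c, OF sets_M, of "\<lambda>A.
    (\<Sum>x\<in>fset \<eta>. ennreal (m (t, x) + (\<Sum>y\<in>fset (\<eta> |-| {|x|}). am (t, x - y)))
        * indicator A (\<eta> |-| {|x|}))
     + ennreal (1 / exp 1)
        * (\<Sum>x\<in>fset \<eta>. ennreal (l (t, x) + (\<Sum>y\<in>fset (\<eta> |-| {|x|}). bp (t, x - y)))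
            * (\<integral>\<^sup>+\<zeta>\<in>UNIV - {{||}}. indicator A (\<eta> |\<union>| \<zeta>) * (\<Prod>w\<in>fset \<zeta>. ennreal (ap (t, x - w)))
                \<partial>lebesgue_poisson))", folded transition_def]
  have birth: "emeasure (distr (offspring (\<lambda>w. ap (t, x - w))) borel ((|\<union>|) \<eta>)) A =
      (\<integral>\<^sup>+\<zeta>\<in>UNIV - {{||}}. indicator A (\<eta> |\<union>| \<zeta>) * (\<Prod>w\<in>fset \<zeta>. ennreal (ap (t, x - w)))
                \<partial>lebesgue_poisson)" if A: "A \<in> sets borel" for A x
  proof -
    have pre: "(|\<union>|) \<eta> -` A \<in> sets lebesgue_poisson"
      using measurable_sets[OF measurable_funion A, of \<eta>] by simp
    have "emeasure (distr (offspring (\<lambda>w. ap (t, x - w))) borel ((|\<union>|) \<eta>)) A =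
        emeasure (offspring (\<lambda>w. ap (t, x - w))) ((|\<union>|) \<eta> -` A)"
      using A by (subst emeasure_distr) (simp_all add: offspring_def cong: measurable_cong_sets, simp add: sets_eq_imp_space_eq[OF sets_lebesgue_poisson])
    also have "\<dots> = (\<integral>\<^sup>+\<zeta>. indicator (UNIV - {{||}}) \<zeta> * (\<Prod>w\<in>fset \<zeta>. ennreal (ap (t, x - w))) *
        indicator ((|\<union>|) \<eta> -` A) \<zeta> \<partial>lebesgue_poisson)"
      unfolding offspring_def using pre by (intro emeasure_density) (simp_all cong: measurable_cong_sets)
    also have "\<dots> = (\<integral>\<^sup>+\<zeta>\<in>UNIV - {{||}}. indicator A (\<eta> |\<union>| \<zeta>) * (\<Prod>w\<in>fset \<zeta>. ennreal (ap (t, x - w)))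
                \<partial>lebesgue_poisson)"
      by (intro nn_integral_cong) (simp add: indicator_def)
    finally show ?thesis .
  qed
  have \<mu>: "(\<Sum>x\<in>fset \<eta>. ennreal (m (t, x) + (\<Sum>y\<in>fset (\<eta> |-| {|x|}). am (t, x - y)))
        * indicator A (\<eta> |-| {|x|}))
     + ennreal (1 / exp 1)
        * (\<Sum>x\<in>fset \<eta>. ennreal (l (t, x) + (\<Sum>y\<in>fset (\<eta> |-| {|x|}). bp (t, x - y)))
            * (\<integral>\<^sup>+\<zeta>\<in>UNIV - {{||}}. indicator A (\<eta> |\<union>| \<zeta>) * (\<Prod>w\<in>fset \<zeta>. ennreal (ap (t, x - w)))
                \<partial>lebesgue_poisson)) = (\<integral>\<^sup>+i. c i * emeasure (M i) A \<partial>count_space ?I)"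
    if A: "A \<in> sets borel" for A
    unfolding split M_def c_def using A birth[OF A]
    by (simp add: interaction_rate_def sum_distrib_left mult.assoc)
  show "sets ?Q = sets borel"
    by (rule *(1)[OF \<mu>])
  assume g [measurable]: "g \<in> borel_measurable borel"
  have "(\<integral>\<^sup>+\<omega>. g \<omega> \<partial>?Q) = (\<integral>\<^sup>+i. c i * (\<integral>\<^sup>+\<omega>. g \<omega> \<partial>M i) \<partial>count_space ?I)"
    by (rule *(3)[OF \<mu> g])
  also have "(\<integral>\<^sup>+\<omega>. g \<omega> \<partial>M (False, x)) = (\<integral>\<^sup>+\<zeta>. g (\<eta> |\<union>| \<zeta>) \<partial>offspring (\<lambda>w. ap (t, x - w)))" for x
    using g by (simp add: M_def nn_integral_distr cong: measurable_cong_sets)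
  then have "(\<integral>\<^sup>+i. c i * (\<integral>\<^sup>+\<omega>. g \<omega> \<partial>M i) \<partial>count_space ?I) =
     (\<Sum>x\<in>fset \<eta>. ennreal (interaction_rate m am t \<eta> x) * g (\<eta> |-| {|x|})) +
      ennreal (1 / exp 1) * (\<Sum>x\<in>fset \<eta>. ennreal (interaction_rate l bp t \<eta> x) *
        (\<integral>\<^sup>+\<zeta>. g (\<eta> |\<union>| \<zeta>) \<partial>offspring (\<lambda>w. ap (t, x - w))))"
    unfolding split c_def
    by (simp add: M_def nn_integral_return sum_distrib_left mult.assoc)
  finally show "(\<integral>\<^sup>+\<omega>. g \<omega> \<partial>?Q) =
      (\<Sum>x\<in>fset \<eta>. ennreal (interaction_rate m am t \<eta> x) * g (\<eta> |-| {|x|})) +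
      ennreal (1 / exp 1) * (\<Sum>x\<in>fset \<eta>. ennreal (interaction_rate l bp t \<eta> x) *
        (\<integral>\<^sup>+\<zeta>. g (\<eta> |\<union>| \<zeta>) \<partial>offspring (\<lambda>w. ap (t, x - w))))" .
qed

section \<open>Weak convergence of dominated densities\<close>

lemma integrable_bounded_mult:
  fixes u v a :: "'b \<Rightarrow> real"
  assumes "integrable M a" "u \<in> borel_measurable M" "v \<in> borel_measurable M"
    and "\<And>x. x \<in> space M \<Longrightarrow> \<bar>u x\<bar> \<le> C" "\<And>x. x \<in> space M \<Longrightarrow> \<bar>v x\<bar> \<le> a x"
  shows "integrable M (\<lambda>x. u x * v x)"
proof (rule Bochner_Integration.integrable_bound)
  show "integrable M (\<lambda>x. C * a x)" using assms(1) by simp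
  show "(\<lambda>x. u x * v x) \<in> borel_measurable M" using assms by measurable
  show "AE x in M. norm (u x * v x) \<le> norm (C * a x)"
  proof (rule AE_I2)
    fix x assume x: "x \<in> space M"
    have "\<bar>u x\<bar> * \<bar>v x\<bar> \<le> C * a x"
      using assms(4,5)[OF x] by (intro mult_mono) auto
    then show "norm (u x * v x) \<le> norm (C * a x)" 
      using abs_ge_self[of "C * a x"] by (simp only: real_norm_def abs_mult)
  qed
qed

lemma integral_bounded_mult_le:
  fixes u v a :: "'b \<Rightarrow> real"
  assumes "integrable M a" "u \<in> borel_measurable M" "v \<in> borel_measurable M"
    and "\<And>x. x \<in> space M \<Longrightarrow> \<bar>u x\<bar> \<le> C" "\<And>x. x \<in> space M \<Longrightarrow> \<bar>v x\<bar> \<le> a x"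
  shows "\<bar>\<integral>x. u x * v x \<partial>M\<bar> \<le> (\<integral>x. \<bar>u x\<bar> * a x \<partial>M)"
proof -
  have "\<bar>\<integral>x. u x * v x \<partial>M\<bar> \<le> (\<integral>x. \<bar>u x * v x\<bar> \<partial>M)"
    by (rule integral_abs_bound)
  also have "\<dots> \<le> (\<integral>x. \<bar>u x\<bar> * a x \<partial>M)"
  proof (rule integral_mono)
    show "integrable M (\<lambda>x. \<bar>u x * v x\<bar>)"
      using integrable_bounded_mult[OF assms] by simp
    have [measurable]: "a \<in> borel_measurable M" using assms(1) by simp
    show "integrable M (\<lambda>x. \<bar>u x\<bar> * a x)"
      by (rule integrable_bounded_mult[where C=C and a=a]) (use assms in \<open>force+\<close>)
    show "\<bar>u x * v x\<bar> \<le> \<bar>u x\<bar> * a x" if "x \<in> space M" for x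
      using assms(5)[OF that] by (simp add: abs_mult mult_left_mono)
  qed
  finally show ?thesis .
qed

text \<open>
  Since the factors \<open>v j\<close> are dominated by one integrable function \<open>a\<close>, dominated convergence gives
  \<open>\<integral> |u j - u0| a \<rightarrow> 0\<close>. So the limit only has to be found for the fixed function \<open>u0\<close>.
\<close>

lemma tendsto_integral_perturb:
  fixes u :: "nat \<Rightarrow> 'b \<Rightarrow> real" and v :: "nat \<Rightarrow> 'b \<Rightarrow> real"
  assumes a: "integrable M a"
    and u: "\<And>j. u j \<in> borel_measurable M" "u0 \<in> borel_measurable M"
    and v: "\<And>j. v j \<in> borel_measurable M"
    and bound: "\<And>j x. x \<in> space M \<Longrightarrow> \<bar>u j x\<bar> \<le> C" "\<And>x. x \<in> space M \<Longrightarrow> \<bar>u0 x\<bar> \<le> C"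
      "\<And>j x. x \<in> space M \<Longrightarrow> \<bar>v j x\<bar> \<le> a x"
    and conv: "AE x in M. (\<lambda>j. u j x) \<longlonglongrightarrow> u0 x"
    and lim: "(\<lambda>j. \<integral>x. u0 x * v j x \<partial>M) \<longlonglongrightarrow> L"
  shows "(\<lambda>j. \<integral>x. u j x * v j x \<partial>M) \<longlonglongrightarrow> L"
proof -
  note [measurable] = u v
  have [measurable]: "a \<in> borel_measurable M" using a by simp
  have B: "\<bar>u j x - u0 x\<bar> \<le> 2 * C" if "x \<in> space M" for j x
    using bound(1)[OF that, of j] bound(2)[OF that] by (smt (verit))
  have "(\<lambda>j. \<integral>x. \<bar>u j x - u0 x\<bar> * a x \<partial>M) \<longlonglongrightarrow> (\<integral>x. 0 \<partial>M)"
  proof (rule integral_dominated_convergence[where w="\<lambda>x. 2 * C * a x"])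
    show "integrable M (\<lambda>x. 2 * C * a x)" using a by simp
    show "AE x in M. (\<lambda>j. \<bar>u j x - u0 x\<bar> * a x) \<longlonglongrightarrow> 0"
      using conv
    proof eventually_elim
      case (elim x)
      have "(\<lambda>j. \<bar>u j x - u0 x\<bar> * a x) \<longlonglongrightarrow> \<bar>u0 x - u0 x\<bar> * a x"
        by (intro tendsto_intros elim)
      then show ?case by simp
    qed
    show "AE x in M. norm (\<bar>u j x - u0 x\<bar> * a x) \<le> 2 * C * a x" for j
    proof (rule AE_I2)
      fix x assume x: "x \<in> space M"
      have "0 \<le> a x" using bound(3)[OF x, of 0] by simp
      then show "norm (\<bar>u j x - u0 x\<bar> * a x) \<le> 2 * C * a x"
        using B[OF x] by (simp add: abs_mult mult_right_mono)
    qed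
  qed measurable
  then have z: "(\<lambda>j. \<integral>x. \<bar>u j x - u0 x\<bar> * a x \<partial>M) \<longlonglongrightarrow> 0" by simp
  have "(\<lambda>j. \<integral>x. (u j x - u0 x) * v j x \<partial>M) \<longlonglongrightarrow> 0"
    by (rule Lim_null_comparison[OF always_eventually z])
       (use integral_bounded_mult_le[OF a, where C="2 * C"] B bound in auto)
  from tendsto_add[OF this lim]
  have "(\<lambda>j. (\<integral>x. (u j x - u0 x) * v j x \<partial>M) + (\<integral>x. u0 x * v j x \<partial>M)) \<longlonglongrightarrow> L" by simp
  moreover have "(\<integral>x. (u j x - u0 x) * v j x \<partial>M) + (\<integral>x. u0 x * v j x \<partial>M) = (\<integral>x. u j x * v j x \<partial>M)" for j
  proof -
    have "integrable M (\<lambda>x. (u j x - u0 x) * v j x)"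
      by (rule integrable_bounded_mult[OF a, where C="2 * C"]) (use B bound in auto)
    moreover have "integrable M (\<lambda>x. u0 x * v j x)"
      by (rule integrable_bounded_mult[OF a, where C=C]) (use bound in auto)
    ultimately show ?thesis
      by (subst Bochner_Integration.integral_add[symmetric]) (auto simp: algebra_simps)
  qed
  ultimately show ?thesis by simp
qed

text \<open>
  The approximating functions come from the characterisation of measurable functions as almost everywhere
  limits of continuous ones; clamping keeps the bound.
\<close>

lemma AE_continuous_approximation:
  fixes g :: "'a::euclidean_space \<Rightarrow> real"
  assumes g: "g \<in> borel_measurable borel" "\<And>x. \<bar>g x\<bar> \<le> C"
  obtains h where "\<And>n. continuous_on UNIV (h n)" "\<And>n x. \<bar>h n x\<bar> \<le> C"
    "AE x in lborel. (\<lambda>n. h n x) \<longlonglongrightarrow> g x"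
proof -
  have "g \<in> borel_measurable lebesgue"
    using g(1) by (simp add: measurable_completion)
  then have "g measurable_on UNIV"
    by (rule lebesgue_measurable_imp_measurable_on) simp
  then obtain N h where N: "negligible N" and h: "\<And>n. continuous_on UNIV (h n)"
    and lim: "\<And>x. x \<notin> N \<Longrightarrow> (\<lambda>n. h n x) \<longlonglongrightarrow> g x"
    unfolding measurable_on_def by auto
  from N obtain N' where N': "N' \<in> null_sets lborel" "N \<subseteq> N'"
    by (auto simp: negligible_iff_null_sets null_sets_completion_iff2)
  have C: "- C \<le> C" using g(2)[of 0] by linarith
  define h' where "h' n x = max (- C) (min C (h n x))" for n x
  show thesis
  proof (rule that[of h'])
    show "continuous_on UNIV (h' n)" for n
      unfolding h'_def by (intro continuous_intros h)
    show "\<bar>h' n x\<bar> \<le> C" for n x using C by (auto simp: h'_def abs_le_iff)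
    have "AE x in lborel. x \<notin> N'" using N'(1) by (rule AE_not_in)
    then show "AE x in lborel. (\<lambda>n. h' n x) \<longlonglongrightarrow> g x"
    proof eventually_elim
      case (elim x)
      then have "(\<lambda>n. h' n x) \<longlonglongrightarrow> max (- C) (min C (g x))"
        using N'(2) unfolding h'_def by (intro tendsto_intros lim) auto
      moreover have "max (- C) (min C (g x)) = g x" using g(2)[of x] by (auto simp: abs_le_iff)
      ultimately show ?case by simp
    qed
  qed
qed

text \<open>
  Domination upgrades narrow convergence: a bounded measurable \<open>g\<close> is approximated by a bounded continuous
  \<open>h\<close> with \<open>\<integral> |h - g| a\<close> small, and this error controls the error for all the densities at once.
\<close>

lemma tendsto_integral_bounded_measurable:
  fixes f :: "nat \<Rightarrow> 'a::euclidean_space \<Rightarrow> real"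
  assumes a: "integrable lborel a"
    and f: "\<And>j. f j \<in> borel_measurable borel" "f0 \<in> borel_measurable borel"
    and bound: "\<And>j x. \<bar>f j x\<bar> \<le> a x" "\<And>x. \<bar>f0 x\<bar> \<le> a x"
    and weak: "\<And>g. continuous_on UNIV g \<Longrightarrow> bounded (range g) \<Longrightarrow>
      (\<lambda>j. \<integral>x. g x * f j x \<partial>lborel) \<longlonglongrightarrow> (\<integral>x. g x * f0 x \<partial>lborel)"
    and g: "g \<in> borel_measurable borel" "\<And>x. \<bar>g x\<bar> \<le> C"
  shows "(\<lambda>j. \<integral>x. g x * f j x \<partial>lborel) \<longlonglongrightarrow> (\<integral>x. g x * f0 x \<partial>lborel)"
proof -
  note [measurable] = f g(1)
  have [measurable]: "a \<in> borel_measurable borel" using a by simp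
  obtain h where h: "\<And>n. continuous_on UNIV (h n)" "\<And>n x. \<bar>h n x\<bar> \<le> C"
    and lim: "AE x in lborel. (\<lambda>n. h n x) \<longlonglongrightarrow> g x"
    using AE_continuous_approximation[OF g] by blast
  have [measurable]: "h n \<in> borel_measurable borel" for n
    using h(1) by (rule borel_measurable_continuous_onI)
  have a0: "0 \<le> a x" for x using bound(2)[of x] by linarith
  define E where "E n = (\<integral>x. \<bar>h n x - g x\<bar> * a x \<partial>lborel)" for n
  have B: "\<bar>h n x - g x\<bar> \<le> 2 * C" for n x
    using h(2)[of n x] g(2)[of x] by (smt (verit))
  have "E \<longlonglongrightarrow> (\<integral>x. 0 * a x \<partial>(lborel :: 'a measure))"
    unfolding E_def
  proof (rule tendsto_integral_perturb[OF a, where C="2 * C"])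
    show "AE x in lborel. (\<lambda>n. \<bar>h n x - g x\<bar>) \<longlonglongrightarrow> 0"
      using lim by eventually_elim (simp add: LIM_zero tendsto_rabs_zero)
    show "\<bar>0\<bar> \<le> 2 * C" using B[of 0 0] by simp
  qed (use B a0 in auto)
  then have E: "E \<longlonglongrightarrow> 0" by simp
  have dif: "\<bar>(\<integral>x. h n x * v x \<partial>lborel) - (\<integral>x. g x * v x \<partial>lborel)\<bar> \<le> E n"
    if [measurable]: "v \<in> borel_measurable borel" and v: "\<And>x. \<bar>v x\<bar> \<le> a x" for n v
  proof -
    have "integrable lborel (\<lambda>x. h n x * v x)" "integrable lborel (\<lambda>x. g x * v x)"
      by (rule integrable_bounded_mult[OF a, where C=C]; use h g v in simp)+
    then have "(\<integral>x. h n x * v x \<partial>lborel) - (\<integral>x. g x * v x \<partial>lborel) = (\<integral>x. (h n x - g x) * v x \<partial>lborel)"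
      by (subst Bochner_Integration.integral_diff[symmetric]) (auto simp: algebra_simps)
    then show ?thesis
      unfolding E_def using integral_bounded_mult_le[OF a, of "\<lambda>x. h n x - g x" v "2 * C"] B v by simp
  qed
  show ?thesis
  proof (rule LIMSEQ_I)
    fix e :: real assume "0 < e"
    then have "\<exists>n. norm (E n - 0) < e / 3"
      using LIMSEQ_D[OF E, of "e / 3"] by force
    then obtain n where n: "E n < e / 3" unfolding real_norm_def by (smt (verit))
    have "bounded (range (h n))" using h(2)[of n] by (auto simp: bounded_iff)
    from LIMSEQ_D[OF weak[OF h(1) this], of "e / 3"] \<open>0 < e\<close>
    obtain j0 where j0: "\<And>j. j \<ge> j0 \<Longrightarrow>
        \<bar>(\<integral>x. h n x * f j x \<partial>lborel) - (\<integral>x. h n x * f0 x \<partial>lborel)\<bar> < e / 3" by auto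
    show "\<exists>j0. \<forall>j\<ge>j0. norm ((\<integral>x. g x * f j x \<partial>lborel) - (\<integral>x. g x * f0 x \<partial>lborel)) < e"
    proof (intro exI[of _ j0] allI impI)
      fix j assume "j0 \<le> j"
      then show "norm ((\<integral>x. g x * f j x \<partial>lborel) - (\<integral>x. g x * f0 x \<partial>lborel)) < e"
        using j0[of j] dif[OF f(1) bound(1), of n j] dif[OF f(2) bound(2), of n] n
        unfolding real_norm_def by linarith
    qed
  qed
qed

lemma product_sigma_finite_lborel: "product_sigma_finite (\<lambda>_. lborel :: 'a::euclidean_space measure)"
  by unfold_locales

lemma prod_density_bound:
  fixes f a :: "'a \<Rightarrow> real"
  assumes "\<And>x. \<bar>f x\<bar> \<le> a x"
  shows "\<bar>\<Prod>i\<in>I. f (w i)\<bar> \<le> (\<Prod>i\<in>I. a (w i))"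
  unfolding abs_prod using assms by (intro prod_mono) auto

text \<open>
  Induction on \<open>k\<close> by Fubini. Integrating out the last coordinate turns the test function \<open>G\<close> into functions
  \<open>\<phi> j\<close> of the other coordinates, which are uniformly bounded and converge pointwise; the induction
  hypothesis treats their limit, and \<open>tendsto_integral_perturb\<close> the difference.
\<close>

lemma tendsto_integral_product_density:
  fixes f :: "nat \<Rightarrow> 'a::euclidean_space \<Rightarrow> real" and k :: nat
  assumes a: "integrable lborel a"
    and f: "\<And>j. f j \<in> borel_measurable borel" "f0 \<in> borel_measurable borel"
    and bound: "\<And>j x. \<bar>f j x\<bar> \<le> a x" "\<And>x. \<bar>f0 x\<bar> \<le> a x"
    and weak: "\<And>g C. g \<in> borel_measurable borel \<Longrightarrow> (\<And>x. \<bar>g x\<bar> \<le> C) \<Longrightarrow>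
      (\<lambda>j. \<integral>x. g x * f j x \<partial>lborel) \<longlonglongrightarrow> (\<integral>x. g x * f0 x \<partial>lborel)"
    and G: "G \<in> borel_measurable (PiM {..<k} (\<lambda>_. lborel))" "\<And>w. \<bar>G w\<bar> \<le> C"
  shows "(\<lambda>j. \<integral>w. G w * (\<Prod>i<k. f j (w i)) \<partial>PiM {..<k} (\<lambda>_. lborel))
    \<longlonglongrightarrow> (\<integral>w. G w * (\<Prod>i<k. f0 (w i)) \<partial>PiM {..<k} (\<lambda>_. lborel))"
  using G
proof (induction k arbitrary: G C)
  case 0
  then show ?case by (simp add: PiM_empty lebesgue_integral_count_space_finite)
next
  case (Suc k)
  interpret product_sigma_finite "\<lambda>_. lborel :: 'a measure" by (rule product_sigma_finite_lborel)
  interpret F: finite_product_sigma_finite "\<lambda>_. lborel :: 'a measure" "{..<k}" by standard auto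
  note [measurable] = f
  have [measurable]: "a \<in> borel_measurable borel" using a by simp
  have a0: "0 \<le> a x" for x using bound(2)[of x] by linarith
  have ins: "{..<Suc k} = insert k {..<k}" by auto
  have G [measurable]: "G \<in> borel_measurable (PiM (insert k {..<k}) (\<lambda>_. lborel))"
    using Suc.prems(1) by (simp add: ins)
  have upd [measurable]: "(\<lambda>y. G (x(k := y))) \<in> borel_measurable borel"
    if "x \<in> space (PiM {..<k} (\<lambda>_. lborel))" for x
    using measurable_comp[OF measurable_component_update[OF that, of k] G] by (simp add: comp_def)
  have slice: "(\<lambda>x. \<integral>y. G (x(k := y)) * v y \<partial>lborel) \<in> borel_measurable (PiM {..<k} (\<lambda>_. lborel))"
    if [measurable]: "v \<in> borel_measurable borel" for v
    by (rule lborel.borel_measurable_lebesgue_integral) measurable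
  define A where "A = (\<integral>y. a y \<partial>lborel)"
  have sl_bound: "\<bar>\<integral>y. G (x(k := y)) * v y \<partial>lborel\<bar> \<le> C * A"
    if "v \<in> borel_measurable borel" "\<And>y. \<bar>v y\<bar> \<le> a y" "x \<in> space (PiM {..<k} (\<lambda>_. lborel))" for v x
  proof -
    have "\<bar>\<integral>y. G (x(k := y)) * v y \<partial>lborel\<bar> \<le> (\<integral>y. \<bar>G (x(k := y))\<bar> * a y \<partial>lborel)"
      using that Suc.prems(2) by (intro integral_bounded_mult_le[OF a, where C=C]) auto
    also have "\<dots> \<le> (\<integral>y. C * a y \<partial>lborel)"
    proof (rule integral_mono)
      show "integrable lborel (\<lambda>y. \<bar>G (x(k := y))\<bar> * a y)"
        using that Suc.prems(2) a0 by (intro integrable_bounded_mult[OF a, where C=C]) auto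
    qed (use a Suc.prems(2) a0 in \<open>auto intro: mult_right_mono\<close>)
    finally show ?thesis by (simp add: A_def)
  qed
  have split: "(\<integral>w. G w * (\<Prod>i<Suc k. v (w i)) \<partial>PiM {..<Suc k} (\<lambda>_. lborel)) =
      (\<integral>x. (\<integral>y. G (x(k := y)) * v y \<partial>lborel) * (\<Prod>i<k. v (x i)) \<partial>PiM {..<k} (\<lambda>_. lborel))"
    if [measurable]: "v \<in> borel_measurable borel" and v: "\<And>y. \<bar>v y\<bar> \<le> a y" for v
  proof -
    have "integrable (PiM (insert k {..<k}) (\<lambda>_. lborel)) (\<lambda>w. \<Prod>i\<in>insert k {..<k}. a (w i))"
      by (rule product_integrable_prod) (auto simp: a)
    then have "integrable (PiM (insert k {..<k}) (\<lambda>_. lborel)) (\<lambda>w. G w * (\<Prod>i\<in>insert k {..<k}. v (w i)))"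
      by (rule integrable_bounded_mult[where C=C])
         (use Suc.prems(2) prod_density_bound[where f=v and a=a, OF v, where I="insert k {..<k}"] in \<open>auto simp del: prod.insert\<close>)
    then have eq: "(\<integral>w. G w * (\<Prod>i<Suc k. v (w i)) \<partial>PiM {..<Suc k} (\<lambda>_. lborel)) =
       (\<integral>x. (\<integral>y. G (x(k := y)) * (\<Prod>i\<in>insert k {..<k}. v ((x(k := y)) i)) \<partial>lborel) \<partial>PiM {..<k} (\<lambda>_. lborel))"
      unfolding ins by (intro product_integral_insert) auto
    have pr: "(\<Prod>i\<in>insert k {..<k}. v ((x(k := y)) i)) = v y * (\<Prod>i<k. v (x i))" for x y
      by (subst prod.insert) (auto intro!: prod.cong arg_cong2[where f="(*)"])
    show ?thesis
      unfolding eq pr by (simp add: mult.assoc[symmetric])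
  qed
  define \<phi> where "\<phi> j x = (\<integral>y. G (x(k := y)) * f j y \<partial>lborel)" for j x
  define \<phi>0 where "\<phi>0 x = (\<integral>y. G (x(k := y)) * f0 y \<partial>lborel)" for x
  \<comment> \<open>The induction hypothesis asks for a bound on all functions, but \<open>\<phi>0\<close> is only known to be
    bounded on the extensional ones, so it is cut off outside of them.\<close>
  define \<phi>0' where "\<phi>0' x = (if x \<in> space (PiM {..<k} (\<lambda>_. lborel)) then \<phi>0 x else 0)" for x
  have CA: "0 \<le> C * A"
  proof -
    have "0 \<le> C" using Suc.prems(2)[of undefined] by linarith
    then show ?thesis using a0 by (simp add: A_def)
  qed
  have \<phi>0' [measurable]: "\<phi>0' \<in> borel_measurable (PiM {..<k} (\<lambda>_. lborel))"
    using slice[OF f(2)] by (subst measurable_cong[where g=\<phi>0]) (auto simp: \<phi>0'_def \<phi>0_def[abs_def])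
  have "(\<lambda>j. \<integral>x. \<phi>0' x * (\<Prod>i<k. f j (x i)) \<partial>PiM {..<k} (\<lambda>_. lborel))
      \<longlonglongrightarrow> (\<integral>x. \<phi>0' x * (\<Prod>i<k. f0 (x i)) \<partial>PiM {..<k} (\<lambda>_. lborel))"
    using CA sl_bound[OF f(2) bound(2)] by (intro Suc.IH[where C="C * A"] \<phi>0') (auto simp: \<phi>0'_def \<phi>0_def)
  then have lim0: "(\<lambda>j. \<integral>x. \<phi>0 x * (\<Prod>i<k. f j (x i)) \<partial>PiM {..<k} (\<lambda>_. lborel))
      \<longlonglongrightarrow> (\<integral>x. \<phi>0 x * (\<Prod>i<k. f0 (x i)) \<partial>PiM {..<k} (\<lambda>_. lborel))"
    by (simp add: \<phi>0'_def cong: Bochner_Integration.integral_cong)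
  have "(\<lambda>j. \<integral>x. \<phi> j x * (\<Prod>i<k. f j (x i)) \<partial>PiM {..<k} (\<lambda>_. lborel))
      \<longlonglongrightarrow> (\<integral>x. \<phi>0 x * (\<Prod>i<k. f0 (x i)) \<partial>PiM {..<k} (\<lambda>_. lborel))"
  proof (rule tendsto_integral_perturb[where a="\<lambda>x. \<Prod>i<k. a (x i)" and C="C * A" and u=\<phi>, OF _ _ _ _ _ _ _ _ lim0])
    show "integrable (PiM {..<k} (\<lambda>_. lborel)) (\<lambda>x. \<Prod>i<k. a (x i))"
      by (rule product_integrable_prod) (auto simp: a)
    show "\<phi> j \<in> borel_measurable (PiM {..<k} (\<lambda>_. lborel))" for j
      unfolding \<phi>_def by (rule slice) measurable
    show "\<phi>0 \<in> borel_measurable (PiM {..<k} (\<lambda>_. lborel))"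
      unfolding \<phi>0_def by (rule slice) measurable
    show "\<bar>\<phi> j x\<bar> \<le> C * A" if "x \<in> space (PiM {..<k} (\<lambda>_. lborel))" for j x
      unfolding \<phi>_def using sl_bound[OF f(1) bound(1) that] .
    show "\<bar>\<phi>0 x\<bar> \<le> C * A" if "x \<in> space (PiM {..<k} (\<lambda>_. lborel))" for x
      unfolding \<phi>0_def using sl_bound[OF f(2) bound(2) that] .
    show "\<bar>\<Prod>i<k. f j (x i)\<bar> \<le> (\<Prod>i<k. a (x i))" for j x
      by (rule prod_density_bound[OF bound(1)])
    show "AE x in PiM {..<k} (\<lambda>_. lborel). (\<lambda>j. \<phi> j x) \<longlonglongrightarrow> \<phi>0 x"
      unfolding \<phi>_def \<phi>0_def using Suc.prems(2) by (intro AE_I2 weak[where C=C] upd) auto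
  qed measurable
  then show ?case
    using split[OF f(1) bound(1)] split[OF f(2) bound(2)] unfolding \<phi>_def \<phi>0_def by simp
qed

lemma AE_tuple_avoids_finite:
  fixes S :: "'a::euclidean_space set"
  assumes "finite S"
  shows "AE w in PiM {..<k::nat} (\<lambda>_. lborel). S \<inter> w ` {..<k} = {}"
proof -
  interpret product_sigma_finite "\<lambda>_. lborel :: 'a measure" by (rule product_sigma_finite_lborel)
  have "AE w in PiM {..<k} (\<lambda>_. lborel). w i \<noteq> s" if i: "i < k" for i and s :: 'a
  proof (rule AE_I)
    let ?B = "PiE {..<k} (\<lambda>j. if j = i then {s} else UNIV)"
    show "{w \<in> space (PiM {..<k} (\<lambda>_. lborel)). \<not> w i \<noteq> s} \<subseteq> ?B"
      by (auto simp: space_PiM PiE_def Pi_def)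
    show "?B \<in> sets (PiM {..<k} (\<lambda>_. lborel))"
      by (intro sets_PiM_I_finite) auto
    have "emeasure (PiM {..<k} (\<lambda>_. lborel)) ?B =
        (\<Prod>j<k. emeasure lborel (if j = i then {s} else UNIV))"
      by (intro emeasure_PiM) auto
    also have "\<dots> = 0"
      using i by (intro prod_zero) (auto intro!: bexI[of _ i])
    finally show "emeasure (PiM {..<k} (\<lambda>_. lborel)) ?B = 0" .
  qed
  then have "AE w in PiM {..<k} (\<lambda>_. lborel). \<forall>i\<in>{..<k}. \<forall>s\<in>S. w i \<noteq> s"
    using assms by (intro AE_finite_allI) auto
  then show ?thesis by eventually_elim auto
qed

section \<open>Moments of the offspring measure\<close>

lemma lborel_distr_reflect: "distr lborel borel (\<lambda>w. x - w) = (lborel :: 'a::euclidean_space measure)"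
  using lborel_affine[of "-1" x] by (simp add: density_1)

lemma nn_integral_lborel_reflect:
  fixes f :: "'a::euclidean_space \<Rightarrow> ennreal"
  assumes [measurable]: "f \<in> borel_measurable borel"
  shows "(\<integral>\<^sup>+w. f (x - w) \<partial>lborel) = (\<integral>\<^sup>+w. f w \<partial>lborel)"
  by (subst (2) lborel_distr_reflect[of x, symmetric]) (simp add: nn_integral_distr)

lemma prob_density_reflect:
  fixes f :: "'a::euclidean_space \<Rightarrow> real"
  assumes "prob_density f"
  shows "prob_density (\<lambda>w. f (x - w))"
proof -
  have [measurable]: "f \<in> borel_measurable borel" using assms by (simp add: prob_density_def)
  show ?thesis
    using assms nn_integral_lborel_reflect[of "\<lambda>w. ennreal (f w)" x] by (simp add: prob_density_def)
qed

lemma offspring_term_le: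
  fixes f :: "'a::euclidean_space \<Rightarrow> real"
  assumes f: "prob_density f" and g: "\<And>\<zeta>. fcard \<zeta> = n \<Longrightarrow> g \<zeta> \<le> c"
  shows "offspring_term f g n \<le> c"
proof -
  interpret product_sigma_finite "\<lambda>_. lborel :: 'a measure" by (rule product_sigma_finite_lborel)
  have [measurable]: "f \<in> borel_measurable borel" using f by (simp add: prob_density_def)
  have "offspring_term f g n \<le> (\<integral>\<^sup>+w. c * (\<Prod>i<n. ennreal (f (w i))) \<partial>PiM {..<n} (\<lambda>_. lborel))"
    unfolding offspring_term_def
    by (intro nn_integral_mono mult_right_mono) (auto simp: indicator_def fcard_conf_of intro!: g)
  also have "\<dots> = c * (\<Prod>i<n. \<integral>\<^sup>+w. ennreal (f w) \<partial>lborel)"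
    by (subst nn_integral_cmult) (simp_all add: product_nn_integral_prod[of "{..<n}" "\<lambda>_ w. ennreal (f w)"])
  also have "\<dots> = c" using f by (simp add: prob_density_def)
  finally show ?thesis .
qed

lemma nn_integral_offspring_le:
  fixes f :: "'a::euclidean_space \<Rightarrow> real"
  assumes f: "prob_density f" and g [measurable]: "g \<in> borel_measurable borel"
    and le: "\<And>\<zeta>. g \<zeta> \<le> ennreal (c (fcard \<zeta>))" and c: "\<And>n. 0 \<le> c n"
    and s: "(\<lambda>k. c (Suc k) / fact (Suc k)) sums s"
  shows "(\<integral>\<^sup>+\<zeta>. g \<zeta> \<partial>offspring f) \<le> ennreal s"
proof -
  have [measurable]: "f \<in> borel_measurable borel" using f by (simp add: prob_density_def)
  have "(\<integral>\<^sup>+\<zeta>. g \<zeta> \<partial>offspring f) = (\<Sum>k. ennreal (1 / fact (Suc k)) * offspring_term f g (Suc k))"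
    by (rule nn_integral_offspring) measurable
  also have "\<dots> \<le> (\<Sum>k. ennreal (1 / fact (Suc k)) * ennreal (c (Suc k)))"
  proof (intro suminf_le mult_left_mono)
    show "offspring_term f g (Suc k) \<le> ennreal (c (Suc k))" for k
      by (rule offspring_term_le[OF f]) (metis le)
  qed (auto intro: summableI)
  also have "\<dots> = (\<Sum>k. ennreal (c (Suc k) / fact (Suc k)))"
    using c by (simp add: ennreal_mult'[symmetric] del: fact_Suc)
  also have "\<dots> = ennreal s"
    using s c by (subst suminf_ennreal2) (auto simp: sums_iff simp del: fact_Suc)
  finally show ?thesis .
qed

lemma sums_inverse_fact: "(\<lambda>n. 1 / fact n) sums exp (1::real)"
  using exp_converges[of "1::real"] by (simp add: divide_inverse)

lemma Suc_divide_fact: "real (Suc n) / fact (Suc n) = 1 / fact n"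
  unfolding fact_Suc by (simp del: of_nat_Suc)

lemma sums_id_fact: "(\<lambda>n. real n / fact n) sums exp 1"
proof -
  have "(\<lambda>n. real (Suc n) / fact (Suc n)) sums exp 1"
    unfolding Suc_divide_fact by (rule sums_inverse_fact)
  then show ?thesis by (subst (asm) sums_Suc_iff) simp
qed

lemma sums_square_fact: "(\<lambda>n. (real n)\<^sup>2 / fact n) sums (2 * exp 1)"
proof -
  have "(\<lambda>n. real n / fact n + 1 / fact n) sums (exp 1 + exp 1)"
    by (intro sums_add sums_id_fact sums_inverse_fact)
  moreover have "(real (Suc n))\<^sup>2 / fact (Suc n) = real n / fact n + 1 / fact n" for n
  proof -
    have "(real (Suc n))\<^sup>2 / fact (Suc n) = real (Suc n) * (real (Suc n) / fact (Suc n))"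
      by (simp only: power2_eq_square times_divide_eq_right)
    also have "\<dots> = real n / fact n + 1 / fact n"
      unfolding Suc_divide_fact by (simp add: add_divide_distrib)
    finally show ?thesis .
  qed
  ultimately have "(\<lambda>n. (real (Suc n))\<^sup>2 / fact (Suc n)) sums (2 * exp 1)"
    by simp
  then show ?thesis by (subst (asm) sums_Suc_iff) simp
qed

text \<open>
  Moments of the weights \<open>1 / k!\<close>, \<open>k \<ge> 1\<close>. Only the constant term feels the missing summand \<open>k = 0\<close>.
\<close>

lemma sums_quadratic_fact:
  "(\<lambda>k. (\<alpha> + \<beta> * real (Suc k) + \<gamma> * (real (Suc k))\<^sup>2) / fact (Suc k))
     sums (\<alpha> * (exp 1 - 1) + \<beta> * exp 1 + \<gamma> * (2 * exp 1))"
proof -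
  have "(\<lambda>k. \<alpha> * (1 / fact k) + \<beta> * (real k / fact k) + \<gamma> * ((real k)\<^sup>2 / fact k))
      sums (\<alpha> * exp 1 + \<beta> * exp 1 + \<gamma> * (2 * exp 1))"
    by (intro sums_add sums_mult sums_inverse_fact sums_id_fact sums_square_fact)
  then have "(\<lambda>k. (\<alpha> + \<beta> * real k + \<gamma> * (real k)\<^sup>2) / fact k)
      sums ((\<alpha> * (exp 1 - 1) + \<beta> * exp 1 + \<gamma> * (2 * exp 1)) + \<alpha>)"
    by (simp add: add_divide_distrib algebra_simps)
  then show ?thesis by (subst sums_Suc_iff) simp
qed

section \<open>The Lyapunov function under births and deaths\<close>

lemma lyapunov_nonneg: "0 \<le> lyapunov \<eta>"
  by (simp add: lyapunov_def)

lemma lyapunov_funion_le: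
  "lyapunov (\<eta> |\<union>| \<zeta>) \<le> lyapunov \<eta> +
     ((1 + 2 * real (fcard \<eta>)) * real (fcard \<zeta>) + (real (fcard \<zeta>))\<^sup>2)"
proof -
  have "fcard (\<eta> |\<union>| \<zeta>) \<le> fcard \<eta> + fcard \<zeta>"
    by (simp add: fcard.rep_eq card_Un_le)
  then have "real (fcard (\<eta> |\<union>| \<zeta>)) \<le> real (fcard \<eta>) + real (fcard \<zeta>)" by simp
  then have "lyapunov (\<eta> |\<union>| \<zeta>) \<le> (real (fcard \<eta>) + real (fcard \<zeta>)) + (real (fcard \<eta>) + real (fcard \<zeta>))\<^sup>2"
    unfolding lyapunov_def by (intro add_mono power_mono) auto
  then show ?thesis by (simp add: lyapunov_def power2_eq_square algebra_simps)
qed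

text \<open>
  The decrease \<open>2|\<eta>|\<close> is what later compensates the growth caused by interacting births.
\<close>

lemma lyapunov_fminus:
  assumes "x \<in> fset \<eta>"
  shows "lyapunov (\<eta> |-| {|x|}) = lyapunov \<eta> - 2 * real (fcard \<eta>)"
proof -
  have "fcard \<eta> > 0" using assms by (auto simp: fcard.rep_eq card_gt_0_iff)
  moreover have "fcard (\<eta> |-| {|x|}) = fcard \<eta> - 1"
    using assms by (simp add: fcard.rep_eq)
  ultimately show ?thesis
    by (simp add: lyapunov_def of_nat_diff power2_eq_square algebra_simps)
qed

lemma continuous_on_fcard: "continuous_on UNIV (\<lambda>\<eta> :: 'a::t2_space fset. real (fcard \<eta>))"
proof (rule continuous_on_fsetI)
  fix n
  show "continuous_on (distinct_seqs n) (\<lambda>x :: nat \<Rightarrow> 'a. real (fcard (conf_of n x)))"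
    by (rule continuous_on_eq[OF continuous_on_const]) (simp add: fcard_conf_of_distinct)
qed

lemma measurable_fcard [measurable]:
  "(\<lambda>\<eta> :: 'a::euclidean_space fset. real (fcard \<eta>)) \<in> borel_measurable borel"
  by (rule borel_measurable_continuous_onI[OF continuous_on_fcard])

lemma measurable_lyapunov [measurable]:
  "(lyapunov :: 'a::euclidean_space fset \<Rightarrow> real) \<in> borel_measurable borel"
  unfolding lyapunov_def[abs_def] by measurable

lemma sum_fset_le:
  assumes "\<And>x. x \<in> fset \<eta> \<Longrightarrow> g x \<le> (c::real)"
  shows "(\<Sum>x\<in>fset \<eta>. g x) \<le> c * real (fcard \<eta>)"
  using sum_bounded_above[of "fset \<eta>" g c] assms by (simp add: fcard.rep_eq mult.commute)

lemma nonneg_Cb_bound: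
  assumes "nonneg_Cb r"
  obtains C where "0 \<le> C" "\<And>t x. 0 \<le> t \<Longrightarrow> r (t, x) \<le> C"
proof -
  obtain B where "\<forall>z\<in>r ` ({0..} \<times> UNIV). norm z \<le> B"
    using assms by (auto simp: nonneg_Cb_def bounded_iff)
  then have "\<bar>r (t, x)\<bar> \<le> B" if "0 \<le> t" for t x using that by force
  then have "r (t, x) \<le> max 0 B" if "0 \<le> t" for t x
    using that by (meson abs_ge_self max.coboundedI2 order_trans)
  then show thesis using that[of "max 0 B"] by auto
qed

lemma interaction_rate_nonneg:
  assumes "nonneg_Cb r" "nonneg_Cb a" "0 \<le> t"
  shows "0 \<le> interaction_rate r a t \<eta> x"
  using assms by (auto simp: interaction_rate_def nonneg_Cb_def intro!: add_nonneg_nonneg sum_nonneg)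

lemma sum_fminus_le:
  assumes "\<And>y. g y \<le> (c::real)" "0 \<le> c"
  shows "(\<Sum>y\<in>fset (\<eta> |-| {|x|}). g y) \<le> c * real (fcard \<eta>)"
proof -
  have "(\<Sum>y\<in>fset (\<eta> |-| {|x|}). g y) \<le> c * real (fcard (\<eta> |-| {|x|}))"
    by (rule sum_fset_le) (rule assms)
  also have "\<dots> \<le> c * real (fcard \<eta>)"
    using assms(2) by (intro mult_left_mono) (auto simp: fcard.rep_eq intro!: card_mono)
  finally show ?thesis .
qed

locale birth_death_rates =
  fixes m am l bp ap :: "real \<times> 'a::euclidean_space \<Rightarrow> real"
  assumes m: "nonneg_Cb m" and l: "nonneg_Cb l" and am: "nonneg_Cb am" and bp: "nonneg_Cb bp"
    and ap: "\<And>t. t \<ge> 0 \<Longrightarrow> prob_density (\<lambda>x. ap (t, x))"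
begin

abbreviation "Q \<equiv> transition m am l bp ap"
abbreviation "death \<equiv> interaction_rate m am"
abbreviation "birth \<equiv> interaction_rate l bp"
abbreviation "kids t x \<equiv> offspring (\<lambda>w. ap (t, x - w))"

lemma ap_reflect: "0 \<le> t \<Longrightarrow> prob_density (\<lambda>w. ap (t, x - w))"
  using prob_density_reflect[OF ap] .

lemma ap_measurable: "0 \<le> t \<Longrightarrow> (\<lambda>w. ap (t, w)) \<in> borel_measurable borel"
  using ap by (simp add: prob_density_def)

lemma sets_transition: "0 \<le> t \<Longrightarrow> sets (Q t \<eta>) = sets borel"
  by (rule transition_mixture(1)[OF ap_measurable])

lemma space_transition: "0 \<le> t \<Longrightarrow> space (Q t \<eta>) = UNIV"
  using sets_eq_imp_space_eq[OF sets_transition] by simp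

lemma nn_integral_transition:
  assumes "0 \<le> t" "g \<in> borel_measurable borel"
  shows "(\<integral>\<^sup>+\<omega>. g \<omega> \<partial>Q t \<eta>) = (\<Sum>x\<in>fset \<eta>. ennreal (death t \<eta> x) * g (\<eta> |-| {|x|})) +
      ennreal (1 / exp 1) * (\<Sum>x\<in>fset \<eta>. ennreal (birth t \<eta> x) *
        (\<integral>\<^sup>+\<zeta>. g (\<eta> |\<union>| \<zeta>) \<partial>kids t x))"
  using transition_mixture(2)[OF ap_measurable assms(2)] assms(1) .

lemma emeasure_kids_le: "0 \<le> t \<Longrightarrow> emeasure (kids t x) UNIV \<le> ennreal (exp 1)"
proof -
  assume t: "0 \<le> t"
  have "emeasure (kids t x) UNIV = (\<integral>\<^sup>+\<zeta>. 1 \<partial>kids t x)"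
    by (simp add: sets_eq_imp_space_eq[OF sets_offspring])
  also have "\<dots> \<le> ennreal (exp 1 - 1)"
    using sums_quadratic_fact[of 1 0 0]
    by (intro nn_integral_offspring_le[where c="\<lambda>_. 1"] ap_reflect t) (simp_all del: fact_Suc)
  also have "\<dots> \<le> ennreal (exp 1)" by (simp add: ennreal_leI)
  finally show ?thesis .
qed

lemma total_rate_eq:
  assumes "0 \<le> t"
  shows "total_rate Q t \<eta> = (\<Sum>x\<in>fset \<eta>. ennreal (death t \<eta> x)) +
      ennreal (1 / exp 1) * (\<Sum>x\<in>fset \<eta>. ennreal (birth t \<eta> x) * emeasure (kids t x) UNIV)"
proof -
  have "total_rate Q t \<eta> = (\<integral>\<^sup>+\<omega>. 1 \<partial>Q t \<eta>)"
    using assms by (simp add: total_rate_def space_transition)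
  then show ?thesis
    using nn_integral_transition[OF assms, of "\<lambda>_. 1" \<eta>]
    by (simp add: sets_eq_imp_space_eq[OF sets_offspring])
qed

text \<open>
  Each point dies or reproduces at a rate of at most a constant times \<open>1 + |\<eta>|\<close>.
\<close>

lemma condition_D_transition: "condition_D lyapunov Q"
proof -
  obtain Cm Cam Cl Cbp where C: "0 \<le> Cm" "0 \<le> Cam" "0 \<le> Cl" "0 \<le> Cbp"
    and le: "\<And>t x. 0 \<le> t \<Longrightarrow> m (t, x) \<le> Cm" "\<And>t x. 0 \<le> t \<Longrightarrow> am (t, x) \<le> Cam"
      "\<And>t x. 0 \<le> t \<Longrightarrow> l (t, x) \<le> Cl" "\<And>t x. 0 \<le> t \<Longrightarrow> bp (t, x) \<le> Cbp"
    using nonneg_Cb_bound[OF m] nonneg_Cb_bound[OF am] nonneg_Cb_bound[OF l] nonneg_Cb_bound[OF bp]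
    by metis
  define a where "a = Cm + Cam + Cl + Cbp + 1"
  have a: "0 < a" using C by (simp add: a_def)
  have "total_rate Q t \<eta> \<le> ennreal (a * lyapunov \<eta>)" if t: "0 \<le> t" for t \<eta>
  proof -
    let ?N = "real (fcard \<eta>)"
    have nn: "0 \<le> death t \<eta> x" "0 \<le> birth t \<eta> x" for x
      by (intro interaction_rate_nonneg m am l bp t)+
    have d: "death t \<eta> x \<le> Cm + Cam * ?N" and b: "birth t \<eta> x \<le> Cl + Cbp * ?N" for x
      unfolding interaction_rate_def by (intro add_mono sum_fminus_le; use le t C in simp)+
    have "total_rate Q t \<eta> \<le> (\<Sum>x\<in>fset \<eta>. ennreal (death t \<eta> x)) +
        ennreal (1 / exp 1) * (\<Sum>x\<in>fset \<eta>. ennreal (birth t \<eta> x) * ennreal (exp 1))"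
      unfolding total_rate_eq[OF t]
      by (intro add_mono mult_left_mono sum_mono emeasure_kids_le t) auto
    also have "\<dots> = ennreal (\<Sum>x\<in>fset \<eta>. death t \<eta> x) +
        ennreal (1 / exp 1) * ennreal ((\<Sum>x\<in>fset \<eta>. birth t \<eta> x) * exp 1)"
      using nn by (simp add: ennreal_mult''[symmetric] sum_distrib_right)
    also have "\<dots> = ennreal ((\<Sum>x\<in>fset \<eta>. death t \<eta> x) + (\<Sum>x\<in>fset \<eta>. birth t \<eta> x))"
      using nn by (simp add: ennreal_mult'[symmetric] sum_nonneg)
    also have "\<dots> \<le> ennreal (a * lyapunov \<eta>)"
    proof (rule ennreal_leI)
      have "(\<Sum>x\<in>fset \<eta>. death t \<eta> x) + (\<Sum>x\<in>fset \<eta>. birth t \<eta> x) \<le>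
          (Cm + Cam * ?N) * ?N + (Cl + Cbp * ?N) * ?N"
        by (intro add_mono sum_fset_le d b)
      also have "\<dots> = (Cm + Cl) * ?N + (Cam + Cbp) * ?N\<^sup>2"
        by (simp add: power2_eq_square algebra_simps)
      also have "\<dots> \<le> a * ?N + a * ?N\<^sup>2"
        using C by (intro add_mono mult_right_mono) (auto simp: a_def)
      finally show "(\<Sum>x\<in>fset \<eta>. death t \<eta> x) + (\<Sum>x\<in>fset \<eta>. birth t \<eta> x) \<le> a * lyapunov \<eta>"
        by (simp add: lyapunov_def distrib_left)
    qed
    finally show ?thesis .
  qed
  then show ?thesis
    unfolding condition_D_def using a by (intro allI impI exI[of _ a]) auto
qed

text \<open>
  The mean increase follows from \<open>\<Sum>k\<ge>1. k / k! = e\<close> and \<open>\<Sum>k\<ge>1. k\<^sup>2 / k! = 2e\<close>. The mass of the offspring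
  measure is left as it is, because it is compared with the same mass in the total rate.
\<close>

lemma nn_integral_kids_lyapunov_le:
  assumes t: "0 \<le> t"
  shows "(\<integral>\<^sup>+\<zeta>. ennreal (lyapunov (\<eta> |\<union>| \<zeta>)) \<partial>kids t x) \<le>
    ennreal (lyapunov \<eta>) * emeasure (kids t x) UNIV + ennreal ((3 + 2 * real (fcard \<eta>)) * exp 1)"
proof -
  let ?c = "\<lambda>n. (1 + 2 * real (fcard \<eta>)) * real n + (real n)\<^sup>2"
  have [measurable]: "(\<lambda>\<zeta> :: 'a fset. ennreal (?c (fcard \<zeta>))) \<in> borel_measurable borel" by measurable
  have "(\<integral>\<^sup>+\<zeta>. ennreal (lyapunov (\<eta> |\<union>| \<zeta>)) \<partial>kids t x) \<le>
      (\<integral>\<^sup>+\<zeta>. ennreal (lyapunov \<eta>) + ennreal (?c (fcard \<zeta>)) \<partial>kids t x)"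
  proof (intro nn_integral_mono)
    fix \<zeta> :: "'a fset"
    have "ennreal (lyapunov (\<eta> |\<union>| \<zeta>)) \<le> ennreal (lyapunov \<eta> + ?c (fcard \<zeta>))"
      by (rule ennreal_leI[OF lyapunov_funion_le])
    also have "\<dots> = ennreal (lyapunov \<eta>) + ennreal (?c (fcard \<zeta>))"
      by (rule ennreal_plus) (auto simp: lyapunov_nonneg)
    finally show "ennreal (lyapunov (\<eta> |\<union>| \<zeta>)) \<le> ennreal (lyapunov \<eta>) + ennreal (?c (fcard \<zeta>))" .
  qed
  also have "\<dots> = ennreal (lyapunov \<eta>) * emeasure (kids t x) UNIV + (\<integral>\<^sup>+\<zeta>. ennreal (?c (fcard \<zeta>)) \<partial>kids t x)"
    by (subst nn_integral_add) (simp_all add: sets_eq_imp_space_eq[OF sets_offspring])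
  also have "(\<integral>\<^sup>+\<zeta>. ennreal (?c (fcard \<zeta>)) \<partial>kids t x) \<le> ennreal ((3 + 2 * real (fcard \<eta>)) * exp 1)"
    using sums_quadratic_fact[of 0 "1 + 2 * real (fcard \<eta>)" 1]
    by (intro nn_integral_offspring_le[where c="?c"] ap_reflect t)
       (simp_all add: algebra_simps del: fact_Suc)
  finally show ?thesis by (simp add: add_mono)
qed

text \<open>
  After removing the common term \<open>q V\<close>, it remains to bound the sum over \<open>x \<in> \<eta>\<close> of \<open>(3 + 2|\<eta>|)\<close> times the
  birth rate of \<open>x\<close> minus \<open>2|\<eta>|\<close> times its death rate. The interaction part of the birth rate is at most that
  of the death rate, so everything cubic in \<open>|\<eta>|\<close> cancels.
\<close>

lemma condition_B_transition:
  assumes dominated: "\<And>t x. t \<ge> 0 \<Longrightarrow> bp (t, x) \<le> am (t, x)"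
  shows "condition_B lyapunov Q"
proof -
  obtain Cl Cbp where C: "0 \<le> Cl" "0 \<le> Cbp"
    and le: "\<And>t x. 0 \<le> t \<Longrightarrow> l (t, x) \<le> Cl" "\<And>t x. 0 \<le> t \<Longrightarrow> bp (t, x) \<le> Cbp"
    using nonneg_Cb_bound[OF l] nonneg_Cb_bound[OF bp] by metis
  define c where "c = 3 * Cl + 3 * Cbp"
  have "(\<integral>\<^sup>+\<omega>. ennreal (lyapunov \<omega>) \<partial>Q t \<eta>)
      \<le> ennreal (c * lyapunov \<eta>) + total_rate Q t \<eta> * ennreal (lyapunov \<eta>)" if t: "0 \<le> t" for t \<eta>
  proof -
    let ?N = "real (fcard \<eta>)" and ?V = "lyapunov \<eta>"
    let ?s = "\<lambda>x. \<Sum>y\<in>fset (\<eta> |-| {|x|}). bp (t, x - y)"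
    define \<mu> where "\<mu> x = enn2real (emeasure (kids t x) UNIV)" for x
    have \<mu>: "emeasure (kids t x) UNIV = ennreal (\<mu> x)" "0 \<le> \<mu> x" for x
      using le_less_trans[OF emeasure_kids_le[OF t, of x] ennreal_less_top]
      by (auto simp: \<mu>_def ennreal_enn2real)
    have nn: "0 \<le> death t \<eta> x" "0 \<le> birth t \<eta> x" for x
      by (intro interaction_rate_nonneg m am l bp t)+
    have V: "0 \<le> ?V" by (rule lyapunov_nonneg)
    have s: "?s x \<le> Cbp * ?N" for x
      by (rule sum_fminus_le) (use le t C in auto)
    have d: "?s x \<le> death t \<eta> x" for x
      using m t dominated unfolding interaction_rate_def nonneg_Cb_def
      by (intro add_increasing sum_mono) auto
    have b: "birth t \<eta> x \<le> Cl + ?s x" for x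
      unfolding interaction_rate_def using le t by auto
    \<comment> \<open>The term \<open>2 * ?N * ?s x\<close> is the cubic one; it is absorbed by the death rate.\<close>
    have "birth t \<eta> x * (3 + 2 * ?N) \<le> (Cl * (3 + 2 * ?N) + 3 * Cbp * ?N) + 2 * ?N * death t \<eta> x" for x
    proof -
      have "birth t \<eta> x * (3 + 2 * ?N) \<le> (Cl + ?s x) * (3 + 2 * ?N)"
        using b by (intro mult_right_mono) auto
      also have "\<dots> = Cl * (3 + 2 * ?N) + 3 * ?s x + 2 * ?N * ?s x" by (simp add: algebra_simps)
      also have "\<dots> \<le> Cl * (3 + 2 * ?N) + 3 * (Cbp * ?N) + 2 * ?N * death t \<eta> x"
        using s d C by (intro add_mono mult_left_mono) auto
      finally show ?thesis by simp
    qed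
    then have "(\<Sum>x\<in>fset \<eta>. birth t \<eta> x * (3 + 2 * ?N) - 2 * ?N * death t \<eta> x)
        \<le> (Cl * (3 + 2 * ?N) + 3 * Cbp * ?N) * ?N"
      by (intro sum_fset_le) (simp add: diff_le_eq)
    also have "\<dots> = 3 * Cl * ?N + (2 * Cl + 3 * Cbp) * ?N\<^sup>2"
      by (simp add: power2_eq_square algebra_simps)
    also have "\<dots> \<le> c * ?N + c * ?N\<^sup>2"
      using C by (intro add_mono mult_right_mono) (auto simp: c_def)
    also have "\<dots> = c * ?V" by (simp add: lyapunov_def distrib_left)
    finally have main: "(\<Sum>x\<in>fset \<eta>. birth t \<eta> x * (3 + 2 * ?N)) - (\<Sum>x\<in>fset \<eta>. 2 * ?N * death t \<eta> x) \<le> c * ?V"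
      by (simp add: sum_subtractf)
    have "(\<integral>\<^sup>+\<omega>. ennreal (lyapunov \<omega>) \<partial>Q t \<eta>) \<le>
        (\<Sum>x\<in>fset \<eta>. ennreal (death t \<eta> x) * ennreal (lyapunov (\<eta> |-| {|x|}))) +
        ennreal (1 / exp 1) * (\<Sum>x\<in>fset \<eta>. ennreal (birth t \<eta> x) *
          (ennreal ?V * ennreal (\<mu> x) + ennreal ((3 + 2 * ?N) * exp 1)))"
      using nn_integral_kids_lyapunov_le[OF t, where \<eta>=\<eta>] unfolding \<mu>
      by (subst nn_integral_transition[OF t]) (auto intro!: add_mono mult_left_mono sum_mono)
    also have "\<dots> = ennreal ((\<Sum>x\<in>fset \<eta>. death t \<eta> x * lyapunov (\<eta> |-| {|x|})) +
        1 / exp 1 * (\<Sum>x\<in>fset \<eta>. birth t \<eta> x * (?V * \<mu> x + (3 + 2 * ?N) * exp 1)))"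
    proof -
      have "(\<Sum>x\<in>fset \<eta>. ennreal (death t \<eta> x) * ennreal (lyapunov (\<eta> |-| {|x|}))) =
          ennreal (\<Sum>x\<in>fset \<eta>. death t \<eta> x * lyapunov (\<eta> |-| {|x|}))"
        by (subst sum_ennreal[symmetric]) (auto simp: nn lyapunov_nonneg ennreal_mult')
      moreover have "0 \<le> (\<Sum>x\<in>fset \<eta>. death t \<eta> x * lyapunov (\<eta> |-| {|x|}))"
        by (intro sum_nonneg mult_nonneg_nonneg nn lyapunov_nonneg)
      moreover have "ennreal (1 / exp 1) * (\<Sum>x\<in>fset \<eta>. ennreal (birth t \<eta> x) *
          (ennreal ?V * ennreal (\<mu> x) + ennreal ((3 + 2 * ?N) * exp 1))) =
          ennreal (1 / exp 1 * (\<Sum>x\<in>fset \<eta>. birth t \<eta> x * (?V * \<mu> x + (3 + 2 * ?N) * exp 1)))"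
        using nn V \<mu>(2)
        by (simp add: ennreal_mult'[symmetric] ennreal_plus[symmetric] sum_nonneg mult_nonneg_nonneg
            divide_nonneg_nonneg add_nonneg_nonneg del: ennreal_plus)
      moreover have "0 \<le> 1 / exp 1 * (\<Sum>x\<in>fset \<eta>. birth t \<eta> x * (?V * \<mu> x + (3 + 2 * ?N) * exp 1))"
        by (intro mult_nonneg_nonneg sum_nonneg add_nonneg_nonneg nn V \<mu>(2)) auto
      ultimately show ?thesis by (simp only: ennreal_plus)
    qed
    also have "(\<Sum>x\<in>fset \<eta>. death t \<eta> x * lyapunov (\<eta> |-| {|x|})) =
        (\<Sum>x\<in>fset \<eta>. death t \<eta> x) * ?V - (\<Sum>x\<in>fset \<eta>. 2 * ?N * death t \<eta> x)"
    proof -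
      have "(\<Sum>x\<in>fset \<eta>. death t \<eta> x * lyapunov (\<eta> |-| {|x|})) =
          (\<Sum>x\<in>fset \<eta>. death t \<eta> x * ?V - 2 * ?N * death t \<eta> x)"
        by (intro sum.cong refl) (simp add: lyapunov_fminus right_diff_distrib)
      then show ?thesis by (simp only: sum_subtractf sum_distrib_right)
    qed
    also have "1 / exp 1 * (\<Sum>x\<in>fset \<eta>. birth t \<eta> x * (?V * \<mu> x + (3 + 2 * ?N) * exp 1)) =
        (1 / exp 1 * (\<Sum>x\<in>fset \<eta>. birth t \<eta> x * \<mu> x)) * ?V + (\<Sum>x\<in>fset \<eta>. birth t \<eta> x * (3 + 2 * ?N))"
    proof -
      have "birth t \<eta> x * (?V * \<mu> x + (3 + 2 * ?N) * exp 1) =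
          (birth t \<eta> x * \<mu> x) * ?V + birth t \<eta> x * (3 + 2 * ?N) * exp 1" for x
        by (simp add: algebra_simps)
      then show ?thesis
        by (simp add: sum.distrib sum_distrib_right[symmetric] add_divide_distrib)
    qed
    also have "ennreal ((\<Sum>x\<in>fset \<eta>. death t \<eta> x) * ?V - (\<Sum>x\<in>fset \<eta>. 2 * ?N * death t \<eta> x) +
         ((1 / exp 1 * (\<Sum>x\<in>fset \<eta>. birth t \<eta> x * \<mu> x)) * ?V + (\<Sum>x\<in>fset \<eta>. birth t \<eta> x * (3 + 2 * ?N))))
       \<le> ennreal (c * ?V + ((\<Sum>x\<in>fset \<eta>. death t \<eta> x) + 1 / exp 1 * (\<Sum>x\<in>fset \<eta>. birth t \<eta> x * \<mu> x)) * ?V)"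
      using main by (intro ennreal_leI) (simp add: distrib_right)
    also have "\<dots> = ennreal (c * ?V) + total_rate Q t \<eta> * ennreal ?V"
    proof -
      have "total_rate Q t \<eta> = ennreal ((\<Sum>x\<in>fset \<eta>. death t \<eta> x) + 1 / exp 1 * (\<Sum>x\<in>fset \<eta>. birth t \<eta> x * \<mu> x))"
        unfolding total_rate_eq[OF t] \<mu>(1) using nn \<mu>(2)
        by (simp add: ennreal_mult'[symmetric] ennreal_plus[symmetric] sum_nonneg mult_nonneg_nonneg
            divide_nonneg_nonneg del: ennreal_plus)
      then show ?thesis
        using V nn \<mu>(2) C by (simp add: c_def ennreal_mult'[symmetric] ennreal_plus[symmetric] sum_nonneg
            mult_nonneg_nonneg divide_nonneg_nonneg add_nonneg_nonneg del: ennreal_plus)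
    qed
    finally show ?thesis .
  qed
  then show ?thesis
    unfolding condition_B_def using C by (intro exI[of _ "\<lambda>_. c"]) (auto simp: c_def)
qed

end

section \<open>Continuity of the transition function\<close>

lemma integral_lborel_reflect:
  fixes h :: "'a::euclidean_space \<Rightarrow> real"
  assumes "h \<in> borel_measurable borel"
  shows "(\<integral>w. h (x - w) \<partial>lborel) = (\<integral>w. h w \<partial>lborel)"
  by (subst (2) lborel_distr_reflect[of x, symmetric]) (simp add: integral_distr assms)

lemma integrable_lborel_reflect:
  fixes h :: "'a::euclidean_space \<Rightarrow> real"
  assumes "integrable lborel h"
  shows "integrable lborel (\<lambda>w. h (x - w))"
proof -
  have [measurable]: "h \<in> borel_measurable borel" using assms by simp
  have "integrable (distr lborel borel (\<lambda>w. x - w)) h" using assms by (simp add: lborel_distr_reflect)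
  then show ?thesis by (subst (asm) integrable_distr_eq) auto
qed

text \<open>
  A bound for \<open>K (1 + V(\<eta> \<union> \<zeta>))\<close> with \<open>|\<eta>| = n\<close> and \<open>|\<zeta>| \<le> k\<close>, written as a polynomial in \<open>k\<close>.
\<close>

definition growth_bound :: "real \<Rightarrow> nat \<Rightarrow> nat \<Rightarrow> real" where
  "growth_bound K n k = K * (1 + real n + (real n)\<^sup>2) + K * (1 + 2 * real n) * real k + K * (real k)\<^sup>2"

lemma growth_bound_nonneg: "0 \<le> K \<Longrightarrow> 0 \<le> growth_bound K n k"
  by (simp add: growth_bound_def)

lemma summable_growth_bound: "summable (\<lambda>k. growth_bound K n (Suc k) / fact (Suc k))"
  unfolding growth_bound_def
  using sums_quadratic_fact[of "K * (1 + real n + (real n)\<^sup>2)" "K * (1 + 2 * real n)" K]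
  by (rule sums_summable)

lemma growth_bound_funion:
  assumes F: "\<And>\<eta>. \<bar>F \<eta>\<bar> \<le> K * (1 + lyapunov \<eta>)" and K: "0 \<le> K" and k: "fcard \<zeta> \<le> k"
  shows "\<bar>F (\<eta> |\<union>| \<zeta>)\<bar> \<le> growth_bound K (fcard \<eta>) k"
proof -
  let ?N = "real (fcard \<eta>)"
  have "lyapunov (\<eta> |\<union>| \<zeta>) \<le> lyapunov \<eta> + ((1 + 2 * ?N) * real (fcard \<zeta>) + (real (fcard \<zeta>))\<^sup>2)"
    by (rule lyapunov_funion_le)
  also have "\<dots> \<le> lyapunov \<eta> + ((1 + 2 * ?N) * real k + (real k)\<^sup>2)"
    using k by (intro add_mono mult_left_mono power_mono) auto
  finally have "K * (1 + lyapunov (\<eta> |\<union>| \<zeta>)) \<le> K * (1 + (lyapunov \<eta> + ((1 + 2 * ?N) * real k + (real k)\<^sup>2)))"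
    using K by (intro mult_left_mono add_left_mono) auto
  also have "\<dots> = growth_bound K (fcard \<eta>) k"
    by (simp add: growth_bound_def lyapunov_def algebra_simps)
  finally show ?thesis using F[of "\<eta> |\<union>| \<zeta>"] by linarith
qed

definition birth_integrand :: "('a fset \<Rightarrow> real) \<Rightarrow> 'a fset \<Rightarrow> nat \<Rightarrow> (nat \<Rightarrow> 'a) \<Rightarrow> real" where
  "birth_integrand F \<eta> k w = indicator (distinct_tuples k) w * F (\<eta> |\<union>| conf_of k w)"

definition birth_moment ::
  "('a::euclidean_space fset \<Rightarrow> real) \<Rightarrow> 'a fset \<Rightarrow> ('a \<Rightarrow> real) \<Rightarrow> nat \<Rightarrow> real" where
  "birth_moment F \<eta> f k =
     (\<integral>w. birth_integrand F \<eta> k w * (\<Prod>i<k. f (w i)) \<partial>PiM {..<k} (\<lambda>_. lborel))"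

lemma measurable_birth_integrand:
  fixes F :: "'a::euclidean_space fset \<Rightarrow> real"
  assumes "F \<in> borel_measurable borel"
  shows "birth_integrand F \<eta> k \<in> borel_measurable (PiM {..<k} (\<lambda>_. lborel))"
proof -
  have "(\<lambda>w. F (\<eta> |\<union>| conf_of k w)) \<in>
      borel_measurable (restrict_space (PiM {..<k} (\<lambda>_. lborel)) (distinct_tuples k))"
    using measurable_compose[OF measurable_compose[OF measurable_conf_of measurable_funion] assms] .
  then show ?thesis
    by (subst (asm) borel_measurable_restrict_space_iff)
       (simp_all add: birth_integrand_def[abs_def] sets.Int_space_eq2)
qed

lemma fcard_conf_of_le: "fcard (conf_of k w) \<le> k"
  using card_image_le[of "{..<k}" w] by (simp add: fcard.rep_eq)

lemma birth_integrand_le: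
  assumes F: "\<And>\<eta>. \<bar>F \<eta>\<bar> \<le> K * (1 + lyapunov \<eta>)" and K: "0 \<le> K"
  shows "\<bar>birth_integrand F \<eta> k w\<bar> \<le> growth_bound K (fcard \<eta>) k"
  using growth_bound_funion[OF F K fcard_conf_of_le] growth_bound_nonneg[OF K]
  by (auto simp: birth_integrand_def indicator_def)

text \<open>
  The passage to real-valued integrals prepares the limit theorems above, whose proofs subtract.
\<close>

lemma offspring_term_eq_birth_moment:
  fixes F :: "'a::euclidean_space fset \<Rightarrow> real"
  assumes f: "prob_density f" and F: "F \<in> borel_measurable borel" "\<And>\<eta>. 0 \<le> F \<eta>"
    "\<And>\<eta>. F \<eta> \<le> K * (1 + lyapunov \<eta>)" and K: "0 \<le> K"
  shows "offspring_term f (\<lambda>\<zeta>. ennreal (F (\<eta> |\<union>| \<zeta>))) k = ennreal (birth_moment F \<eta> f k)"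
    and "0 \<le> birth_moment F \<eta> f k" and "birth_moment F \<eta> f k \<le> growth_bound K (fcard \<eta>) k"
proof -
  interpret product_sigma_finite "\<lambda>_. lborel :: 'a measure" by (rule product_sigma_finite_lborel)
  have f0: "\<And>x. 0 \<le> f x" and [measurable]: "f \<in> borel_measurable borel"
    using f by (auto simp: prob_density_def)
  have int: "integrable lborel f"
    using f by (intro integrableI_nonneg) (auto simp: prob_density_def)
  have abs_F: "\<bar>F \<eta>\<bar> \<le> K * (1 + lyapunov \<eta>)" for \<eta> using F(2,3) by simp
  have "integrable (PiM {..<k} (\<lambda>_. lborel)) (\<lambda>w. \<Prod>i<k. f (w i))"
    by (rule product_integrable_prod) (auto simp: int)
  then have "integrable (PiM {..<k} (\<lambda>_. lborel)) (\<lambda>w. birth_integrand F \<eta> k w * (\<Prod>i<k. f (w i)))"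
    by (rule integrable_bounded_mult)
       (use measurable_birth_integrand[OF F(1)] birth_integrand_le[OF abs_F K] f0 in \<open>auto simp: prod_nonneg\<close>)
  then have "(\<integral>\<^sup>+w. ennreal (birth_integrand F \<eta> k w * (\<Prod>i<k. f (w i))) \<partial>PiM {..<k} (\<lambda>_. lborel)) =
      ennreal (birth_moment F \<eta> f k)"
    unfolding birth_moment_def
    by (rule nn_integral_eq_integral) (auto simp: birth_integrand_def F f0 prod_nonneg)
  moreover have "ennreal (birth_integrand F \<eta> k w * (\<Prod>i<k. f (w i))) =
      indicator (distinct_tuples k) w * ennreal (F (\<eta> |\<union>| conf_of k w)) * (\<Prod>i<k. ennreal (f (w i)))" for w
    using F f0 by (simp add: birth_integrand_def ennreal_mult' prod_nonneg prod_ennreal indicator_def)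
  ultimately show eq: "offspring_term f (\<lambda>\<zeta>. ennreal (F (\<eta> |\<union>| \<zeta>))) k = ennreal (birth_moment F \<eta> f k)"
    by (simp add: offspring_term_def)
  show "0 \<le> birth_moment F \<eta> f k"
    unfolding birth_moment_def by (auto simp: birth_integrand_def F f0 prod_nonneg)
  have "ennreal (birth_moment F \<eta> f k) \<le> ennreal (growth_bound K (fcard \<eta>) k)"
    unfolding eq[symmetric]
  proof (rule offspring_term_le[OF f], rule ennreal_leI)
    fix \<zeta> :: "'a fset" assume "fcard \<zeta> = k"
    then show "F (\<eta> |\<union>| \<zeta>) \<le> growth_bound K (fcard \<eta>) k"
      using growth_bound_funion[OF abs_F K, of \<zeta> k \<eta>] by simp
  qed
  then show "birth_moment F \<eta> f k \<le> growth_bound K (fcard \<eta>) k"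
    using growth_bound_nonneg[OF K] by simp
qed

context birth_death_rates begin

text \<open>
  The integral of \<open>F\<close> against the transition function, expanded into quantities whose continuity can
  be examined one by one.
\<close>

definition mean_after_jump :: "('a fset \<Rightarrow> real) \<Rightarrow> real \<Rightarrow> 'a fset \<Rightarrow> real" where
  "mean_after_jump F t \<eta> = (\<Sum>x\<in>fset \<eta>. death t \<eta> x * F (\<eta> |-| {|x|})) +
     1 / exp 1 * (\<Sum>x\<in>fset \<eta>. birth t \<eta> x *
       (\<Sum>k. birth_moment F \<eta> (\<lambda>w. ap (t, x - w)) (Suc k) / fact (Suc k)))"

lemma integral_transition_nonneg:
  assumes t: "0 \<le> t" and F: "F \<in> borel_measurable borel" "\<And>\<eta>. 0 \<le> F \<eta>"
    "\<And>\<eta>. F \<eta> \<le> K * (1 + lyapunov \<eta>)" and K: "0 \<le> K"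
  shows "(\<integral>\<^sup>+\<omega>. ennreal (F \<omega>) \<partial>Q t \<eta>) = ennreal (mean_after_jump F t \<eta>)"
    and "integrable (Q t \<eta>) F" and "(\<integral>\<omega>. F \<omega> \<partial>Q t \<eta>) = mean_after_jump F t \<eta>"
proof -
  note [measurable] = F(1)
  note bm = offspring_term_eq_birth_moment[OF ap_reflect[OF t] F K]
  let ?bm = "\<lambda>x k. birth_moment F \<eta> (\<lambda>w. ap (t, x - w)) (Suc k) / fact (Suc k)"
  have summ: "summable (?bm x)" for x
    by (rule summable_comparison_test_ev[OF _ summable_growth_bound[of K "fcard \<eta>"]])
       (use bm in \<open>auto intro!: always_eventually divide_right_mono simp del: fact_Suc\<close>)
  have bm0: "0 \<le> ?bm x k" for x k using bm(2) by simp
  have nn: "0 \<le> death t \<eta> x" "0 \<le> birth t \<eta> x" for x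
    by (intro interaction_rate_nonneg m am l bp t)+
  have S0: "0 \<le> (\<Sum>k. ?bm x k)" for x
    by (intro suminf_nonneg summ bm0)
  have kids: "(\<integral>\<^sup>+\<zeta>. ennreal (F (\<eta> |\<union>| \<zeta>)) \<partial>kids t x) = ennreal (\<Sum>k. ?bm x k)" for x
  proof -
    have "(\<integral>\<^sup>+\<zeta>. ennreal (F (\<eta> |\<union>| \<zeta>)) \<partial>kids t x) =
        (\<Sum>k. ennreal (1 / fact (Suc k)) * ennreal (birth_moment F \<eta> (\<lambda>w. ap (t, x - w)) (Suc k)))"
      using ap_reflect[OF t, of x] by (subst nn_integral_offspring) (simp_all add: bm prob_density_def)
    also have "\<dots> = (\<Sum>k. ennreal (?bm x k))"
      using bm(2) by (simp add: ennreal_mult'[symmetric] del: fact_Suc)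
    also have "\<dots> = ennreal (\<Sum>k. ?bm x k)"
      by (rule suminf_ennreal2[OF bm0 summ])
    finally show ?thesis .
  qed
  have J0: "0 \<le> mean_after_jump F t \<eta>"
    unfolding mean_after_jump_def
    by (intro add_nonneg_nonneg mult_nonneg_nonneg sum_nonneg nn F S0) auto
  show nn_eq: "(\<integral>\<^sup>+\<omega>. ennreal (F \<omega>) \<partial>Q t \<eta>) = ennreal (mean_after_jump F t \<eta>)"
  proof -
    have "(\<integral>\<^sup>+\<omega>. ennreal (F \<omega>) \<partial>Q t \<eta>) =
      (\<Sum>x\<in>fset \<eta>. ennreal (death t \<eta> x) * ennreal (F (\<eta> |-| {|x|}))) +
      ennreal (1 / exp 1) * (\<Sum>x\<in>fset \<eta>. ennreal (birth t \<eta> x) * ennreal (\<Sum>k. ?bm x k))"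
      by (subst nn_integral_transition[OF t]) (simp_all add: kids)
    also have "\<dots> = (\<Sum>x\<in>fset \<eta>. ennreal (death t \<eta> x * F (\<eta> |-| {|x|}))) +
      ennreal (1 / exp 1) * (\<Sum>x\<in>fset \<eta>. ennreal (birth t \<eta> x * (\<Sum>k. ?bm x k)))"
      using nn by (simp only: ennreal_mult')
    also have "\<dots> = ennreal (\<Sum>x\<in>fset \<eta>. death t \<eta> x * F (\<eta> |-| {|x|})) +
      ennreal (1 / exp 1 * (\<Sum>x\<in>fset \<eta>. birth t \<eta> x * (\<Sum>k. ?bm x k)))"
      by (subst (1 2) sum_ennreal) (auto intro!: mult_nonneg_nonneg nn F S0 simp: ennreal_mult'[symmetric] simp del: fact_Suc)
    also have "\<dots> = ennreal (mean_after_jump F t \<eta>)"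
      unfolding mean_after_jump_def
      by (intro ennreal_plus[symmetric] mult_nonneg_nonneg sum_nonneg nn F S0) auto
    finally show ?thesis .
  qed
  have meas: "F \<in> borel_measurable (Q t \<eta>)"
    using F(1) measurable_cong_sets[OF sets_transition[OF t] refl] by blast
  then show "integrable (Q t \<eta>) F"
    using F(2) nn_eq by (intro integrableI_nonneg) auto
  show "(\<integral>\<omega>. F \<omega> \<partial>Q t \<eta>) = mean_after_jump F t \<eta>"
    using F(2) nn_eq meas J0 by (subst integral_eq_nn_integral) auto
qed

end

locale continuous_birth_death_rates = birth_death_rates +
  assumes narrow: "narrowly_continuous ap"
    and dominated: "\<And>\<Lambda> T. compact \<Lambda> \<Longrightarrow> T > 0 \<Longrightarrow>
          \<exists>a_star :: 'a \<Rightarrow> real. integrable lborel a_star \<and>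
            (\<forall>x\<in>\<Lambda>. \<forall>t\<in>{0..T}. \<forall>y. ap (t, x - y) \<le> a_star y)"
begin

text \<open>
  The points of a convergent sequence together with its limit form a compact set, so the domination
  hypothesis provides one majorant for the whole sequence of dispersal densities.
\<close>

lemma sequence_dominated:
  assumes T: "\<And>j. 0 \<le> T j" "T \<longlonglongrightarrow> t" "0 \<le> t" and X: "X \<longlonglongrightarrow> x"
  obtains a where "integrable lborel a" "\<And>j w. \<bar>ap (T j, X j - w)\<bar> \<le> a w" "\<And>w. \<bar>ap (t, x - w)\<bar> \<le> a w"
proof -
  have "Bseq T" using T(2) by (intro convergent_imp_Bseq convergentI)
  then obtain B where B: "B > 0" "\<And>j. T j \<le> B"
    by (metis BseqE abs_le_D1 real_norm_def)
  have "compact (insert x (range X))" using X by (rule compact_sequence_with_limit)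
  moreover have "max B t > 0" using B by simp
  ultimately obtain a where a: "integrable lborel a"
    "\<And>y s w. y \<in> insert x (range X) \<Longrightarrow> s \<in> {0..max B t} \<Longrightarrow> ap (s, y - w) \<le> a w"
    using dominated by meson
  have nonneg: "0 \<le> ap (s, w)" if "0 \<le> s" for s w
    using ap[OF that] by (auto simp: prob_density_def)
  show thesis
  proof (rule that[OF a(1)])
    show "\<bar>ap (T j, X j - w)\<bar> \<le> a w" for j w
      using a(2)[of "X j" "T j" w] nonneg T(1) B(2)[of j] by (simp add: le_max_iff_disj)
    show "\<bar>ap (t, x - w)\<bar> \<le> a w" for w
      using a(2)[of x t w] nonneg T(3) by simp
  qed
qed

text \<open>
  Reflecting the variable moves the position of the parent from the density into the test function:
  \<open>\<integral> g(w) a\<^sup>+(s, y - w) dw = \<integral> g(y - w) a\<^sup>+(s, w) dw\<close>. The densities then depend on the time alone, as in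
  the hypothesis of narrow continuity, and the test functions converge pointwise.
\<close>

lemma dispersal_weakly_continuous:
  assumes T: "\<And>j. 0 \<le> T j" "T \<longlonglongrightarrow> t" "0 \<le> t" and X: "X \<longlonglongrightarrow> x"
    and g: "continuous_on UNIV g" "bounded (range g)"
  shows "(\<lambda>j. \<integral>w. g w * ap (T j, X j - w) \<partial>lborel) \<longlonglongrightarrow> (\<integral>w. g w * ap (t, x - w) \<partial>lborel)"
proof -
  have [measurable]: "g \<in> borel_measurable borel" by (rule borel_measurable_continuous_onI[OF g(1)])
  have ap_m [measurable]: "(\<lambda>w. ap (s, w)) \<in> borel_measurable borel" if "0 \<le> s" for s
    by (rule ap_measurable[OF that])
  obtain C where C: "\<And>w. \<bar>g w\<bar> \<le> C" using g(2) by (auto simp: bounded_iff)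
  have reflect: "(\<integral>w. g w * ap (s, y - w) \<partial>lborel) = (\<integral>w. g (y - w) * ap (s, w) \<partial>lborel)"
    if "0 \<le> s" for s y
    using integral_lborel_reflect[of "\<lambda>w. g (y - w) * ap (s, w)" y] ap_m[OF that] by simp
  obtain a where a: "integrable lborel a" "\<And>j w. \<bar>ap (T j, 0 - w)\<bar> \<le> a w"
      "\<And>w. \<bar>ap (t, 0 - w)\<bar> \<le> a w"
    by (rule sequence_dominated[OF T tendsto_const[of 0]]) blast
  have g_cont: "isCont g y" for y
    using g(1) by (simp add: continuous_on_eq_continuous_at)
  have "(\<lambda>j. \<integral>w. g (X j - w) * ap (T j, w) \<partial>lborel) \<longlonglongrightarrow> (\<integral>w. g (x - w) * ap (t, w) \<partial>lborel)"
  proof (rule tendsto_integral_perturb[where ?u0.0="\<lambda>w. g (x - w)" and C=C and a="\<lambda>w. a (0 - w)"])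
    show "integrable lborel (\<lambda>w. a (0 - w))" by (rule integrable_lborel_reflect[OF a(1)])
    show "(\<lambda>w. ap (T j, w)) \<in> borel_measurable lborel" for j using ap_m[OF T(1)] by simp
    show "\<bar>ap (T j, w)\<bar> \<le> a (0 - w)" for j w using a(2)[of j "0 - w"] by simp
    show "AE w in lborel. (\<lambda>j. g (X j - w)) \<longlonglongrightarrow> g (x - w)"
      by (intro AE_I2 isCont_tendsto_compose[OF g_cont] tendsto_intros X)
    have "continuous_on UNIV (\<lambda>w. g (x - w))"
      by (rule continuous_on_compose2[OF g(1)]) (auto intro!: continuous_intros)
    moreover have "bounded (range (\<lambda>w. g (x - w)))"
      by (rule bounded_subset[OF g(2)]) auto
    ultimately have "continuous_on {0..} (\<lambda>t. \<integral>w. g (x - w) * ap (t, w) \<partial>lborel)"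
      using narrow unfolding narrowly_continuous_def by blast
    then show "(\<lambda>j. \<integral>w. g (x - w) * ap (T j, w) \<partial>lborel) \<longlonglongrightarrow> (\<integral>w. g (x - w) * ap (t, w) \<partial>lborel)"
      by (rule continuous_on_tendsto_compose) (use T in auto)
  qed (use C in auto)
  then show ?thesis using reflect T by simp
qed

text \<open>
  For almost every position of the children, they are distinct and avoid the limiting parents; there
  the union is continuous in the parents and the integrands converge.
\<close>

lemma birth_moment_continuous:
  assumes F: "continuous_on UNIV F" "\<And>\<eta>. \<bar>F \<eta>\<bar> \<le> K * (1 + lyapunov \<eta>)" and K: "0 \<le> K"
    and T: "\<And>j. 0 \<le> T j" "T \<longlonglongrightarrow> t" "0 \<le> t" and Y: "Y \<longlonglongrightarrow> y"
    and X: "\<And>j. X j \<in> distinct_seqs n" "x \<in> distinct_seqs n" "\<And>i. i < n \<Longrightarrow> (\<lambda>j. X j i) \<longlonglongrightarrow> x i"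
  shows "(\<lambda>j. birth_moment F (conf_of n (X j)) (\<lambda>w. ap (T j, Y j - w)) k)
    \<longlonglongrightarrow> birth_moment F (conf_of n x) (\<lambda>w. ap (t, y - w)) k"
proof -
  interpret product_sigma_finite "\<lambda>_. lborel :: 'a measure" by (rule product_sigma_finite_lborel)
  have Fm: "F \<in> borel_measurable borel" by (rule borel_measurable_continuous_onI[OF F(1)])
  obtain a where a: "integrable lborel a" "\<And>j w. \<bar>ap (T j, Y j - w)\<bar> \<le> a w" "\<And>w. \<bar>ap (t, y - w)\<bar> \<le> a w"
    using sequence_dominated[OF T Y] by blast
  have f: "(\<lambda>w. ap (T j, Y j - w)) \<in> borel_measurable borel" "(\<lambda>w. ap (t, y - w)) \<in> borel_measurable borel" for j
    using ap_reflect T by (auto simp: prob_density_def)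
  note [measurable] = f
  have bounds: "\<bar>birth_integrand F (conf_of n x) k w\<bar> \<le> growth_bound K n k"
      "\<bar>birth_integrand F (conf_of n (X j)) k w\<bar> \<le> growth_bound K n k" for j w
    using birth_integrand_le[OF F(2) K] X(1,2) fcard_conf_of_distinct by metis+
  have lim0: "(\<lambda>j. \<integral>w. birth_integrand F (conf_of n x) k w * (\<Prod>i<k. ap (T j, Y j - w i)) \<partial>PiM {..<k} (\<lambda>_. lborel))
      \<longlonglongrightarrow> birth_moment F (conf_of n x) (\<lambda>w. ap (t, y - w)) k"
    unfolding birth_moment_def
  proof (rule tendsto_integral_product_density[OF a(1) f a(2,3) _ measurable_birth_integrand[OF Fm] bounds(1)])
    fix g :: "'a \<Rightarrow> real" and C assume g: "g \<in> borel_measurable borel" "\<And>w. \<bar>g w\<bar> \<le> C"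
    show "(\<lambda>j. \<integral>w. g w * ap (T j, Y j - w) \<partial>lborel) \<longlonglongrightarrow> (\<integral>w. g w * ap (t, y - w) \<partial>lborel)"
      by (rule tendsto_integral_bounded_measurable[OF a(1) f a(2,3) _ g])
         (rule dispersal_weakly_continuous[OF T Y])
  qed
  show ?thesis
    unfolding birth_moment_def[of F "conf_of n (X j)" for j]
  proof (rule tendsto_integral_perturb[OF _ _ _ _ bounds(2,1) _ _ lim0])
    show "integrable (PiM {..<k} (\<lambda>_. lborel)) (\<lambda>w. \<Prod>i<k. a (w i))"
      by (rule product_integrable_prod) (auto simp: a)
    show "\<bar>\<Prod>i<k. ap (T j, Y j - w i)\<bar> \<le> (\<Prod>i<k. a (w i))" for j w
      using prod_density_bound[of "\<lambda>w. ap (T j, Y j - w)" a] a(2) by blast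
    have "AE w in PiM {..<k} (\<lambda>_. lborel). x ` {..<n} \<inter> w ` {..<k} = {}"
      by (rule AE_tuple_avoids_finite) simp
    then show "AE w in PiM {..<k} (\<lambda>_. lborel). (\<lambda>j. birth_integrand F (conf_of n (X j)) k w)
        \<longlonglongrightarrow> birth_integrand F (conf_of n x) k w"
    proof eventually_elim
      case (elim w)
      show ?case
      proof (cases "w \<in> distinct_tuples k")
        case True
        then have "w \<in> distinct_seqs k" by (simp add: distinct_tuples_def distinct_seqs_def)
        then have "(\<lambda>j. conf_of n (X j) |\<union>| conf_of k w) \<longlonglongrightarrow> conf_of n x |\<union>| conf_of k w"
          by (intro tendsto_funion X elim)
        then have "(\<lambda>j. F (conf_of n (X j) |\<union>| conf_of k w)) \<longlonglongrightarrow> F (conf_of n x |\<union>| conf_of k w)"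
          by (intro continuous_on_tendsto_compose[OF F(1)]) auto
        then show ?thesis using True by (simp add: birth_integrand_def)
      qed (simp add: birth_integrand_def)
    qed
  qed (use measurable_birth_integrand[OF Fm] in measurable)
qed

lemma tendsto_interaction_rate:
  fixes X :: "nat \<Rightarrow> nat \<Rightarrow> 'a"
  assumes r: "nonneg_Cb r" and a: "nonneg_Cb a"
    and T: "\<And>j. 0 \<le> T j" "T \<longlonglongrightarrow> t" "0 \<le> t"
    and X: "\<And>j. X j \<in> distinct_seqs n" "x \<in> distinct_seqs n" "\<And>i. i < n \<Longrightarrow> (\<lambda>j. X j i) \<longlonglongrightarrow> x i"
    and i: "i < n"
  shows "(\<lambda>j. interaction_rate r a (T j) (conf_of n (X j)) (X j i)) \<longlonglongrightarrow>
    interaction_rate r a t (conf_of n x) (x i)"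
proof -
  have lim: "(\<lambda>j. h (T j, Y j)) \<longlonglongrightarrow> h (t, y)" if h: "nonneg_Cb h" and "Y \<longlonglongrightarrow> y" for h and Y :: "nat \<Rightarrow> 'a" and y
  proof (rule continuous_on_tendsto_compose[where f=h and s="{0..} \<times> UNIV"])
    show "continuous_on ({0..} \<times> UNIV) h" using h by (simp add: nonneg_Cb_def)
    show "(\<lambda>j. (T j, Y j)) \<longlonglongrightarrow> (t, y)" by (intro tendsto_intros T that)
  qed (use T in auto)
  have "(\<lambda>j. r (T j, X j i) + (\<Sum>k\<in>{..<n} - {i}. a (T j, X j i - X j k))) \<longlonglongrightarrow>
      r (t, x i) + (\<Sum>k\<in>{..<n} - {i}. a (t, x i - x k))"
    by (intro tendsto_add tendsto_sum lim[OF r] lim[OF a] tendsto_diff X i) auto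
  then show ?thesis
    unfolding interaction_rate_def sum_conf_of(2)[OF X(1) i] sum_conf_of(2)[OF X(2) i] .
qed

text \<open>
  The growth bound depends only on the number of parents, which is constant along the sequence, so it
  serves as the summable majorant in Tannery's theorem.
\<close>

lemma tendsto_mean_after_jump:
  assumes F: "continuous_on UNIV F" "\<And>\<eta>. 0 \<le> F \<eta>" "\<And>\<eta>. F \<eta> \<le> K * (1 + lyapunov \<eta>)" and K: "0 \<le> K"
    and T: "\<And>j. 0 \<le> T j" "T \<longlonglongrightarrow> t" "0 \<le> t"
    and X: "\<And>j. X j \<in> distinct_seqs n" "x \<in> distinct_seqs n" "\<And>i. i < n \<Longrightarrow> (\<lambda>j. X j i) \<longlonglongrightarrow> x i"
  shows "(\<lambda>j. mean_after_jump F (T j) (conf_of n (X j))) \<longlonglongrightarrow> mean_after_jump F t (conf_of n x)"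
proof -
  have Fm: "F \<in> borel_measurable borel" by (rule borel_measurable_continuous_onI[OF F(1)])
  have abs_F: "\<bar>F \<eta>\<bar> \<le> K * (1 + lyapunov \<eta>)" for \<eta> using F(2,3) by simp
  have death_lim: "(\<lambda>j. F (conf_of n (X j) |-| {|X j i|})) \<longlonglongrightarrow> F (conf_of n x |-| {|x i|})" if i: "i < n" for i
  proof (rule continuous_on_tendsto_compose[OF F(1)])
    have "(\<lambda>j. conf_of (n - 1) (\<lambda>k. if k < i then X j k else X j (Suc k))) \<longlonglongrightarrow>
        conf_of (n - 1) (\<lambda>k. if k < i then x k else x (Suc k))"
    proof (rule tendsto_conf_of[OF conf_of_fminus(2)[OF X(2) i]])
      fix k assume "k < n - 1"
      then show "(\<lambda>j. if k < i then X j k else X j (Suc k)) \<longlonglongrightarrow> (if k < i then x k else x (Suc k))"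
        using X(3)[of k] X(3)[of "Suc k"] by auto
    qed
    then show "(\<lambda>j. conf_of n (X j) |-| {|X j i|}) \<longlonglongrightarrow> conf_of n x |-| {|x i|}"
      unfolding conf_of_fminus(1)[OF X(1) i] conf_of_fminus(1)[OF X(2) i] .
  qed auto
  have series_lim: "(\<lambda>j. \<Sum>k. birth_moment F (conf_of n (X j)) (\<lambda>w. ap (T j, X j i - w)) (Suc k) / fact (Suc k))
      \<longlonglongrightarrow> (\<Sum>k. birth_moment F (conf_of n x) (\<lambda>w. ap (t, x i - w)) (Suc k) / fact (Suc k))" if i: "i < n" for i
  proof (rule tannerys_theorem[THEN conjunct2, THEN conjunct2])
    show "(\<lambda>j. birth_moment F (conf_of n (X j)) (\<lambda>w. ap (T j, X j i - w)) (Suc k) / fact (Suc k)) \<longlonglongrightarrow>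
        birth_moment F (conf_of n x) (\<lambda>w. ap (t, x i - w)) (Suc k) / fact (Suc k)" for k
      by (intro tendsto_divide tendsto_const birth_moment_continuous[OF F(1) abs_F K T X(3)[OF i] X]) auto
    show "summable (\<lambda>k. growth_bound K n (Suc k) / fact (Suc k))" by (rule summable_growth_bound)
    show "\<forall>\<^sub>F (k, j) in at_top \<times>\<^sub>F sequentially.
        norm (birth_moment F (conf_of n (X j)) (\<lambda>w. ap (T j, X j i - w)) (Suc k) / fact (Suc k))
        \<le> growth_bound K n (Suc k) / fact (Suc k)"
    proof (rule always_eventually, safe)
      fix k j
      note bm = offspring_term_eq_birth_moment[OF ap_reflect[OF T(1)[of j], of "X j i"] Fm F(2,3) K,
          where \<eta>="conf_of n (X j)" and k="Suc k"]
      show "norm (birth_moment F (conf_of n (X j)) (\<lambda>w. ap (T j, X j i - w)) (Suc k) / fact (Suc k))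
        \<le> growth_bound K n (Suc k) / fact (Suc k)"
        using bm(2,3) fcard_conf_of_distinct[OF X(1)] by (simp add: divide_right_mono del: fact_Suc)
    qed
  qed simp
  show ?thesis
    unfolding mean_after_jump_def sum_conf_of(1)[OF X(1)] sum_conf_of(1)[OF X(2)]
    by (intro tendsto_add tendsto_mult tendsto_sum tendsto_const death_lim series_lim
        tendsto_interaction_rate m am l bp T X) auto
qed

lemma continuous_on_integral_transition_nonneg:
  assumes F: "continuous_on UNIV F" "\<And>\<eta>. 0 \<le> F \<eta>" "\<And>\<eta>. F \<eta> \<le> K * (1 + lyapunov \<eta>)" and K: "0 \<le> K"
  shows "continuous_on ({0..} \<times> UNIV) (\<lambda>(t, \<eta>). \<integral>\<omega>. F \<omega> \<partial>Q t \<eta>)"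
proof (rule continuous_on_fset_prodI, rule continuous_on_sequentiallyI)
  have Fm: "F \<in> borel_measurable borel" by (rule borel_measurable_continuous_onI[OF F(1)])
  fix n and u :: "nat \<Rightarrow> real \<times> (nat \<Rightarrow> 'a)" and a
  assume u: "\<forall>j. u j \<in> {0..} \<times> distinct_seqs n" and a: "a \<in> {0..} \<times> distinct_seqs n" and lim: "u \<longlonglongrightarrow> a"
  have "(\<lambda>j. mean_after_jump F (fst (u j)) (conf_of n (snd (u j)))) \<longlonglongrightarrow> mean_after_jump F (fst a) (conf_of n (snd a))"
  proof (rule tendsto_mean_after_jump[OF F K])
    show "0 \<le> fst (u j)" "snd (u j) \<in> distinct_seqs n" for j using u[rule_format, of j] by (auto simp: mem_Times_iff)
    show "0 \<le> fst a" "snd a \<in> distinct_seqs n" using a by (auto simp: mem_Times_iff)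
    show "(\<lambda>j. fst (u j)) \<longlonglongrightarrow> fst a" using lim by (rule tendsto_fst)
    show "(\<lambda>j. snd (u j) i) \<longlonglongrightarrow> snd a i" for i
      by (rule continuous_on_tendsto_compose[OF continuous_on_product_coordinates tendsto_snd[OF lim]]) auto
  qed
  moreover have "(\<integral>\<omega>. F \<omega> \<partial>Q s \<eta>) = mean_after_jump F s \<eta>" if "0 \<le> s" for s \<eta>
    by (rule integral_transition_nonneg(3)[OF that Fm F(2,3) K])
  ultimately show "(\<lambda>j. (\<lambda>(t, x). (\<lambda>(t, \<eta>). \<integral>\<omega>. F \<omega> \<partial>Q t \<eta>) (t, conf_of n x)) (u j))
      \<longlonglongrightarrow> (\<lambda>(t, x). (\<lambda>(t, \<eta>). \<integral>\<omega>. F \<omega> \<partial>Q t \<eta>) (t, conf_of n x)) a"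
    using u a by (simp add: split_beta mem_Times_iff)
qed

lemma condition_C_transition: "condition_C lyapunov Q"
  unfolding condition_C_def
proof (intro allI impI)
  fix F :: "'a fset \<Rightarrow> real"
  assume "continuous_on UNIV F \<and> bdd_above (range (\<lambda>\<eta>. \<bar>F \<eta>\<bar> / (1 + lyapunov \<eta>)))"
  then obtain K where F: "continuous_on UNIV F" and K: "\<And>\<eta>. \<bar>F \<eta>\<bar> / (1 + lyapunov \<eta>) \<le> K"
    by (auto simp: bdd_above_def)
  have K0: "0 \<le> K" using K[of "{||}"] by (simp add: lyapunov_def fcard.rep_eq) 
  have le: "\<bar>F \<eta>\<bar> \<le> K * (1 + lyapunov \<eta>)" for \<eta>
    using K[of \<eta>] lyapunov_nonneg[of \<eta>] by (simp add: divide_le_eq)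
  \<comment> \<open>The expansion of the integral is available for nonnegative functions.\<close>
  define P where "P \<eta> = max 0 (F \<eta>)" for \<eta>
  define N where "N \<eta> = max 0 (- F \<eta>)" for \<eta>
  have P: "continuous_on UNIV P" "\<And>\<eta>. 0 \<le> P \<eta>" "\<And>\<eta>. P \<eta> \<le> K * (1 + lyapunov \<eta>)"
    and N: "continuous_on UNIV N" "\<And>\<eta>. 0 \<le> N \<eta>" "\<And>\<eta>. N \<eta> \<le> K * (1 + lyapunov \<eta>)"
  proof -
    show "P \<eta> \<le> K * (1 + lyapunov \<eta>)" "N \<eta> \<le> K * (1 + lyapunov \<eta>)" for \<eta>
      using le[of \<eta>] unfolding P_def N_def by linarith+
  qed (auto simp: P_def[abs_def] N_def[abs_def] intro!: continuous_intros F)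
  have F_eq: "F = (\<lambda>\<eta>. P \<eta> - N \<eta>)" by (auto simp: P_def N_def)
  have PN: "integrable (Q t \<eta>) P" "integrable (Q t \<eta>) N" if "0 \<le> t" for t \<eta>
    using integral_transition_nonneg(2)[OF that _ P(2,3) K0] integral_transition_nonneg(2)[OF that _ N(2,3) K0]
      borel_measurable_continuous_onI[OF P(1)] borel_measurable_continuous_onI[OF N(1)] by auto
  show "(\<forall>t\<ge>0. \<forall>\<eta>. integrable (Q t \<eta>) F) \<and>
      continuous_on ({0..} \<times> UNIV) (\<lambda>(t, \<eta>). \<integral>\<omega>. F \<omega> \<partial>Q t \<eta>)"
  proof
    show "\<forall>t\<ge>0. \<forall>\<eta>. integrable (Q t \<eta>) F"
      unfolding F_eq by (intro allI impI Bochner_Integration.integrable_diff PN)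
    have "continuous_on ({0..} \<times> UNIV)
        (\<lambda>p. (\<lambda>(t, \<eta>). \<integral>\<omega>. P \<omega> \<partial>Q t \<eta>) p - (\<lambda>(t, \<eta>). \<integral>\<omega>. N \<omega> \<partial>Q t \<eta>) p)"
      by (intro continuous_on_diff continuous_on_integral_transition_nonneg[OF P K0]
          continuous_on_integral_transition_nonneg[OF N K0])
    then show "continuous_on ({0..} \<times> UNIV) (\<lambda>(t, \<eta>). \<integral>\<omega>. F \<omega> \<partial>Q t \<eta>)"
      by (rule continuous_on_eq) (auto simp: F_eq Bochner_Integration.integral_diff[OF PN])
  qed
qed

section \<open>Tightness of the transition function\<close>

text \<open>
  Tightness that is uniform over \<open>[0, T] \<times> B\<close> comes from Dini's argument applied to the integrals of cut-off
  functions that see only configurations of large spread.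
\<close>

lemma condition_A_transition: "condition_A Q"
  unfolding condition_A_def
proof (intro allI impI)
  fix \<epsilon> T :: real and B :: "'a fset set"
  assume \<epsilon>: "0 < \<epsilon>" and T: "0 < T" and B: "compact B"
  \<comment> \<open>Half of \<open>\<epsilon> / T\<close>, since the time integral has to be strictly smaller than \<open>\<epsilon>\<close>.\<close>
  define \<delta> where "\<delta> = \<epsilon> / (2 * T)"
  have \<delta>: "0 < \<delta>" using \<epsilon> T by (simp add: \<delta>_def)
  define \<phi> where "\<phi> n \<omega> = max 0 (min 1 (spread \<omega> - real n))" for n :: nat and \<omega> :: "'a fset"
  have \<phi>: "continuous_on UNIV (\<phi> n)" "\<And>\<omega>. 0 \<le> \<phi> n \<omega>" "\<And>\<omega>. \<phi> n \<omega> \<le> 1 * (1 + lyapunov \<omega>)" for n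
    unfolding \<phi>_def by (auto intro!: continuous_intros continuous_on_spread simp: lyapunov_nonneg add_increasing2)
  have \<phi>m: "\<phi> n \<in> borel_measurable borel" for n
    by (rule borel_measurable_continuous_onI[OF \<phi>(1)])
  note \<phi>_int = integral_transition_nonneg[OF _ \<phi>m \<phi>(2,3) zero_le_one]
  define \<Phi> where "\<Phi> n = (\<lambda>(t, \<eta>). \<integral>\<omega>. \<phi> n \<omega> \<partial>Q t \<eta>)" for n
  have cont: "continuous_on ({0..} \<times> UNIV) (\<Phi> n)" for n
    unfolding \<Phi>_def by (rule continuous_on_integral_transition_nonneg[OF \<phi> zero_le_one])
  have decr: "\<Phi> n' (t, \<eta>) \<le> \<Phi> n (t, \<eta>)" if "n \<le> n'" "0 \<le> t" for n n' t \<eta>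
    unfolding \<Phi>_def using that by (auto intro!: integral_mono \<phi>_int simp: \<phi>_def)
  have small: "\<exists>n. \<Phi> n (t, \<eta>) < \<delta>" if t: "0 \<le> t" for t \<eta>
  proof -
    have "(\<lambda>n. \<integral>\<omega>. \<phi> n \<omega> \<partial>Q t \<eta>) \<longlonglongrightarrow> (\<integral>\<omega>. 0 \<partial>Q t \<eta>)"
    proof (rule integral_dominated_convergence[where w="\<lambda>_. 1"])
      show "integrable (Q t \<eta>) (\<lambda>_. 1 :: real)"
        by (rule integral_transition_nonneg(2)[OF t, where K=1]) (auto simp: lyapunov_nonneg)
      show "\<phi> n \<in> borel_measurable (Q t \<eta>)" for n
        using \<phi>_int(2)[OF t] by auto
      show "AE \<omega> in Q t \<eta>. (\<lambda>n. \<phi> n \<omega>) \<longlonglongrightarrow> 0"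
      proof (rule AE_I2)
        fix \<omega> :: "'a fset"
        obtain n0 where "spread \<omega> \<le> real n0" using real_arch_simple by blast
        then have "\<forall>\<^sub>F n in sequentially. \<phi> n \<omega> = 0"
          by (intro eventually_sequentiallyI[of n0]) (auto simp: \<phi>_def)
        then show "(\<lambda>n. \<phi> n \<omega>) \<longlonglongrightarrow> 0" by (rule tendsto_eventually)
      qed
    qed (auto simp: \<phi>_def)
    then have "(\<lambda>n. \<Phi> n (t, \<eta>)) \<longlonglongrightarrow> 0" by (simp add: \<Phi>_def)
    then have "\<forall>\<^sub>F n in sequentially. \<Phi> n (t, \<eta>) < \<delta>" using \<delta> by (rule order_tendstoD)
    then show ?thesis by (auto simp: eventually_sequentially)
  qed
  have "\<exists>A. open A \<and> A \<inter> {0..} \<times> UNIV = \<Phi> n -` {..<\<delta>} \<inter> {0..} \<times> UNIV" for n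
    using cont[of n] open_lessThan unfolding continuous_on_open_invariant by blast
  then obtain U where U: "\<And>n. open (U n)" "\<And>n. U n \<inter> {0..} \<times> UNIV = \<Phi> n -` {..<\<delta>} \<inter> {0..} \<times> UNIV"
    by metis
  have comp: "compact ({0..T} \<times> B)" by (intro compact_Times compact_Icc B)
  have cover: "{0..T} \<times> B \<subseteq> (\<Union>n\<in>UNIV. U n)"
  proof
    fix p assume "p \<in> {0..T} \<times> B"
    then obtain t \<eta> where p: "p = (t, \<eta>)" "0 \<le> t" by auto
    then obtain n where "\<Phi> n p < \<delta>" using small by blast
    then have "p \<in> \<Phi> n -` {..<\<delta>} \<inter> {0..} \<times> UNIV" using p by auto
    then show "p \<in> (\<Union>n\<in>UNIV. U n)" unfolding U(2)[symmetric] by auto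
  qed
  obtain I where I: "finite I" "{0..T} \<times> B \<subseteq> (\<Union>n\<in>I. U n)"
    using compactE_image[OF comp U(1) cover] by metis
  define n where "n = Max (insert 0 I)"
  have uniform: "\<Phi> n (t, \<eta>) < \<delta>" if t\<eta>: "t \<in> {0..T}" "\<eta> \<in> B" for t \<eta>
  proof -
    obtain k where k: "k \<in> I" "(t, \<eta>) \<in> U k"
      using subsetD[OF I(2), of "(t, \<eta>)"] t\<eta> by auto
    have "(t, \<eta>) \<in> \<Phi> k -` {..<\<delta>} \<inter> {0..} \<times> UNIV"
      unfolding U(2)[symmetric] using k t\<eta> by auto
    then have "\<Phi> k (t, \<eta>) < \<delta>" by simp
    moreover have "k \<le> n" using k I(1) by (auto simp: n_def)
    then have "\<Phi> n (t, \<eta>) \<le> \<Phi> k (t, \<eta>)" using t\<eta> by (intro decr) auto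
    ultimately show ?thesis by simp
  qed
  obtain A :: "'a fset set" where A: "compact A" "\<And>\<omega>. spread \<omega> \<le> real n + 1 \<Longrightarrow> \<omega> \<in> A"
    using spread_sublevel_in_compact by blast
  \<comment> \<open>Off \<open>A\<close> the spread exceeds \<open>n + 1\<close>, where the cut-off function equals \<open>1\<close>.\<close>
  have escape: "emeasure (Q t \<eta>) (- A) \<le> ennreal \<delta>" if t: "t \<in> {0..T}" and \<eta>: "\<eta> \<in> B" for t \<eta>
  proof (cases "- A \<in> sets (Q t \<eta>)")
    case True
    then have "emeasure (Q t \<eta>) (- A) = (\<integral>\<^sup>+\<omega>. indicator (- A) \<omega> \<partial>Q t \<eta>)" by simp
    also have "\<dots> \<le> (\<integral>\<^sup>+\<omega>. ennreal (\<phi> n \<omega>) \<partial>Q t \<eta>)"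
    proof (rule nn_integral_mono)
      fix \<omega> :: "'a fset"
      show "indicator (- A) \<omega> \<le> ennreal (\<phi> n \<omega>)"
      proof (cases "\<omega> \<in> A")
        case False
        then have "\<not> spread \<omega> \<le> real n + 1" using A(2) by blast
        then have "\<phi> n \<omega> = 1" by (simp add: \<phi>_def)
        then show ?thesis by (simp add: indicator_def)
      qed simp
    qed
    also have "\<dots> = ennreal (\<Phi> n (t, \<eta>))"
      using \<phi>_int(1,3)[of t \<eta> n] t by (simp add: \<Phi>_def)
    also have "\<dots> \<le> ennreal \<delta>" using uniform[OF t \<eta>] by (intro ennreal_leI) simp
    finally show ?thesis .
  qed (simp add: emeasure_notin_sets)
  have "(\<integral>\<^sup>+r\<in>{0..T}. emeasure (Q r \<eta>) (- A) \<partial>lborel) < ennreal \<epsilon>" if \<eta>: "\<eta> \<in> B" for \<eta>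
  proof -
    have "(\<integral>\<^sup>+r\<in>{0..T}. emeasure (Q r \<eta>) (- A) \<partial>lborel) \<le> (\<integral>\<^sup>+r. ennreal \<delta> * indicator {0..T} r \<partial>lborel)"
      using escape[OF _ \<eta>] by (intro nn_integral_mono) (auto simp: indicator_def)
    also have "\<dots> = ennreal \<delta> * ennreal T"
      using T by (subst nn_integral_cmult_indicator) auto
    also have "\<dots> = ennreal (\<epsilon> / 2)"
      using T \<epsilon> by (simp add: ennreal_mult'[symmetric] \<delta>_def)
    also have "\<dots> < ennreal \<epsilon>" using \<epsilon> by (intro ennreal_lessI) auto
    finally show ?thesis .
  qed
  then show "\<exists>A. compact A \<and> (\<forall>\<eta>\<in>B. (\<integral>\<^sup>+r\<in>{0..T}. emeasure (Q r \<eta>) (- A) \<partial>lborel) < ennreal \<epsilon>)"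
    using A(1) by blast
qed

end

theorem theorem3p8:
  fixes m am l bp ap :: "real \<times> 'a::euclidean_space \<Rightarrow> real"
  assumes "nonneg_Cb m" and "nonneg_Cb l" and "nonneg_Cb am" and "nonneg_Cb bp"
    and "\<And>t. t \<ge> 0 \<Longrightarrow> prob_density (\<lambda>x. ap (t, x))"
    and "narrowly_continuous ap"
    and "\<And>\<Lambda> T. compact \<Lambda> \<Longrightarrow> T > 0 \<Longrightarrow>
          \<exists>a_star :: 'a \<Rightarrow> real. integrable lborel a_star \<and>
            (\<forall>x\<in>\<Lambda>. \<forall>t\<in>{0..T}. \<forall>y. ap (t, x - y) \<le> a_star y)"
    and "\<And>t x. t \<ge> 0 \<Longrightarrow> bp (t, x) \<le> am (t, x)"
  shows "condition_A (transition m am l bp ap)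
       \<and> condition_B lyapunov (transition m am l bp ap)
       \<and> condition_C lyapunov (transition m am l bp ap)
       \<and> condition_D lyapunov (transition m am l bp ap)"
proof -
  interpret continuous_birth_death_rates m am l bp ap
    by standard (fact assms)+
  show ?thesis
    using condition_A_transition condition_B_transition[OF assms(8)] condition_C_transition
      condition_D_transition by blast
qed

end
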